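(* Let $(M,g)$ be a compact, connected, oriented Riemannian manifold of positive dimension. Let $J^{T\mathcal{D}}$ be the almost complex structure on $T\mathcal{D}$ associated via Dombrowski's construction to $(g^{\mathcal{D}},\nabla^{\mathcal{D}})$, where $(g^{\mathcal{D}})_\rho\big((\rho,\nabla\phi),(\rho,\nabla\phi')\big)=\int_M g(\nabla\phi,\nabla\phi')\rho\,d\mathrm{vol}_g$ and $\nabla^{\mathcal{D}}$ is the affine connection on $\mathcal{D}$ with connector $K^{\mathcal{D}}(\rho,\nabla\phi,\nabla\psi_1,\nabla\psi_2)=(\rho,\nabla\psi_2)$. Then $J^{T\mathcal{D}}$ is not integrable, i.e. its Nijenhuis tensor satisfies $N^{T\mathcal{D}}\not\equiv0$.
   Context: $d\mathrm{vol}_g$ is the Riemannian volume form. $\mathcal{D}:=\{\rho\in C^\infty(M,\mathbb{R}) : \rho>0,\ \int_M\rho\,d\mathrm{vol}_g=1\}$, a Fréchet submanifold of $C^\infty(M,\mathbb{R})$ with $T_\rho\mathcal{D}\cong\{f\in C^\infty(M,\mathbb{R}):\int_M f\,d\mathrm{vol}_g=0\}$. $\nabla$ applied to a function is the Riemannian gradient and $\nabla C^\infty(M)$ is the space of gradient vector fields. Identifications: $T\mathcal{D}\cong\mathcal{D}\times\nabla C^\infty(M)$, where $(\rho,\nabla\phi)$ denotes $\mathrm{div}(\rho\nabla\phi)\in T_\rho\mathcal{D}$; and $T(T\mathcal{D})\cong\mathcal{D}\times\nabla C^\infty(M)^3$, where $(\rho,\nabla\phi,\nabla\psi_1,\nabla\psi_2)$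 denotes $\frac{d}{dt}\big|_{0}(\rho_t,\nabla\phi+t\nabla\psi_2)\in T_{(\rho,\nabla\phi)}T\mathcal{D}$, with $\rho_t$ a smooth curve in $\mathcal{D}$, $\rho_0=\rho$, $\frac{d}{dt}\big|_0\rho_t=\mathrm{div}(\rho\nabla\psi_1)$. Dombrowski's construction writes $A\in T_uT\mathcal{D}$ as $(u,v,w)$ with horizontal part $v=\pi_*A$ ($\pi:T\mathcal{D}\to\mathcal{D}$) and vertical part $w=K^{\mathcal{D}}A$, and sets $J^{T\mathcal{D}}(u,v,w)=(u,-w,v)$; here $J^{T\mathcal{D}}(\rho,\nabla\phi,\nabla\psi_1,\nabla\psi_2)=(\rho,\nabla\phi,-\nabla\psi_2,\nabla\psi_1)$. The Nijenhuis tensor is $N^{T\mathcal{D}}(X,Y):=[X,Y]-[J^{T\mathcal{D}}X,J^{T\mathcal{D}}Y]+J^{T\mathcal{D}}[J^{T\mathcal{D}}X,Y]+J^{T\mathcal{D}}[X,J^{T\mathcal{D}}Y]$ for $X,Y\in\mathfrak{X}(T\mathcal{D})$. *)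

theory Defs
  imports "HOL-Analysis.Analysis" "HOL-Library.Function_Algebras"
begin

section \<open>Pointwise vector space structure on functions\<close>

instantiation "fun" :: (type, real_vector) real_vector
begin

definition "scaleR r f = (\<lambda>x. r *\<^sub>R f x)"

instance
  by standard (simp_all add: scaleR_fun_def fun_eq_iff algebra_simps)

end

lemma scaleR_fun_apply [simp]: "(r *\<^sub>R f) x = r *\<^sub>R f x"
  by (simp add: scaleR_fun_def)


section \<open>Calculus in Frechet spaces\<close>

text \<open>The locally convex topology on the vector subspace \<open>E\<close> given by a family \<open>P\<close> of seminorms.\<close>

definition seminorm_topology :: "'v::real_vector set \<Rightarrow> ('v \<Rightarrow> real) set \<Rightarrow> 'v topology" where
  "seminorm_topology E P =
     topology_generated_by {{y \<in> E. p (y - x) < e} | p x e. p \<in> P \<and> x \<in> E \<and> 0 < e}"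

definition has_dir_deriv ::
  "'w::real_vector topology \<Rightarrow> ('v::real_vector \<Rightarrow> 'w) \<Rightarrow> 'v \<Rightarrow> 'v \<Rightarrow> 'w \<Rightarrow> bool" where
  "has_dir_deriv T F u v l \<longleftrightarrow>
     limitin T (\<lambda>t::real. (1 / t) *\<^sub>R (F (u + t *\<^sub>R v) - F u)) l (at 0)"

definition dir_deriv ::
  "'w::real_vector topology \<Rightarrow> ('v::real_vector \<Rightarrow> 'w) \<Rightarrow> 'v \<Rightarrow> 'v \<Rightarrow> 'w" where
  "dir_deriv T F u v = (THE l. has_dir_deriv T F u v l)"

text \<open>\<open>iter_dir_deriv T F k u v\<close> is \<open>D\<^sup>kF(u){v 0, \<dots>, v (k - 1)}\<close>.\<close>

primrec iter_dir_deriv ::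
  "'w::real_vector topology \<Rightarrow> ('v::real_vector \<Rightarrow> 'w) \<Rightarrow> nat \<Rightarrow> 'v \<Rightarrow> (nat \<Rightarrow> 'v) \<Rightarrow> 'w" where
  "iter_dir_deriv T F 0 = (\<lambda>u v. F u)"
| "iter_dir_deriv T F (Suc k) =
     (\<lambda>u v. dir_deriv T (\<lambda>z. iter_dir_deriv T F k z v) u (v k))"

text \<open>Smoothness in the sense of Michal, Bastiani and Hamilton: all iterated directional derivatives
  exist and are jointly continuous \<open>U \<times> E\<^sup>k \<rightarrow> F\<close>. Here \<open>TU\<close> is the topology of the domain \<open>U\<close>, a
  relatively open subset of an affine space modelled on the Frechet space with topology \<open>TE\<close>, and
  \<open>TF\<close> is the topology of the target Frechet space.\<close>

definition frechet_smooth ::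
  "'v::real_vector topology \<Rightarrow> 'v topology \<Rightarrow> 'w::real_vector topology \<Rightarrow> ('v \<Rightarrow> 'w) \<Rightarrow> bool" where
  "frechet_smooth TU TE TF F \<longleftrightarrow>
     (\<forall>k. (\<forall>u \<in> topspace TU. \<forall>v. (\<forall>i \<le> k. v i \<in> topspace TE) \<longrightarrow>
              has_dir_deriv TF (\<lambda>z. iter_dir_deriv TF F k z v) u (v k)
                (iter_dir_deriv TF F (Suc k) u v)) \<and>
          continuous_map (prod_topology TU (product_topology (\<lambda>_. TE) {..<k})) TF
            (\<lambda>(u, v). iter_dir_deriv TF F k u v))"


section \<open>Smooth manifolds and Riemannian metrics\<close>

text \<open>A chart is a pair of its open domain and its coordinate map; only the values of the coordinate
  map on the domain matter.\<close>

type_synonym ('a, 'n) chart = "'a set \<times> ('a \<Rightarrow> real ^ 'n)"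

abbreviation patch :: "('a, 'n) chart \<Rightarrow> 'a set" where "patch c \<equiv> fst c"
abbreviation coord :: "('a, 'n) chart \<Rightarrow> 'a \<Rightarrow> real ^ 'n" where "coord c \<equiv> snd c"

definition in_chart :: "('a, 'n::finite) chart \<Rightarrow> ('a \<Rightarrow> 'w) \<Rightarrow> real ^ 'n \<Rightarrow> 'w" where
  "in_chart c h = (\<lambda>y. h (inv_into (patch c) (coord c) y))"

definition partial_deriv ::
  "'n::finite \<Rightarrow> (real ^ 'n \<Rightarrow> 'w::real_normed_vector) \<Rightarrow> real ^ 'n \<Rightarrow> 'w" where
  "partial_deriv i h y = frechet_derivative h (at y) (axis i 1)"

primrec iter_partial ::
  "'n::finite list \<Rightarrow> (real ^ 'n \<Rightarrow> 'w::real_normed_vector) \<Rightarrow> real ^ 'n \<Rightarrow> 'w" where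
  "iter_partial [] h = h"
| "iter_partial (i # is) h = partial_deriv i (iter_partial is h)"

text \<open>\<open>C\<^sup>\<infinity>\<close> on an open set \<open>S\<close>.\<close>

definition smooth_on :: "(real ^ 'n::finite) set \<Rightarrow> (real ^ 'n \<Rightarrow> 'w::real_normed_vector) \<Rightarrow> bool" where
  "smooth_on S h \<longleftrightarrow> (\<forall>is. \<forall>y \<in> S. iter_partial is h differentiable (at y))"

text \<open>Jacobian matrix at \<open>p\<close> of the change of coordinates from \<open>c\<close> to \<open>c'\<close>.\<close>

definition transition_jacobian ::
  "('a, 'n::finite) chart \<Rightarrow> ('a, 'n) chart \<Rightarrow> 'a \<Rightarrow> real ^ 'n ^ 'n" where
  "transition_jacobian c c' p =
     matrix (frechet_derivative (in_chart c (coord c')) (at (coord c p)))"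

text \<open>A compact, connected, oriented smooth manifold of dimension \<open>CARD('n) \<ge> 1\<close>, whose points are
  the elements of the type \<open>'a\<close>, with a Riemannian metric. Second countability is automatic by
  compactness. The smooth structure and the orientation are given by an atlas whose transition maps
  are smooth with positive Jacobian determinant. The matrix \<open>g c p\<close> is \<open>(g\<^sub>i\<^sub>j(p))\<close> in the
  chart \<open>c\<close>; the assumption \<open>metric_transform\<close> says that these matrices define one bilinear
  form on \<open>T\<^sub>pM\<close>.\<close>

locale closed_oriented_riemannian_manifold =
  fixes A :: "('a::t2_space, 'n::finite) chart set"
    and g :: "('a, 'n) chart \<Rightarrow> 'a \<Rightarrow> real ^ 'n ^ 'n"
  assumes compact_M: "compact (UNIV :: 'a set)"
    and connected_M: "connected (UNIV :: 'a set)"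
    and charts_cover: "(\<Union>c\<in>A. patch c) = UNIV"
    and open_patch: "c \<in> A \<Longrightarrow> open (patch c)"
    and open_coord_image: "c \<in> A \<Longrightarrow> open (coord c ` patch c)"
    and chart_homeomorphism: "c \<in> A \<Longrightarrow>
      homeomorphism (patch c) (coord c ` patch c) (coord c) (inv_into (patch c) (coord c))"
    and transition_smooth: "c \<in> A \<Longrightarrow> c' \<in> A \<Longrightarrow>
      smooth_on (coord c ` (patch c \<inter> patch c')) (in_chart c (coord c'))"
    and oriented: "c \<in> A \<Longrightarrow> c' \<in> A \<Longrightarrow> p \<in> patch c \<inter> patch c' \<Longrightarrow>
      0 < det (transition_jacobian c c' p)"
    and metric_symmetric: "c \<in> A \<Longrightarrow> p \<in> patch c \<Longrightarrow> transpose (g c p) = g c p"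
    and metric_pos_def: "c \<in> A \<Longrightarrow> p \<in> patch c \<Longrightarrow> v \<noteq> 0 \<Longrightarrow> 0 < v \<bullet> (g c p *v v)"
    and metric_smooth: "c \<in> A \<Longrightarrow> smooth_on (coord c ` patch c) (in_chart c (g c))"
    and metric_transform: "c \<in> A \<Longrightarrow> c' \<in> A \<Longrightarrow> p \<in> patch c \<inter> patch c' \<Longrightarrow>
      v \<bullet> (g c p *v w) =
      (transition_jacobian c c' p *v v) \<bullet> (g c' p *v (transition_jacobian c c' p *v w))"

definition chart_at :: "('a, 'n) chart set \<Rightarrow> 'a \<Rightarrow> ('a, 'n) chart" where
  "chart_at A p = (SOME c. c \<in> A \<and> p \<in> patch c)"

definition smooth_functions :: "('a, 'n::finite) chart set \<Rightarrow> ('a \<Rightarrow> real) set" where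
  "smooth_functions A = {f. \<forall>c\<in>A. smooth_on (coord c ` patch c) (in_chart c f)}"

text \<open>The measure given by the volume form \<open>dvol\<^sub>g\<close>: in a chart of the oriented atlas the volume form
  is \<open>sqrt (det (g\<^sub>i\<^sub>j)) dx\<^sup>1 \<and> \<dots> \<and> dx\<^sup>n\<close>, so it integrates as the density
  \<open>sqrt (det (g\<^sub>i\<^sub>j))\<close>.\<close>

definition riemannian_volume ::
  "('a::t2_space, 'n::finite) chart set \<Rightarrow> (('a, 'n) chart \<Rightarrow> 'a \<Rightarrow> real ^ 'n ^ 'n) \<Rightarrow> 'a measure" where
  "riemannian_volume A g = (THE \<mu>. sets \<mu> = sets borel \<and>
     (\<forall>c\<in>A. \<forall>B\<in>sets borel. B \<subseteq> patch c \<longrightarrow>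
        emeasure \<mu> B =
        (\<integral>\<^sup>+ y \<in> coord c ` B. ennreal (sqrt (det (in_chart c (g c) y))) \<partial>lborel)))"

text \<open>A vector field is given by its components: \<open>V c p\<close> is \<open>(V\<^sup>1(p), \<dots>, V\<^sup>n(p))\<close> in
  the chart \<open>c\<close>, and \<open>0\<close> when \<open>c\<close> is not a chart of the atlas around \<open>p\<close>, so that equality of
  vector fields is equality of functions.\<close>

type_synonym ('a, 'n) vfield = "('a, 'n) chart \<Rightarrow> 'a \<Rightarrow> real ^ 'n"

definition grad ::
  "('a, 'n::finite) chart set \<Rightarrow> (('a, 'n) chart \<Rightarrow> 'a \<Rightarrow> real ^ 'n ^ 'n) \<Rightarrow>
   ('a \<Rightarrow> real) \<Rightarrow> ('a, 'n) vfield" where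
  "grad A g f = (\<lambda>c p. if c \<in> A \<and> p \<in> patch c
     then (THE v. \<forall>w. v \<bullet> (g c p *v w) = frechet_derivative (in_chart c f) (at (coord c p)) w)
     else 0)"

definition gradient_fields ::
  "('a, 'n::finite) chart set \<Rightarrow> (('a, 'n) chart \<Rightarrow> 'a \<Rightarrow> real ^ 'n ^ 'n) \<Rightarrow> ('a, 'n) vfield set" where
  "gradient_fields A g = grad A g ` smooth_functions A"

text \<open>The divergence, defined by \<open>L\<^sub>V dvol\<^sub>g = div V dvol\<^sub>g\<close>; with
  \<open>w = sqrt (det (g\<^sub>i\<^sub>j))\<close>, evaluating \<open>L\<^sub>V (w dx\<^sup>1 \<and> \<dots> \<and> dx\<^sup>n)\<close> in a chart gives
  \<open>div V = (\<Sum>i. \<partial>\<^sub>i (w V\<^sup>i)) / w\<close>. The value does not depend on the chart.\<close>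

definition divergence ::
  "('a, 'n::finite) chart set \<Rightarrow> (('a, 'n) chart \<Rightarrow> 'a \<Rightarrow> real ^ 'n ^ 'n) \<Rightarrow>
   ('a, 'n) vfield \<Rightarrow> 'a \<Rightarrow> real" where
  "divergence A g V p = (let c = chart_at A p in
     (\<Sum>i\<in>UNIV. partial_deriv i (in_chart c (\<lambda>q. sqrt (det (g c q)) * V c q $ i)) (coord c p))
       / sqrt (det (g c p)))"

text \<open>The function \<open>p \<mapsto> g\<^sub>p(V p, W p)\<close>.\<close>

definition metric_pairing ::
  "('a, 'n::finite) chart set \<Rightarrow> (('a, 'n) chart \<Rightarrow> 'a \<Rightarrow> real ^ 'n ^ 'n) \<Rightarrow>
   ('a, 'n) vfield \<Rightarrow> ('a, 'n) vfield \<Rightarrow> 'a \<Rightarrow> real" where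
  "metric_pairing A g V W p = (let c = chart_at A p in V c p \<bullet> (g c p *v W c p))"


section \<open>The \<open>C\<^sup>\<infinity>\<close> topologies\<close>

text \<open>Uniform convergence of all partial derivatives on compact subsets of charts.\<close>

definition chart_seminorm ::
  "('a, 'n::finite) chart \<Rightarrow> (real ^ 'n) set \<Rightarrow> 'n list \<Rightarrow> ('a \<Rightarrow> 'w::real_normed_vector) \<Rightarrow> real" where
  "chart_seminorm c K is h = (SUP y\<in>K. norm (iter_partial is (in_chart c h) y))"

definition smooth_topology :: "('a, 'n::finite) chart set \<Rightarrow> ('a \<Rightarrow> real) topology" where
  "smooth_topology A = seminorm_topology (smooth_functions A)
     {chart_seminorm c K is | c K is. c \<in> A \<and> compact K \<and> K \<noteq> {} \<and> K \<subseteq> coord c ` patch c}"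

definition gradient_topology ::
  "('a, 'n::finite) chart set \<Rightarrow> (('a, 'n) chart \<Rightarrow> 'a \<Rightarrow> real ^ 'n ^ 'n) \<Rightarrow>
   ('a, 'n) vfield topology" where
  "gradient_topology A g = seminorm_topology (gradient_fields A g)
     {\<lambda>V. chart_seminorm c K is (V c) | c K is.
        c \<in> A \<and> compact K \<and> K \<noteq> {} \<and> K \<subseteq> coord c ` patch c}"


section \<open>The manifold of densities and its tangent bundle\<close>

definition densities ::
  "('a::t2_space, 'n::finite) chart set \<Rightarrow> (('a, 'n) chart \<Rightarrow> 'a \<Rightarrow> real ^ 'n ^ 'n) \<Rightarrow>
   ('a \<Rightarrow> real) set" where
  "densities A g = {\<rho> \<in> smooth_functions A.
     (\<forall>p. 0 < \<rho> p) \<and> (\<integral>p. \<rho> p \<partial>riemannian_volume A g) = 1}"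

text \<open>The tangent space \<open>T\<^sub>\<rho>D\<close>, which is the same for all densities \<open>\<rho>\<close>.\<close>

definition zero_mean ::
  "('a::t2_space, 'n::finite) chart set \<Rightarrow> (('a, 'n) chart \<Rightarrow> 'a \<Rightarrow> real ^ 'n ^ 'n) \<Rightarrow>
   ('a \<Rightarrow> real) set" where
  "zero_mean A g = {f \<in> smooth_functions A. (\<integral>p. f p \<partial>riemannian_volume A g) = 0}"

text \<open>The identification \<open>TD \<cong> D \<times> \<nabla>C\<^sup>\<infinity>(M)\<close>: the pair \<open>(\<rho>, V)\<close>
  denotes the tangent vector \<open>div (\<rho> V)\<close> at \<open>\<rho>\<close>. We work with the right hand side as a manifold;
  it is a relatively open subset of an affine subspace of
  \<open>C\<^sup>\<infinity>(M) \<times> \<nabla>C\<^sup>\<infinity>(M)\<close>.\<close>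

definition TD_vec ::
  "('a, 'n::finite) chart set \<Rightarrow> (('a, 'n) chart \<Rightarrow> 'a \<Rightarrow> real ^ 'n ^ 'n) \<Rightarrow>
   ('a \<Rightarrow> real) \<Rightarrow> ('a, 'n) vfield \<Rightarrow> 'a \<Rightarrow> real" where
  "TD_vec A g \<rho> V = divergence A g (\<lambda>c p. \<rho> p *\<^sub>R V c p)"

type_synonym ('a, 'n) TD_point = "('a \<Rightarrow> real) \<times> ('a, 'n) vfield"

definition TD ::
  "('a::t2_space, 'n::finite) chart set \<Rightarrow> (('a, 'n) chart \<Rightarrow> 'a \<Rightarrow> real ^ 'n ^ 'n) \<Rightarrow>
   ('a, 'n) TD_point set" where
  "TD A g = densities A g \<times> gradient_fields A g"

definition TD_topology ::
  "('a::t2_space, 'n::finite) chart set \<Rightarrow> (('a, 'n) chart \<Rightarrow> 'a \<Rightarrow> real ^ 'n ^ 'n) \<Rightarrow>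
   ('a, 'n) TD_point topology" where
  "TD_topology A g =
     prod_topology (subtopology (smooth_topology A) (densities A g)) (gradient_topology A g)"

text \<open>The tangent space of \<open>D \<times> \<nabla>C\<^sup>\<infinity>(M)\<close> at any point: \<open>(f, W)\<close> is the velocity at
  \<open>t = 0\<close> of \<open>(\<rho>\<^sub>t, \<nabla>\<phi> + t W)\<close>, where \<open>f = d/dt \<rho>\<^sub>t\<close>. The quadruple
  \<open>(\<rho>, \<nabla>\<phi>, \<nabla>\<psi>\<^sub>1, \<nabla>\<psi>\<^sub>2)\<close> is therefore the tangent vector
  \<open>(TD_vec A g \<rho> (\<nabla>\<psi>\<^sub>1), \<nabla>\<psi>\<^sub>2)\<close> at \<open>(\<rho>, \<nabla>\<phi>)\<close>.\<close>

definition TTD ::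
  "('a::t2_space, 'n::finite) chart set \<Rightarrow> (('a, 'n) chart \<Rightarrow> 'a \<Rightarrow> real ^ 'n ^ 'n) \<Rightarrow>
   ('a, 'n) TD_point set" where
  "TTD A g = zero_mean A g \<times> gradient_fields A g"

definition TTD_topology ::
  "('a::t2_space, 'n::finite) chart set \<Rightarrow> (('a, 'n) chart \<Rightarrow> 'a \<Rightarrow> real ^ 'n ^ 'n) \<Rightarrow>
   ('a, 'n) TD_point topology" where
  "TTD_topology A g =
     prod_topology (subtopology (smooth_topology A) (zero_mean A g)) (gradient_topology A g)"

text \<open>The smooth vector fields on \<open>TD\<close>, as maps into the model space.\<close>

definition vector_fields_TD ::
  "('a::t2_space, 'n::finite) chart set \<Rightarrow> (('a, 'n) chart \<Rightarrow> 'a \<Rightarrow> real ^ 'n ^ 'n) \<Rightarrow>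
   (('a, 'n) TD_point \<Rightarrow> ('a, 'n) TD_point) set" where
  "vector_fields_TD A g = {X. (\<forall>u \<in> TD A g. X u \<in> TTD A g) \<and>
     frechet_smooth (TD_topology A g) (TTD_topology A g) (TTD_topology A g) X}"

definition lie_bracket ::
  "('a::t2_space, 'n::finite) chart set \<Rightarrow> (('a, 'n) chart \<Rightarrow> 'a \<Rightarrow> real ^ 'n ^ 'n) \<Rightarrow>
   (('a, 'n) TD_point \<Rightarrow> ('a, 'n) TD_point) \<Rightarrow> (('a, 'n) TD_point \<Rightarrow> ('a, 'n) TD_point) \<Rightarrow>
   ('a, 'n) TD_point \<Rightarrow> ('a, 'n) TD_point" where
  "lie_bracket A g X Y u =
     dir_deriv (TTD_topology A g) Y u (X u) - dir_deriv (TTD_topology A g) X u (Y u)"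


section \<open>Dombrowski's construction and the Nijenhuis tensor\<close>

text \<open>The metric \<open>g\<^sup>D\<close> on \<open>T\<^sub>\<rho>D\<close>, for tangent vectors
  \<open>f = div (\<rho> \<nabla>\<phi>)\<close> and \<open>f' = div (\<rho> \<nabla>\<phi>')\<close>.\<close>

definition metric_D ::
  "('a::t2_space, 'n::finite) chart set \<Rightarrow> (('a, 'n) chart \<Rightarrow> 'a \<Rightarrow> real ^ 'n ^ 'n) \<Rightarrow>
   ('a \<Rightarrow> real) \<Rightarrow> ('a \<Rightarrow> real) \<Rightarrow> ('a \<Rightarrow> real) \<Rightarrow> real" where
  "metric_D A g \<rho> f f' =
     (let V = (THE V. V \<in> gradient_fields A g \<and> TD_vec A g \<rho> V = f);
          V' = (THE V. V \<in> gradient_fields A g \<and> TD_vec A g \<rho> V = f')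
      in \<integral>p. metric_pairing A g V V' p * \<rho> p \<partial>riemannian_volume A g)"

text \<open>The connector \<open>K\<^sup>D(\<rho>, \<nabla>\<phi>, \<nabla>\<psi>\<^sub>1, \<nabla>\<psi>\<^sub>2) = (\<rho>, \<nabla>\<psi>\<^sub>2)\<close>: on a
  tangent vector \<open>(f, \<nabla>\<psi>\<^sub>2)\<close> at \<open>u = (\<rho>, \<nabla>\<phi>)\<close> its value is the element of
  \<open>T\<^sub>\<rho>D\<close> denoted by \<open>(\<rho>, \<nabla>\<psi>\<^sub>2)\<close>.\<close>

definition connector_D ::
  "('a, 'n::finite) chart set \<Rightarrow> (('a, 'n) chart \<Rightarrow> 'a \<Rightarrow> real ^ 'n ^ 'n) \<Rightarrow>
   ('a, 'n) TD_point \<Rightarrow> ('a, 'n) TD_point \<Rightarrow> 'a \<Rightarrow> real" where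
  "connector_D A g u B = TD_vec A g (fst u) (snd B)"

text \<open>The almost Hermitian structure on \<open>TD\<close> associated to a metric \<open>G\<close> on \<open>D\<close> and an affine
  connection on \<open>D\<close> with connector \<open>K\<close>. A tangent vector \<open>B\<close> at \<open>u\<close> has horizontal part
  \<open>\<pi>\<^sub>* B = fst B\<close> and vertical part \<open>K u B\<close>, both in \<open>T\<^sub>\<rho>D\<close>. The first component is the metric for
  which the two parts are orthogonal, the second is the almost complex structure
  \<open>J (u, v, w) = (u, -w, v)\<close>, which only depends on the connection.\<close>

definition dombrowski ::
  "('a::t2_space, 'n::finite) chart set \<Rightarrow> (('a, 'n) chart \<Rightarrow> 'a \<Rightarrow> real ^ 'n ^ 'n) \<Rightarrow>
   (('a \<Rightarrow> real) \<Rightarrow> ('a \<Rightarrow> real) \<Rightarrow> ('a \<Rightarrow> real) \<Rightarrow> real) \<Rightarrow>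
   (('a, 'n) TD_point \<Rightarrow> ('a, 'n) TD_point \<Rightarrow> 'a \<Rightarrow> real) \<Rightarrow>
   (('a, 'n) TD_point \<Rightarrow> ('a, 'n) TD_point \<Rightarrow> ('a, 'n) TD_point \<Rightarrow> real) \<times>
   (('a, 'n) TD_point \<Rightarrow> ('a, 'n) TD_point \<Rightarrow> ('a, 'n) TD_point)" where
  "dombrowski A g G K =
     (\<lambda>u B B'. G (fst u) (fst B) (fst B') + G (fst u) (K u B) (K u B'),
      \<lambda>u B. THE C. C \<in> TTD A g \<and> fst C = - K u B \<and> K u C = fst B)"

definition J_TD ::
  "('a::t2_space, 'n::finite) chart set \<Rightarrow> (('a, 'n) chart \<Rightarrow> 'a \<Rightarrow> real ^ 'n ^ 'n) \<Rightarrow>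
   ('a, 'n) TD_point \<Rightarrow> ('a, 'n) TD_point \<Rightarrow> ('a, 'n) TD_point" where
  "J_TD A g = snd (dombrowski A g (metric_D A g) (connector_D A g))"

definition nijenhuis ::
  "('a::t2_space, 'n::finite) chart set \<Rightarrow> (('a, 'n) chart \<Rightarrow> 'a \<Rightarrow> real ^ 'n ^ 'n) \<Rightarrow>
   (('a, 'n) TD_point \<Rightarrow> ('a, 'n) TD_point \<Rightarrow> ('a, 'n) TD_point) \<Rightarrow>
   (('a, 'n) TD_point \<Rightarrow> ('a, 'n) TD_point) \<Rightarrow> (('a, 'n) TD_point \<Rightarrow> ('a, 'n) TD_point) \<Rightarrow>
   ('a, 'n) TD_point \<Rightarrow> ('a, 'n) TD_point" where
  "nijenhuis A g J X Y u =
     (let JX = (\<lambda>z. J z (X z)); JY = (\<lambda>z. J z (Y z)) in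
      lie_bracket A g X Y u - lie_bracket A g JX JY u
      + J u (lie_bracket A g JX Y u) + J u (lie_bracket A g X JY u))"

end

theory Submission
  imports Defs
begin

text \<open>The Nijenhuis tensor is nonzero because gradient fields are not closed under the Lie bracket.

  Let \<open>a\<close> and \<open>b\<close> be gradient fields, regarded as the vertical vector fields \<open>(0, a)\<close> and \<open>(0, b)\<close>
  with constant components on \<open>TD\<close>. Then \<open>J\<close> maps \<open>(0, a)\<close> at \<open>(\<rho>, V)\<close> to \<open>(- div (\<rho> a), 0)\<close>, a
  field which is linear in \<open>\<rho>\<close> and independent of \<open>V\<close>. In the Nijenhuis tensor the bracket of the
  two constant fields and the two mixed brackets vanish, and what remains is
  \<open>(div (div (\<rho> b) a) - div (div (\<rho> a) b), 0)\<close> (\<open>nijenhuis_vertical\<close>), which up to sign is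
  \<open>div (\<rho> [a, b])\<close>. To see that it can be nonzero, let \<open>\<rho> = k\<close> be constant, \<open>b = \<nabla>s\<close> and
  \<open>a = \<nabla>(s\<^sup>3) = 3 s\<^sup>2 \<nabla>s\<close> for a function \<open>s\<close> with \<open>s = 0\<close> and \<open>\<nabla>s \<noteq> 0\<close> at a point \<open>p\<close>. All terms with
  a factor \<open>s\<close> vanish at \<open>p\<close>, and the value is \<open>- 6 k |\<nabla>s|\<^sup>4\<close> (\<open>commutator_at_zero\<close>).

  Constant vector fields are trivially smooth, and the directional derivatives in the brackets are
  those of affine functions, so of the Frechet topologies only the Hausdorff property enters, as
  uniqueness of limits. The substance is that \<open>J\<close> on vertical vectors is what the
  formula says (\<open>J_TD_vertical\<close>): \<open>div (\<rho> a)\<close> must have mean zero, and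
  \<open>div (\<rho> W) = 0\<close> must imply \<open>W = 0\<close> for gradient fields \<open>W\<close>. Both follow from the divergence
  theorem (\<open>divergence_integral_0\<close>), the second by the energy argument
  \<open>0 = - \<integral> \<phi> div (\<rho> \<nabla>\<phi>) = \<integral> \<rho> |\<nabla>\<phi>|\<^sup>2\<close>.

  The divergence theorem rests on integration by parts in a chart (\<open>chart_divergence_by_parts\<close>),
  and with it on the existence of the Riemannian measure (\<open>riemannian_volume_unique\<close>). Integration by
  parts also shows that the divergence does not depend on the chart (\<open>chart_divergence_unique\<close>):
  against a test function supported in the overlap of two charts, both versions of \<open>div V\<close> integrate
  to minus the integral of the derivative of the test function along \<open>V\<close>. This replaces a computation
  with derivatives of Jacobian determinants.\<close>

section \<open>Smooth functions on open subsets of Euclidean space\<close>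

lemma partial_deriv_eq:
  "(h has_derivative h') (at y) \<Longrightarrow> partial_deriv i h y = h' (axis i 1)"
  unfolding partial_deriv_def by (metis frechet_derivative_at)

lemma partial_deriv_cong:
  assumes "open S" "y \<in> S" "h differentiable (at y)" "\<And>z. z \<in> S \<Longrightarrow> h z = h' z"
  shows "partial_deriv i h y = partial_deriv i h' y"
  unfolding partial_deriv_def using frechet_derivative_transform_within_open assms by metis

lemma differentiable_cong_open:
  assumes "open S" "y \<in> S" "h differentiable (at y)" "\<And>z. z \<in> S \<Longrightarrow> h z = h' z"
  shows "h' differentiable (at y)"
  using assms unfolding differentiable_def by (meson has_derivative_transform_within_open)

lemma frechet_derivative_partial_sum:
  fixes h :: "real ^ 'n::finite \<Rightarrow> real"
  assumes "h differentiable (at y)"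
  shows "frechet_derivative h (at y) v = (\<Sum>i\<in>UNIV. v $ i * partial_deriv i h y)"
proof -
  have lin: "linear (frechet_derivative h (at y))"
    using assms by (rule linear_frechet_derivative)
  have "v = (\<Sum>i\<in>UNIV. v $ i *\<^sub>R axis i 1)"
    using basis_expansion[of v] by (simp add: scalar_mult_eq_scaleR)
  then have "frechet_derivative h (at y) v
      = frechet_derivative h (at y) (\<Sum>i\<in>UNIV. v $ i *\<^sub>R axis i 1)"
    by simp
  also have "\<dots> = (\<Sum>i\<in>UNIV. v $ i * partial_deriv i h y)"
    by (simp add: linear_sum[OF lin] linear_cmul[OF lin] partial_deriv_def)
  finally show ?thesis .
qed

lemma iter_partial_snoc: "iter_partial (is @ [i]) h = iter_partial is (partial_deriv i h)"
  by (induction "is") simp_all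

text \<open>Every closure property of smooth functions is an induction on the order of differentiation: a
  partial derivative of a product, a quotient or a composition is built by the same operations from
  functions of which one order less is needed. The list of indices in \<open>smooth_on\<close> does not support
  this induction, so it is replaced by the number of derivatives.\<close>

primrec times_diff :: "nat \<Rightarrow> (real ^ 'n::finite) set \<Rightarrow> (real ^ 'n \<Rightarrow> real) \<Rightarrow> bool" where
  "times_diff 0 S h = True"
| "times_diff (Suc k) S h =
     ((\<forall>y\<in>S. h differentiable (at y)) \<and> (\<forall>i. times_diff k S (partial_deriv i h)))"

lemma times_diff_iff_iter_partial:
  "times_diff k S h \<longleftrightarrow> (\<forall>is. length is < k \<longrightarrow> (\<forall>y\<in>S. iter_partial is h differentiable (at y)))"
proof (induction k arbitrary: h)
  case (Suc k)
  show ?case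
  proof
    assume L: "times_diff (Suc k) S h"
    show "\<forall>is. length is < Suc k \<longrightarrow> (\<forall>y\<in>S. iter_partial is h differentiable (at y))"
    proof (intro allI impI ballI)
      fix "is" y assume len: "length (is :: 'a list) < Suc k" and y: "y \<in> S"
      show "iter_partial is h differentiable (at y)"
      proof (cases "is" rule: rev_cases)
        case Nil then show ?thesis using L y by simp
      next
        case (snoc js j)
        then show ?thesis using L y len Suc.IH[of "partial_deriv j h"] by (simp add: iter_partial_snoc)
      qed
    qed
  next
    assume R: "\<forall>is. length is < Suc k \<longrightarrow> (\<forall>y\<in>S. iter_partial is h differentiable (at y))"
    have "h differentiable (at y)" if "y \<in> S" for y using R[rule_format, of "[]"] that by simp
    moreover have "times_diff k S (partial_deriv i h)" for i
      unfolding Suc.IH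
    proof (intro allI impI)
      fix "is" :: "'a list" assume "length is < k"
      then show "\<forall>y\<in>S. iter_partial is (partial_deriv i h) differentiable (at y)"
        using R[rule_format, of "is @ [i]"] by (simp add: iter_partial_snoc)
    qed
    ultimately show "times_diff (Suc k) S h" by simp
  qed
qed simp

lemma smooth_on_iff_times_diff: "smooth_on S h \<longleftrightarrow> (\<forall>k. times_diff k S h)"
  unfolding smooth_on_def times_diff_iff_iter_partial by auto

lemma times_diff_Suc_imp: "times_diff (Suc k) S h \<Longrightarrow> times_diff k S h"
  unfolding times_diff_iff_iter_partial by simp

lemma times_diff_cong:
  assumes "open S" "times_diff k S h" "\<And>y. y \<in> S \<Longrightarrow> h y = h' y"
  shows "times_diff k S h'"
  using assms(2,3)
proof (induction k arbitrary: h h')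
  case (Suc k)
  have "\<And>y. y \<in> S \<Longrightarrow> h' differentiable (at y)"
    using Suc.prems assms(1) by (auto intro: differentiable_cong_open)
  moreover have "times_diff k S (partial_deriv i h')" for i
  proof (rule Suc.IH)
    show "times_diff k S (partial_deriv i h)" using Suc.prems by simp
    show "\<And>y. y \<in> S \<Longrightarrow> partial_deriv i h y = partial_deriv i h' y"
      using Suc.prems assms(1) by (intro partial_deriv_cong) auto
  qed
  ultimately show ?case by simp
qed simp

text \<open>The induction step: it suffices to give a formula for the derivative, and to know the
  directional derivatives along the axes in that formula to one order less.\<close>

lemma times_diff_SucI:
  assumes "open S" "\<And>y. y \<in> S \<Longrightarrow> (h has_derivative h' y) (at y)"
    and "\<And>i. times_diff k S (\<lambda>y. h' y (axis i 1))"
  shows "times_diff (Suc k) S h"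
proof -
  have "times_diff k S (partial_deriv i h)" for i
    by (rule times_diff_cong[OF assms(1,3)]) (simp add: partial_deriv_eq[OF assms(2)])
  then show ?thesis using assms(2) differentiableI by (simp, blast)
qed

lemma times_diff_SucD:
  assumes "times_diff (Suc k) S h"
  shows "\<And>y. y \<in> S \<Longrightarrow> (h has_derivative frechet_derivative h (at y)) (at y)"
    and "times_diff k S (\<lambda>y. frechet_derivative h (at y) (axis i 1))"
proof -
  show "\<And>y. y \<in> S \<Longrightarrow> (h has_derivative frechet_derivative h (at y)) (at y)"
    using assms by (simp add: frechet_derivative_works)
  have "partial_deriv i h = (\<lambda>y. frechet_derivative h (at y) (axis i 1))"
    by (simp add: partial_deriv_def fun_eq_iff)
  then show "times_diff k S (\<lambda>y. frechet_derivative h (at y) (axis i 1))"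
    using assms by (metis times_diff.simps(2))
qed

lemma times_diff_const: "open S \<Longrightarrow> times_diff k S (\<lambda>_. c)"
proof (induction k arbitrary: c)
  case (Suc k)
  show ?case by (rule times_diff_SucI[where h'="\<lambda>_ _. 0"]) (use Suc in auto)
qed simp

lemma times_diff_coord: "open S \<Longrightarrow> times_diff k S (\<lambda>y. y $ j)"
proof (cases k)
  case (Suc m)
  assume "open S"
  then show ?thesis unfolding Suc
    by (intro times_diff_SucI[where h'="\<lambda>_ v. v $ j"])
      (auto intro: times_diff_const bounded_linear_imp_has_derivative bounded_linear_vec_nth)
qed simp

lemma times_diff_add:
  "open S \<Longrightarrow> times_diff k S f \<Longrightarrow> times_diff k S h \<Longrightarrow> times_diff k S (\<lambda>y. f y + h y)"
proof (induction k arbitrary: f h)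
  case (Suc k)
  note f = times_diff_SucD[OF Suc.prems(2)] and h = times_diff_SucD[OF Suc.prems(3)]
  show ?case
    by (rule times_diff_SucI[OF Suc.prems(1)],
        rule has_derivative_add[OF f(1) h(1)], assumption, assumption)
      (intro Suc.IH Suc.prems f h)
qed simp

lemma times_diff_mult:
  "open S \<Longrightarrow> times_diff k S f \<Longrightarrow> times_diff k S h \<Longrightarrow> times_diff k S (\<lambda>y. f y * h y)"
proof (induction k arbitrary: f h)
  case (Suc k)
  note f = times_diff_SucD[OF Suc.prems(2)] and h = times_diff_SucD[OF Suc.prems(3)]
  show ?case
    by (rule times_diff_SucI[OF Suc.prems(1)],
        rule has_derivative_mult[OF f(1) h(1)], assumption, assumption)
      (intro times_diff_add Suc.IH Suc.prems f h times_diff_Suc_imp[OF Suc.prems(2)]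
        times_diff_Suc_imp[OF Suc.prems(3)])
qed simp

lemma times_diff_inverse:
  "open S \<Longrightarrow> times_diff k S f \<Longrightarrow> (\<And>y. y \<in> S \<Longrightarrow> f y \<noteq> 0) \<Longrightarrow> times_diff k S (\<lambda>y. inverse (f y))"
proof (induction k)
  case (Suc k)
  note f = times_diff_SucD[OF Suc.prems(2)]
  have inv: "times_diff k S (\<lambda>y. inverse (f y))"
    by (intro Suc.IH Suc.prems times_diff_Suc_imp[OF Suc.prems(2)])
  show ?case
  proof (rule times_diff_SucI[OF Suc.prems(1)])
    fix y assume y: "y \<in> S"
    show "((\<lambda>y. inverse (f y)) has_derivative
        (\<lambda>v. (-1) * (inverse (f y) * inverse (f y)) * frechet_derivative f (at y) v)) (at y)"
      using Deriv.has_derivative_inverse[OF Suc.prems(3)[OF y] f(1)[OF y]] by (simp add: mult_ac)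
  next
    fix i
    show "times_diff k S (\<lambda>y. (-1) * (inverse (f y) * inverse (f y)) * frechet_derivative f (at y) (axis i 1))"
      by (intro times_diff_mult Suc.prems f inv times_diff_const)
  qed
qed simp

lemma times_diff_sqrt:
  "open S \<Longrightarrow> times_diff k S f \<Longrightarrow> (\<And>y. y \<in> S \<Longrightarrow> f y > 0) \<Longrightarrow> times_diff k S (\<lambda>y. sqrt (f y))"
proof (induction k)
  case (Suc k)
  note f = times_diff_SucD[OF Suc.prems(2)]
  have sq: "times_diff k S (\<lambda>y. sqrt (f y))"
    by (intro Suc.IH Suc.prems times_diff_Suc_imp[OF Suc.prems(2)])
  show ?case
  proof (rule times_diff_SucI[OF Suc.prems(1)])
    fix y assume y: "y \<in> S"
    have "((\<lambda>z. sqrt (f z)) has_derivative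
        (*) (inverse (sqrt (f y)) / 2) \<circ> frechet_derivative f (at y)) (at y)"
      using diff_chain_at[OF f(1)[OF y] has_field_derivative_imp_has_derivative[OF DERIV_real_sqrt[OF Suc.prems(3)[OF y]]]]
      by (simp add: o_def)
    then show "((\<lambda>y. sqrt (f y)) has_derivative
        (\<lambda>v. inverse (sqrt (f y)) * (1/2) * frechet_derivative f (at y) v)) (at y)"
      by (simp add: o_def)
  next
    fix i
    have "times_diff k S (\<lambda>y. inverse (sqrt (f y)))"
      by (intro times_diff_inverse Suc.prems sq) (use Suc.prems(3) in force)
    then show "times_diff k S (\<lambda>y. inverse (sqrt (f y)) * (1/2) * frechet_derivative f (at y) (axis i 1))"
      by (intro times_diff_mult Suc.prems f times_diff_const)
  qed
qed simp

lemma times_diff_sum: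
  "open S \<Longrightarrow> (\<And>i. i \<in> I \<Longrightarrow> times_diff k S (f i)) \<Longrightarrow> times_diff k S (\<lambda>y. \<Sum>i\<in>I. f i y)"
  by (induction I rule: infinite_finite_induct) (auto intro: times_diff_const times_diff_add)

lemma times_diff_compose:
  fixes T :: "real ^ 'm::finite \<Rightarrow> real ^ 'n::finite"
  assumes S: "open S" and S': "open S'" and into: "T ` S \<subseteq> S'"
  shows "times_diff k S' f \<Longrightarrow> (\<And>j. times_diff k S (\<lambda>y. T y $ j)) \<Longrightarrow> times_diff k S (\<lambda>y. f (T y))"
proof (induction k arbitrary: f)
  case (Suc k)
  note f = times_diff_SucD[OF Suc.prems(1)] and T = times_diff_SucD[OF Suc.prems(2)]
  show ?case
  proof (rule times_diff_SucI[OF S])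
    fix y assume y: "y \<in> S"
    then have Ty: "T y \<in> S'" using into by auto
    have "(T has_derivative (\<lambda>v. \<chi> j. frechet_derivative (\<lambda>y. T y $ j) (at y) v)) (at y)"
      by (subst has_derivative_componentwise_within) (auto simp: Basis_vec_def inner_axis T(1)[OF y])
    from diff_chain_at[OF this f(1)[OF Ty]]
    have *: "((\<lambda>y. f (T y)) has_derivative (\<lambda>v. frechet_derivative f (at (T y))
        (\<chi> j. frechet_derivative (\<lambda>y. T y $ j) (at y) v))) (at y)"
      by (simp add: o_def)
    have "f differentiable (at (T y))" using Suc.prems(1) Ty by simp
    then show "((\<lambda>y. f (T y)) has_derivative (\<lambda>v. \<Sum>j\<in>UNIV.
        frechet_derivative (\<lambda>y. T y $ j) (at y) v * partial_deriv j f (T y))) (at y)"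
      using * by (simp add: frechet_derivative_partial_sum)
  next
    fix i
    have "times_diff k S' (partial_deriv j f)" for j using Suc.prems(1) by simp
    then have "times_diff k S (\<lambda>y. partial_deriv j f (T y))" for j
      by (rule Suc.IH) (rule times_diff_Suc_imp[OF Suc.prems(2)])
    then show "times_diff k S (\<lambda>y. \<Sum>j\<in>UNIV.
        frechet_derivative (\<lambda>y. T y $ j) (at y) (axis i 1) * partial_deriv j f (T y))"
      by (intro times_diff_sum times_diff_mult S T)
  qed
qed simp

subsection \<open>Closure properties\<close>

lemma smooth_on_const: "open S \<Longrightarrow> smooth_on S (\<lambda>_. c :: real)"
  and smooth_on_coord: "open S \<Longrightarrow> smooth_on S (\<lambda>y. y $ j)"
  by (auto simp: smooth_on_iff_times_diff intro: times_diff_const times_diff_coord)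

lemma smooth_on_add:
    "open S \<Longrightarrow> smooth_on S f \<Longrightarrow> smooth_on S h \<Longrightarrow> smooth_on S (\<lambda>y. f y + h y :: real)"
  and smooth_on_mult:
    "open S \<Longrightarrow> smooth_on S f \<Longrightarrow> smooth_on S h \<Longrightarrow> smooth_on S (\<lambda>y. f y * h y :: real)"
  by (auto simp: smooth_on_iff_times_diff intro: times_diff_add times_diff_mult)

lemma smooth_on_minus: "open S \<Longrightarrow> smooth_on S f \<Longrightarrow> smooth_on S (\<lambda>y. - f y :: real)"
  using smooth_on_mult[OF _ smooth_on_const[of S "-1"]] by simp

lemma smooth_on_diff:
  "open S \<Longrightarrow> smooth_on S f \<Longrightarrow> smooth_on S h \<Longrightarrow> smooth_on S (\<lambda>y. f y - h y :: real)"
  using smooth_on_add[OF _ _ smooth_on_minus] by simp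

lemma smooth_on_inverse:
    "open S \<Longrightarrow> smooth_on S f \<Longrightarrow> (\<And>y. y \<in> S \<Longrightarrow> f y \<noteq> (0::real)) \<Longrightarrow> smooth_on S (\<lambda>y. inverse (f y))"
  and smooth_on_sqrt:
    "open S \<Longrightarrow> smooth_on S f \<Longrightarrow> (\<And>y. y \<in> S \<Longrightarrow> f y > (0::real)) \<Longrightarrow> smooth_on S (\<lambda>y. sqrt (f y))"
  by (auto simp: smooth_on_iff_times_diff intro: times_diff_inverse times_diff_sqrt)

lemma smooth_on_divide:
  assumes "open S" "smooth_on S f" "smooth_on S h" "\<And>y. y \<in> S \<Longrightarrow> h y \<noteq> (0::real)"
  shows "smooth_on S (\<lambda>y. f y / h y)"
  using smooth_on_mult[OF assms(1,2) smooth_on_inverse[OF assms(1,3,4)]] by (simp add: divide_inverse)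

lemma smooth_on_sum:
  "open S \<Longrightarrow> (\<And>i. i \<in> I \<Longrightarrow> smooth_on S (f i)) \<Longrightarrow> smooth_on S (\<lambda>y. \<Sum>i\<in>I. f i y :: real)"
  by (auto simp: smooth_on_iff_times_diff intro: times_diff_sum)

lemma smooth_on_prod:
  "open S \<Longrightarrow> (\<And>i. i \<in> I \<Longrightarrow> smooth_on S (f i)) \<Longrightarrow> smooth_on S (\<lambda>y. \<Prod>i\<in>I. f i y :: real)"
  by (induction I rule: infinite_finite_induct) (auto intro: smooth_on_const smooth_on_mult)

lemma smooth_on_det:
  assumes "open S" "\<And>i j. smooth_on S (\<lambda>y. M y $ i $ j)"
  shows "smooth_on S (\<lambda>y. det (M y :: real ^ 'm::finite ^ 'm))"
  unfolding det_def by (intro smooth_on_sum smooth_on_mult smooth_on_const smooth_on_prod assms)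

lemma smooth_on_compose:
  fixes T :: "real ^ 'm::finite \<Rightarrow> real ^ 'n::finite" and f :: "real ^ 'n \<Rightarrow> real"
  assumes "open S" "open S'" "T ` S \<subseteq> S'" "smooth_on S' f" "\<And>j. smooth_on S (\<lambda>y. T y $ j)"
  shows "smooth_on S (\<lambda>y. f (T y))"
  unfolding smooth_on_iff_times_diff
proof
  fix k show "times_diff k S (\<lambda>y. f (T y))"
    by (rule times_diff_compose[OF assms(1-3)]) (use assms(4,5) in \<open>simp_all add: smooth_on_iff_times_diff\<close>)
qed

lemma smooth_on_partial_deriv: "smooth_on S h \<Longrightarrow> smooth_on S (partial_deriv i h)"
  unfolding smooth_on_def by (metis iter_partial_snoc)

lemma smooth_on_subset: "smooth_on S h \<Longrightarrow> S' \<subseteq> S \<Longrightarrow> smooth_on S' h"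
  unfolding smooth_on_def by blast

lemma smooth_on_Union: "(\<And>S. S \<in> \<S> \<Longrightarrow> smooth_on S h) \<Longrightarrow> smooth_on (\<Union>\<S>) h"
  unfolding smooth_on_def by blast

lemma smooth_on_cong:
  "open S \<Longrightarrow> smooth_on S h \<Longrightarrow> (\<And>y. y \<in> S \<Longrightarrow> h y = h' y) \<Longrightarrow> smooth_on S (h' :: _ \<Rightarrow> real)"
  unfolding smooth_on_iff_times_diff using times_diff_cong[of S _ h h'] by simp

lemma smooth_on_differentiable: "smooth_on S h \<Longrightarrow> y \<in> S \<Longrightarrow> h differentiable (at y)"
  unfolding smooth_on_def using iter_partial.simps(1) by metis

lemma smooth_on_continuous_on: "smooth_on S h \<Longrightarrow> continuous_on S h"
  by (meson continuous_at_imp_continuous_on differentiable_imp_continuous_within smooth_on_differentiable)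

text \<open>Applied to the coordinate functions of vectors and matrices, this reduces smoothness of
  transition maps and metrics to that of real functions.\<close>

lemma bounded_linear_differentiable_compose:
  "bounded_linear L \<Longrightarrow> h differentiable (at y) \<Longrightarrow> (\<lambda>y. L (h y)) differentiable (at y)"
  unfolding differentiable_def using bounded_linear.has_derivative by blast

lemma smooth_on_bounded_linear:
  assumes S: "open S" and L: "bounded_linear L" and h: "smooth_on S h"
  shows "smooth_on S (\<lambda>y. L (h y))"
proof -
  have *: "iter_partial is (\<lambda>y. L (h y)) y = L (iter_partial is h y) \<and>
      iter_partial is (\<lambda>y. L (h y)) differentiable (at y)" if "y \<in> S" for "is" y
    using that
  proof (induction "is" arbitrary: y)
    case Nil
    then show ?case using smooth_on_differentiable[OF h] bounded_linear_differentiable_compose[OF L] by auto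
  next
    case (Cons i "is")
    have pd: "partial_deriv i (iter_partial is (\<lambda>y. L (h y))) z = L (partial_deriv i (iter_partial is h) z)"
      if z: "z \<in> S" for z
    proof -
      have d: "iter_partial is h differentiable (at z)" using h z unfolding smooth_on_def by blast
      have "partial_deriv i (iter_partial is (\<lambda>y. L (h y))) z
          = partial_deriv i (\<lambda>z. L (iter_partial is h z)) z"
        by (rule partial_deriv_cong[OF S z]) (use Cons.IH z in auto)
      also have "\<dots> = L (partial_deriv i (iter_partial is h) z)"
        unfolding partial_deriv_def[of i "iter_partial is h"]
        by (rule partial_deriv_eq)
          (rule bounded_linear.has_derivative[OF L d[unfolded frechet_derivative_works]])
      finally show ?thesis .
    qed
    have "iter_partial (i # is) h differentiable (at y)" using h Cons.prems unfolding smooth_on_def by blast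
    then have "(\<lambda>z. L (iter_partial (i # is) h z)) differentiable (at y)"
      by (rule bounded_linear_differentiable_compose[OF L])
    then have "iter_partial (i # is) (\<lambda>y. L (h y)) differentiable (at y)"
      by (rule differentiable_cong_open[OF S Cons.prems]) (simp add: pd)
    then show ?case using pd[OF Cons.prems] by simp
  qed
  then show ?thesis unfolding smooth_on_def by blast
qed

subsection \<open>A smooth function with support in a ball\<close>

text \<open>The classical \<open>exp (-1/t)\<close>. Its derivatives are not of the same form, but the family obtained
  by multiplying with powers of \<open>1/t\<close> is closed under differentiation up to linear combinations.\<close>

definition flat_exp :: "nat \<Rightarrow> real \<Rightarrow> real" where
  "flat_exp k t = (if t > 0 then inverse t ^ k * exp (- inverse t) else 0)"

lemma flat_exp_tendsto_0: "(flat_exp k \<longlongrightarrow> 0) (at_right 0)"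
proof -
  have "((\<lambda>t::real. inverse t ^ k * exp (- inverse t)) \<longlongrightarrow> 0) (at_right 0)"
    using filterlim_compose[OF tendsto_power_div_exp_0[of k] filterlim_inverse_at_top_right]
    by (simp add: exp_minus divide_inverse)
  then show ?thesis
    by (rule Lim_transform_eventually) (auto simp: flat_exp_def eventually_at_right_less eventually_at_filter)
qed

lemma flat_exp_has_derivative:
  "(flat_exp k has_real_derivative - real k * flat_exp (k + 1) t + flat_exp (k + 2) t) (at t)"
proof -
  consider "t > 0" | "t < 0" | "t = 0" by linarith
  then show ?thesis
  proof cases
    case 1
    have "((\<lambda>t. inverse t ^ k * exp (- inverse t)) has_real_derivative
        - real k * flat_exp (k + 1) t + flat_exp (k + 2) t) (at t)"
      using 1 by (auto intro!: derivative_eq_intros simp: flat_exp_def)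
        (cases k; simp add: algebra_simps power2_eq_square)
    then show ?thesis
      by (rule has_field_derivative_transform_within_open[where S="{0<..}"])
        (use 1 in \<open>auto simp: flat_exp_def\<close>)
  next
    case 2
    have "((\<lambda>t. 0) has_real_derivative 0) (at t)" by simp
    then have "(flat_exp k has_real_derivative 0) (at t)"
      by (rule has_field_derivative_transform_within_open[where S="{..<0}"])
        (use 2 in \<open>auto simp: flat_exp_def\<close>)
    then show ?thesis using 2 by (simp add: flat_exp_def)
  next
    case 3
    have "((\<lambda>y. (flat_exp k y - flat_exp k 0) / (y - 0)) \<longlongrightarrow> 0) (at 0)"
    proof (subst filterlim_at_split, intro conjI)
      show "((\<lambda>y. (flat_exp k y - flat_exp k 0) / (y - 0)) \<longlongrightarrow> 0) (at_left 0)"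
        by (rule Lim_transform_eventually[OF tendsto_const])
          (auto simp: flat_exp_def eventually_at_filter)
      show "((\<lambda>y. (flat_exp k y - flat_exp k 0) / (y - 0)) \<longlongrightarrow> 0) (at_right 0)"
        by (rule Lim_transform_eventually[OF flat_exp_tendsto_0[of "Suc k"]])
          (auto simp: flat_exp_def eventually_at_filter divide_inverse)
    qed
    then have "(flat_exp k has_real_derivative 0) (at 0)"
      by (simp add: has_field_derivative_iff)
    then show ?thesis using 3 by (simp add: flat_exp_def)
  qed
qed

lemma times_diff_flat_exp:
  "open S \<Longrightarrow> (\<And>m. times_diff m S q) \<Longrightarrow> times_diff m S (\<lambda>y. flat_exp k (q y))"
proof (induction m arbitrary: k)
  case (Suc m)
  note q = times_diff_SucD[OF Suc.prems(2)]
  show ?case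
  proof (rule times_diff_SucI[OF Suc.prems(1)])
    fix y assume y: "y \<in> S"
    show "((\<lambda>y. flat_exp k (q y)) has_derivative (\<lambda>v. ((- real k) * flat_exp (k + 1) (q y) + flat_exp (k + 2) (q y))
        * frechet_derivative q (at y) v)) (at y)"
      using diff_chain_at[OF q(1)[OF y] has_field_derivative_imp_has_derivative[OF flat_exp_has_derivative]]
      by (simp add: o_def)
  next
    fix i
    show "times_diff m S (\<lambda>y. ((- real k) * flat_exp (k + 1) (q y) + flat_exp (k + 2) (q y))
        * frechet_derivative q (at y) (axis i 1))"
      by (intro times_diff_mult times_diff_add times_diff_const Suc.IH Suc.prems q)
  qed
qed simp

text \<open>The squared distance to \<open>a\<close> is spelled out as a polynomial in the coordinates, so that
  smoothness follows from the closure properties.\<close>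

definition ball_bump :: "real ^ 'n::finite \<Rightarrow> real \<Rightarrow> real ^ 'n \<Rightarrow> real" where
  "ball_bump a r y = flat_exp 0 (r\<^sup>2 - (\<Sum>i\<in>UNIV. (y $ i - a $ i) * (y $ i - a $ i)))"

lemma smooth_on_ball_bump: "smooth_on UNIV (ball_bump a r)"
proof -
  have "smooth_on UNIV (\<lambda>y. r\<^sup>2 - (\<Sum>i\<in>UNIV. (y $ i - a $ i) * (y $ i - a $ i)))"
    by (intro smooth_on_diff smooth_on_const smooth_on_sum smooth_on_mult smooth_on_coord open_UNIV)
  then show ?thesis
    unfolding smooth_on_iff_times_diff ball_bump_def[abs_def] by (auto intro: times_diff_flat_exp)
qed

lemma ball_bump_nonneg: "0 \<le> ball_bump a r y"
  by (simp add: ball_bump_def flat_exp_def)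

lemma ball_bump_pos_iff: "0 < ball_bump a r y \<longleftrightarrow> dist a y < \<bar>r\<bar>"
proof -
  have "(\<Sum>i\<in>UNIV. (y $ i - a $ i) * (y $ i - a $ i)) = (norm (y - a))\<^sup>2"
    by (simp add: dot_square_norm[symmetric] inner_vec_def)
  also have "\<dots> = (dist a y)\<^sup>2" by (simp add: dist_norm norm_minus_commute)
  finally show ?thesis
    using abs_le_square_iff[of r "dist a y"] by (simp add: ball_bump_def flat_exp_def flip: not_le)
qed

section \<open>Two facts about Lebesgue measure\<close>

lemma has_real_derivative_along_axis:
  fixes F :: "real ^ 'n::finite \<Rightarrow> real"
  assumes "F differentiable (at (y + t *\<^sub>R axis i 1))"
  shows "((\<lambda>s. F (y + s *\<^sub>R axis i 1)) has_real_derivative partial_deriv i F (y + t *\<^sub>R axis i 1)) (at t)"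
proof -
  let ?D = "frechet_derivative F (at (y + t *\<^sub>R axis i 1))"
  have "((\<lambda>s. y + s *\<^sub>R axis i 1) has_derivative (\<lambda>s. s *\<^sub>R axis i 1)) (at t)"
    by (auto intro!: derivative_eq_intros)
  from diff_chain_at[OF this assms[unfolded frechet_derivative_works]]
  have "((\<lambda>s. F (y + s *\<^sub>R axis i 1)) has_derivative (\<lambda>s. ?D (s *\<^sub>R axis i 1))) (at t)"
    by (simp add: o_def)
  moreover have "?D (s *\<^sub>R axis i 1) = partial_deriv i F (y + t *\<^sub>R axis i 1) * s" for s
    using linear_cmul[OF linear_frechet_derivative[OF assms]] by (simp add: partial_deriv_def)
  ultimately show ?thesis unfolding has_field_derivative_def by simp
qed

text \<open>The integral of a compactly supported function is invariant under translation in the direction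
  of the \<open>i\<close>-th axis. Hence the integrals of the difference quotients vanish, and they
  converge dominatedly to the integral of the partial derivative.\<close>

lemma has_bochner_integral_partial_deriv_0:
  fixes F :: "real ^ 'n::finite \<Rightarrow> real"
  assumes diff: "\<And>y. F differentiable (at y)" and cont: "continuous_on UNIV (partial_deriv i F)"
    and K: "compact K" and zero: "\<And>y. y \<notin> K \<Longrightarrow> F y = 0"
  shows "has_bochner_integral lborel (partial_deriv i F) 0"
proof -
  define e :: "real ^ 'n" where "e = axis i 1"
  have norm_e: "norm e = 1" by (simp add: e_def)
  define s where "s n = inverse (real (Suc n))" for n
  have s: "0 < s n" "s n \<le> 1" for n by (auto simp: s_def field_simps)
  define G where "G n y = (F (y + s n *\<^sub>R e) - F y) / s n" for n y
  have contF: "continuous_on UNIV F"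
    using diff by (simp add: continuous_at_imp_continuous_on differentiable_imp_continuous_within)
  have [measurable]: "F \<in> borel_measurable borel" "partial_deriv i F \<in> borel_measurable borel"
    using contF cont by (auto intro: borel_measurable_continuous_onI)
  have pd0: "partial_deriv i F y = 0" if "y \<notin> K" for y
  proof -
    have "partial_deriv i F y = partial_deriv i (\<lambda>_. 0) y"
      by (rule partial_deriv_cong[of "- K"]) (use that K zero diff in \<open>auto intro: compact_imp_closed\<close>)
    then show ?thesis by (simp add: partial_deriv_def)
  qed
  obtain C where C: "\<And>y. \<bar>partial_deriv i F y\<bar> \<le> C" "0 \<le> C"
  proof -
    have "bounded (partial_deriv i F ` K)"
      using compact_continuous_image[OF continuous_on_subset[OF cont] K] compact_imp_bounded by blast
    then obtain B where B: "\<And>y. y \<in> K \<Longrightarrow> \<bar>partial_deriv i F y\<bar> \<le> B"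
      unfolding bounded_iff by auto
    have "\<bar>partial_deriv i F y\<bar> \<le> max B 0" for y using B[of y] pd0[of y] by (cases "y \<in> K") auto
    then show ?thesis using that[of "max B 0"] by simp
  qed
  obtain R where R: "K \<subseteq> cball 0 R" using compact_imp_bounded[OF K] unfolding bounded_iff by force
  \<comment> \<open>The quotients are supported in the \<open>1\<close>-neighbourhood of \<open>K\<close>, as the steps have length at most \<open>1\<close>.\<close>
  have bound: "norm (G n y) \<le> C * indicator (cball 0 (R + 1)) y" for n y
  proof (cases "y \<in> cball 0 (R + 1)")
    case True
    have "\<exists>z. 0 < z \<and> z < s n \<and> F (y + s n *\<^sub>R e) - F (y + 0 *\<^sub>R e)
        = (s n - 0) * partial_deriv i F (y + z *\<^sub>R e)"
      using s(1)[of n] unfolding e_def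
      by (intro MVT2) (auto intro: has_real_derivative_along_axis diff)
    then obtain z where "F (y + s n *\<^sub>R e) - F y = s n * partial_deriv i F (y + z *\<^sub>R e)" by auto
    then have "G n y = partial_deriv i F (y + z *\<^sub>R e)" using s(1)[of n] by (simp add: G_def)
    then show ?thesis using True C(1) by simp
  next
    case False
    have "norm y \<le> norm (y + s n *\<^sub>R e) + norm (s n *\<^sub>R e)"
      using norm_triangle_ineq4[of "y + s n *\<^sub>R e" "s n *\<^sub>R e"] by simp
    then have "y \<notin> K" "y + s n *\<^sub>R e \<notin> K" using False R s[of n] norm_e by (auto simp: subset_iff)
    then show ?thesis using False by (simp add: G_def zero)
  qed
  have lim: "(\<lambda>n. G n y) \<longlonglongrightarrow> partial_deriv i F y" for y
  proof -
    have "((\<lambda>h. (F (y + (0 + h) *\<^sub>R e) - F (y + 0 *\<^sub>R e)) / h) \<longlongrightarrow> partial_deriv i F (y + 0 *\<^sub>R e)) (at 0)"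
      using has_real_derivative_along_axis[of F y 0 i] diff unfolding DERIV_def e_def by simp
    then have "((\<lambda>h. (F (y + h *\<^sub>R e) - F y) / h) \<longlongrightarrow> partial_deriv i F y) (at 0)" by simp
    moreover have "filterlim s (at 0) sequentially"
      unfolding filterlim_at using s LIMSEQ_inverse_real_of_nat
      by (auto simp: s_def[abs_def] intro!: always_eventually)
    ultimately show ?thesis unfolding G_def by (rule filterlim_compose)
  qed
  have intF: "integrable lborel F"
  proof -
    have "(\<lambda>y. indicator K y *\<^sub>R F y) = F" by (rule ext) (metis indicator_simps scaleR_one scaleR_zero_left zero)
    then show ?thesis using borel_integrable_compact[OF K continuous_on_subset[OF contF subset_UNIV]] by simp
  qed
  have "integral\<^sup>L lborel (G n) = 0" for n
  proof -
    have sh: "integrable lborel (\<lambda>y. F (s n *\<^sub>R e + y)) \<and>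
        integral\<^sup>L lborel (\<lambda>y. F (s n *\<^sub>R e + y)) = integral\<^sup>L lborel F"
      using integral_distr[of "(+) (s n *\<^sub>R e)" lborel borel F]
        integrable_distr_eq[of "(+) (s n *\<^sub>R e)" lborel borel F] intF
      by (simp add: lborel_distr_plus)
    then show ?thesis unfolding G_def using intF by (simp add: add.commute)
  qed
  moreover have wint: "integrable lborel (\<lambda>y. C * indicator (cball (0::real^'n) (R + 1)) y)"
    using borel_integrable_compact[of "cball (0::real^'n) (R + 1)" "\<lambda>_. C"] by (simp add: mult.commute)
  moreover have Gmeas: "G n \<in> borel_measurable lborel" for n unfolding G_def by measurable
  ultimately have "(\<lambda>n. 0 :: real) \<longlonglongrightarrow> (\<integral>y. partial_deriv i F y \<partial>lborel)"
    using integral_dominated_convergence[OF _ Gmeas wint AE_I2[OF lim] AE_I2[OF bound]] by simp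
  moreover have "integrable lborel (partial_deriv i F)"
    using integrable_dominated_convergence[OF _ Gmeas wint AE_I2[OF lim] AE_I2[OF bound]] by simp
  ultimately show ?thesis by (simp add: LIMSEQ_const_iff has_bochner_integral_iff)
qed

lemma set_nn_integral_eq_integral:
  fixes h :: "'b::euclidean_space \<Rightarrow> real"
  assumes [measurable]: "(\<lambda>x. indicator S x * h x) \<in> borel_measurable borel"
    and nonneg: "\<And>x. x \<in> S \<Longrightarrow> 0 \<le> h x"
  shows "(\<integral>\<^sup>+x\<in>S. ennreal (h x) \<partial>lborel)
    = (if h absolutely_integrable_on S then ennreal (integral S h) else \<infinity>)"
proof -
  let ?h = "\<lambda>x. indicator S x * h x"
  have nn: "0 \<le> ?h x" for x using nonneg by (simp add: indicator_def)
  have "(\<integral>\<^sup>+x\<in>S. ennreal (h x) \<partial>lborel) = (\<integral>\<^sup>+x. ennreal (?h x) \<partial>lborel)"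
    by (intro nn_integral_cong) (simp add: indicator_def)
  moreover have iff: "h absolutely_integrable_on S \<longleftrightarrow> integrable lborel ?h"
    unfolding set_integrable_def using integrable_completion[of ?h lborel] by simp
  moreover have "(\<integral>\<^sup>+x. ennreal (?h x) \<partial>lborel) = ennreal (integral S h)" if "h absolutely_integrable_on S"
  proof -
    have "integral S h = (LINT x:S|lebesgue. h x)"
      using set_lebesgue_integral_eq_integral[OF that] by simp
    also have "\<dots> = integral\<^sup>L lborel ?h"
      unfolding set_lebesgue_integral_def using integral_completion[of ?h lborel] by simp
    finally show ?thesis using nn_integral_eq_integral[of lborel ?h] nn iff that by simp
  qed
  moreover have "(\<integral>\<^sup>+x. ennreal (?h x) \<partial>lborel) = \<infinity>" if "\<not> integrable lborel ?h"
  proof (rule ccontr)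
    assume "(\<integral>\<^sup>+x. ennreal (?h x) \<partial>lborel) \<noteq> \<infinity>"
    then have "(\<integral>\<^sup>+x. ennreal (?h x) \<partial>lborel) < \<infinity>" by (simp only: infinity_ennreal_def less_top)
    then have "integrable lborel ?h" by (intro integrableI_nonneg) (simp_all add: nn)
    with that show False by contradiction
  qed
  ultimately show ?thesis by presburger
qed

text \<open>If one side is infinite, its integrand is not absolutely integrable, hence neither is the other
  one, and both sides are infinite.\<close>

lemma set_nn_integral_change_of_variables:
  fixes f :: "real ^ 'm::{finite, wellorder} \<Rightarrow> real" and T :: "real ^ 'm::_ \<Rightarrow> real ^ 'm::_"
  assumes S: "S \<in> sets borel"
    and T: "\<And>x. x \<in> S \<Longrightarrow> (T has_derivative T' x) (at x)" and inj: "inj_on T S"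
    and meas: "(\<lambda>y. indicator (T ` S) y * f y) \<in> borel_measurable borel"
      "(\<lambda>x. indicator S x * (\<bar>det (matrix (T' x))\<bar> * f (T x))) \<in> borel_measurable borel"
    and nonneg: "\<And>x. x \<in> S \<Longrightarrow> 0 \<le> f (T x)"
  shows "(\<integral>\<^sup>+y\<in>T ` S. ennreal (f y) \<partial>lborel)
    = (\<integral>\<^sup>+x\<in>S. ennreal (\<bar>det (matrix (T' x))\<bar> * f (T x)) \<partial>lborel)"
proof -
  let ?f = "\<lambda>x. (vec (f x) :: real ^ 1)"
  have Sl: "S \<in> sets lebesgue" using S by auto
  have Tw: "(T has_derivative T' x) (at x within S)" if "x \<in> S" for x
    using T[OF that] has_derivative_at_withinI by blast
  have iff: "(\<lambda>x. \<bar>det (matrix (T' x))\<bar> * f (T x)) absolutely_integrable_on S \<and>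
      integral S (\<lambda>x. \<bar>det (matrix (T' x))\<bar> * f (T x)) = b
    \<longleftrightarrow> f absolutely_integrable_on (T ` S) \<and> integral (T ` S) f = b" for b
    using has_absolute_integral_change_of_variables[OF Sl Tw inj, where f="?f" and b="vec b"]
    by (auto simp: absolutely_integrable_on_1_iff integral_on_1_eq)
  let ?g = "\<lambda>x. \<bar>det (matrix (T' x))\<bar> * f (T x)"
  have "(\<integral>\<^sup>+y\<in>T ` S. ennreal (f y) \<partial>lborel)
      = (if f absolutely_integrable_on T ` S then ennreal (integral (T ` S) f) else \<infinity>)"
    by (rule set_nn_integral_eq_integral[OF meas(1)]) (use nonneg in auto)
  moreover have "(\<integral>\<^sup>+x\<in>S. ennreal (?g x) \<partial>lborel)
      = (if ?g absolutely_integrable_on S then ennreal (integral S ?g) else \<infinity>)"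
    by (rule set_nn_integral_eq_integral[OF meas(2)]) (use nonneg in auto)
  ultimately show ?thesis
    using iff[of "integral (T ` S) f"] iff[of "integral S ?g"] by presburger
qed

section \<open>Smooth functions and vector fields on the manifold\<close>

abbreviation inv_coord :: "('a, 'n::finite) chart \<Rightarrow> real ^ 'n \<Rightarrow> 'a" where
  "inv_coord c \<equiv> inv_into (patch c) (coord c)"

abbreviation coord_image :: "('a, 'n::finite) chart \<Rightarrow> (real ^ 'n) set" where
  "coord_image c \<equiv> coord c ` patch c"

text \<open>The index type is ordered as in the change of variables formula for integrals, on which the
  construction of the Riemannian measure depends.\<close>

locale ordered_closed_riemannian_manifold = closed_oriented_riemannian_manifold A g
  for A :: "('a::t2_space, 'n::{finite, wellorder}) chart set"
    and g :: "('a, 'n) chart \<Rightarrow> 'a \<Rightarrow> real ^ 'n::_ ^ 'n::_"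
begin

subsection \<open>Charts\<close>

lemma inv_coord_coord: "c \<in> A \<Longrightarrow> p \<in> patch c \<Longrightarrow> inv_coord c (coord c p) = p"
  using chart_homeomorphism[of c] by (rule homeomorphism_apply1)

lemma coord_inv_coord: "y \<in> coord_image c \<Longrightarrow> coord c (inv_coord c y) = y"
  by (rule f_inv_into_f)

lemma inv_coord_in_patch: "y \<in> coord_image c \<Longrightarrow> inv_coord c y \<in> patch c"
  by (rule inv_into_into)

lemma in_chart_coord: "c \<in> A \<Longrightarrow> p \<in> patch c \<Longrightarrow> in_chart c f (coord c p) = f p"
  by (simp add: in_chart_def inv_coord_coord)

lemma continuous_on_coord: "c \<in> A \<Longrightarrow> continuous_on (patch c) (coord c)"
  and continuous_on_inv_coord: "c \<in> A \<Longrightarrow> continuous_on (coord_image c) (inv_coord c)"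
  using chart_homeomorphism[of c] by (auto dest: homeomorphism_cont1 homeomorphism_cont2)

lemma coord_image_eq_vimage:
  assumes "c \<in> A" "W \<subseteq> patch c"
  shows "coord c ` W = inv_coord c -` W \<inter> coord_image c"
  using assms inv_coord_coord[OF assms(1)] by (auto simp: subset_iff coord_inv_coord)

lemma open_coord_subset:
  assumes "c \<in> A" "open W" shows "open (coord c ` (patch c \<inter> W))"
proof -
  have "coord c ` (patch c \<inter> W) = inv_coord c -` (patch c \<inter> W) \<inter> coord_image c"
    by (rule coord_image_eq_vimage) (use assms in auto)
  then show ?thesis
    using continuous_on_open_vimage[OF open_coord_image[OF assms(1)]] continuous_on_inv_coord[OF assms(1)]
      open_patch[OF assms(1)] assms(2) by (metis open_Int)
qed

lemma open_coord_preimage: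
  assumes "c \<in> A" "open S" shows "open (coord c -` S \<inter> patch c)"
  using continuous_on_coord[OF assms(1)] open_patch[OF assms(1)] assms(2)
  by (simp add: continuous_on_open_vimage)

lemma chart_at: "chart_at A p \<in> A" "p \<in> patch (chart_at A p)"
proof -
  have "\<exists>c. c \<in> A \<and> p \<in> patch c" using charts_cover by blast
  then show "chart_at A p \<in> A" "p \<in> patch (chart_at A p)"
    unfolding chart_at_def by (metis (mono_tags, lifting) someI_ex)+
qed

lemma in_chart_transition:
  assumes "c \<in> A" "c' \<in> A" "y \<in> coord c ` (patch c \<inter> patch c')"
  shows "in_chart c' f (in_chart c (coord c') y) = in_chart c f y"
  using assms by (auto simp: in_chart_def inv_coord_coord)

lemma transition_has_derivative:
  assumes "c \<in> A" "c' \<in> A" "p \<in> patch c \<inter> patch c'"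
  shows "(in_chart c (coord c') has_derivative (*v) (transition_jacobian c c' p)) (at (coord c p))"
proof -
  have d: "in_chart c (coord c') differentiable (at (coord c p))"
    using transition_smooth[OF assms(1,2)] assms(3) by (intro smooth_on_differentiable) auto
  have "(*v) (transition_jacobian c c' p) = frechet_derivative (in_chart c (coord c')) (at (coord c p))"
    unfolding transition_jacobian_def using linear_frechet_derivative[OF d] by (simp add: matrix_works fun_eq_iff)
  then show ?thesis using d by (simp add: frechet_derivative_works)
qed

subsection \<open>Smooth functions\<close>

definition smooth_in :: "'a set \<Rightarrow> ('a \<Rightarrow> real) \<Rightarrow> bool" where
  "smooth_in W f \<longleftrightarrow> (\<forall>c\<in>A. smooth_on (coord c ` (patch c \<inter> W)) (in_chart c f))"

lemma smooth_functions_iff: "f \<in> smooth_functions A \<longleftrightarrow> smooth_in UNIV f"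
  by (simp add: smooth_functions_def smooth_in_def)

lemma smooth_in_const: "open W \<Longrightarrow> smooth_in W (\<lambda>_. k)"
  unfolding smooth_in_def in_chart_def by (auto intro: smooth_on_const open_coord_subset)

lemma smooth_in_add: "open W \<Longrightarrow> smooth_in W f \<Longrightarrow> smooth_in W h \<Longrightarrow> smooth_in W (\<lambda>p. f p + h p)"
  unfolding smooth_in_def in_chart_def by (auto intro!: smooth_on_add open_coord_subset)

lemma smooth_in_diff: "open W \<Longrightarrow> smooth_in W f \<Longrightarrow> smooth_in W h \<Longrightarrow> smooth_in W (\<lambda>p. f p - h p)"
  unfolding smooth_in_def in_chart_def by (auto intro!: smooth_on_diff open_coord_subset)

lemma smooth_in_minus: "open W \<Longrightarrow> smooth_in W f \<Longrightarrow> smooth_in W (\<lambda>p. - f p)"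
  unfolding smooth_in_def in_chart_def by (auto intro!: smooth_on_minus open_coord_subset)

lemma smooth_in_mult: "open W \<Longrightarrow> smooth_in W f \<Longrightarrow> smooth_in W h \<Longrightarrow> smooth_in W (\<lambda>p. f p * h p)"
  unfolding smooth_in_def in_chart_def by (auto intro!: smooth_on_mult open_coord_subset)

lemma smooth_in_sum: "open W \<Longrightarrow> (\<And>i. i \<in> I \<Longrightarrow> smooth_in W (f i)) \<Longrightarrow> smooth_in W (\<lambda>p. \<Sum>i\<in>I. f i p)"
  unfolding smooth_in_def in_chart_def by (auto intro!: smooth_on_sum open_coord_subset)

lemma smooth_in_divide:
  assumes "open W" "smooth_in W f" "smooth_in W h" "\<And>p. p \<in> W \<Longrightarrow> h p \<noteq> 0"
  shows "smooth_in W (\<lambda>p. f p / h p)"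
  unfolding smooth_in_def
proof
  fix c assume c: "c \<in> A"
  have "smooth_on (coord c ` (patch c \<inter> W)) (\<lambda>y. in_chart c f y / in_chart c h y)"
    by (intro smooth_on_divide open_coord_subset c)
      (use assms c in \<open>auto simp: smooth_in_def in_chart_coord\<close>)
  then show "smooth_on (coord c ` (patch c \<inter> W)) (in_chart c (\<lambda>p. f p / h p))"
    by (simp add: in_chart_def)
qed

lemma smooth_in_subset: "smooth_in W f \<Longrightarrow> W' \<subseteq> W \<Longrightarrow> smooth_in W' f"
  unfolding smooth_in_def by (blast intro: smooth_on_subset)

lemma smooth_in_Union:
  assumes "\<And>W. W \<in> \<W> \<Longrightarrow> smooth_in W f" shows "smooth_in (\<Union>\<W>) f"
  unfolding smooth_in_def
proof
  fix c assume c: "c \<in> A"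
  have "smooth_on (\<Union>((\<lambda>W. coord c ` (patch c \<inter> W)) ` \<W>)) (in_chart c f)"
    by (rule smooth_on_Union) (use assms c in \<open>auto simp: smooth_in_def\<close>)
  moreover have "\<Union>((\<lambda>W. coord c ` (patch c \<inter> W)) ` \<W>) = coord c ` (patch c \<inter> \<Union>\<W>)" by auto
  ultimately show "smooth_on (coord c ` (patch c \<inter> \<Union>\<W>)) (in_chart c f)" by simp
qed

lemma smooth_in_cong:
  assumes "open W" "smooth_in W f" "\<And>p. p \<in> W \<Longrightarrow> f p = h p" shows "smooth_in W h"
  unfolding smooth_in_def
proof
  fix c assume c: "c \<in> A"
  show "smooth_on (coord c ` (patch c \<inter> W)) (in_chart c h)"
    by (rule smooth_on_cong[OF open_coord_subset[OF c assms(1)], of "in_chart c f"])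
      (use assms c in \<open>auto simp: smooth_in_def in_chart_coord\<close>)
qed

text \<open>A function which is smooth in one chart around \<open>W\<close> is smooth in all of them, because the
  transition maps are smooth.\<close>

lemma smooth_in_chartI:
  assumes c: "c \<in> A" and W: "open W" "W \<subseteq> patch c" and f: "smooth_on (coord c ` W) (in_chart c f)"
  shows "smooth_in W f"
  unfolding smooth_in_def
proof
  fix c' assume c': "c' \<in> A"
  let ?S = "coord c' ` (patch c' \<inter> W)"
  have S: "open ?S" using open_coord_subset[OF c' W(1)] .
  have op: "open (coord c ` W)" using open_coord_subset[OF c W(1)] W(2) by (simp add: inf.absorb2)
  have into: "in_chart c' (coord c) ` ?S \<subseteq> coord c ` W" using c' by (auto simp: in_chart_coord)
  have tr: "smooth_on ?S (\<lambda>y. in_chart c' (coord c) y $ j)" for j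
    by (rule smooth_on_bounded_linear[OF S bounded_linear_vec_nth])
      (rule smooth_on_subset[OF transition_smooth[OF c' c]], use W in auto)
  have "smooth_on ?S (\<lambda>y. in_chart c f (in_chart c' (coord c) y))"
    by (rule smooth_on_compose[OF S op into f tr])
  then show "smooth_on ?S (in_chart c' f)"
    by (rule smooth_on_cong[OF S]) (use in_chart_transition[OF c' c] W in blast)
qed

lemma smooth_in_continuous_on:
  assumes W: "open W" and f: "smooth_in W f" shows "continuous_on W f"
proof (rule continuous_at_imp_continuous_on, rule ballI)
  fix p assume p: "p \<in> W"
  let ?c = "chart_at A p"
  note c = chart_at[of p]
  have "continuous_on (coord ?c ` (patch ?c \<inter> W)) (in_chart ?c f)"
    using f c(1) by (auto simp: smooth_in_def intro: smooth_on_continuous_on)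
  then have "continuous_on (patch ?c \<inter> W) (\<lambda>q. in_chart ?c f (coord ?c q))"
    by (rule continuous_on_compose2) (use continuous_on_subset[OF continuous_on_coord[OF c(1)]] in auto)
  then have "continuous_on (patch ?c \<inter> W) f"
    by (rule continuous_on_eq) (use c in \<open>simp add: in_chart_coord\<close>)
  then show "isCont f p"
    using p c continuous_on_eq_continuous_at[OF open_Int[OF open_patch[OF c(1)] W]] by blast
qed

lemma smooth_functions_continuous_on: "f \<in> smooth_functions A \<Longrightarrow> continuous_on UNIV f"
  by (simp add: smooth_functions_iff smooth_in_continuous_on)

text \<open>Extension by zero: the interior and the complement of the support are an open cover.\<close>

lemma smooth_functions_supportI:
  assumes W: "open W" and f: "smooth_in W f" and K: "compact K" "K \<subseteq> W"
    and zero: "\<And>p. p \<notin> K \<Longrightarrow> f p = 0"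
  shows "f \<in> smooth_functions A"
proof -
  have op: "open (- K)" using K(1) by (simp add: compact_imp_closed open_Compl)
  have "smooth_in (- K) f" by (rule smooth_in_cong[OF op smooth_in_const[OF op, of 0]]) (simp add: zero)
  then have "smooth_in (\<Union>{W, - K}) f" using f by (intro smooth_in_Union) auto
  moreover have "\<Union>{W, - K} = UNIV" using K(2) by auto
  ultimately show ?thesis by (simp add: smooth_functions_iff)
qed

lemma smooth_functions_const: "(\<lambda>_. k) \<in> smooth_functions A"
  and smooth_functions_add: "f \<in> smooth_functions A \<Longrightarrow> h \<in> smooth_functions A \<Longrightarrow> (\<lambda>p. f p + h p) \<in> smooth_functions A"
  and smooth_functions_diff: "f \<in> smooth_functions A \<Longrightarrow> h \<in> smooth_functions A \<Longrightarrow> (\<lambda>p. f p - h p) \<in> smooth_functions A"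
  and smooth_functions_mult: "f \<in> smooth_functions A \<Longrightarrow> h \<in> smooth_functions A \<Longrightarrow> (\<lambda>p. f p * h p) \<in> smooth_functions A"
  and smooth_functions_minus: "f \<in> smooth_functions A \<Longrightarrow> (\<lambda>p. - f p) \<in> smooth_functions A"
  by (simp_all add: smooth_functions_iff smooth_in_const smooth_in_add smooth_in_diff smooth_in_mult smooth_in_minus)

lemma smooth_functions_in_chart: "f \<in> smooth_functions A \<Longrightarrow> c \<in> A \<Longrightarrow> smooth_on (coord_image c) (in_chart c f)"
  by (simp add: smooth_functions_def)

lemma smooth_in_chart_differentiable:
  "smooth_in W f \<Longrightarrow> c \<in> A \<Longrightarrow> p \<in> W \<Longrightarrow> p \<in> patch c \<Longrightarrow> in_chart c f differentiable (at (coord c p))"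
  unfolding smooth_in_def by (auto intro: smooth_on_differentiable)

text \<open>A Euclidean bump function in a chart, extended by zero.\<close>

lemma bump_around:
  assumes W: "open W" "p \<in> W"
  obtains b K where "b \<in> smooth_functions A" "\<And>q. 0 \<le> b q" "0 < b p" "compact K" "K \<subseteq> W"
    "\<And>q. q \<notin> K \<Longrightarrow> b q = 0"
proof -
  let ?c = "chart_at A p"
  note c = chart_at[of p]
  have "open (coord ?c ` (patch ?c \<inter> W))" using open_coord_subset[OF c(1) W(1)] .
  moreover have "coord ?c p \<in> coord ?c ` (patch ?c \<inter> W)" using c W by auto
  ultimately obtain r where r: "r > 0" "cball (coord ?c p) r \<subseteq> coord ?c ` (patch ?c \<inter> W)"
    unfolding open_contains_cball by blast
  let ?B = "cball (coord ?c p) r"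
  define b where "b q = (if q \<in> patch ?c then ball_bump (coord ?c p) r (coord ?c q) else 0)" for q
  have KW: "inv_coord ?c ` ?B \<subseteq> patch ?c \<inter> W" using r(2) c(1) by (auto simp: inv_coord_coord subset_iff)
  have K: "compact (inv_coord ?c ` ?B)"
    by (rule compact_continuous_image[OF continuous_on_subset[OF continuous_on_inv_coord[OF c(1)]]]) (use r in auto)
  have zero: "b q = 0" if "q \<notin> inv_coord ?c ` ?B" for q
  proof (cases "q \<in> patch ?c")
    case True
    then have "coord ?c q \<notin> ?B" using that inv_coord_coord[OF c(1) True] by (metis image_eqI)
    then show ?thesis
      using True ball_bump_pos_iff[of "coord ?c p" r "coord ?c q"] ball_bump_nonneg[of "coord ?c p" r "coord ?c q"] r(1)
      by (auto simp: b_def)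
  qed (simp add: b_def)
  have "smooth_on (coord_image ?c) (in_chart ?c b)"
    by (rule smooth_on_cong[OF open_coord_image[OF c(1)] smooth_on_subset[OF smooth_on_ball_bump]])
      (auto simp: b_def in_chart_coord[OF c(1)])
  then have "smooth_in (patch ?c) b" using open_patch c(1) by (intro smooth_in_chartI) auto
  then have "b \<in> smooth_functions A"
    by (rule smooth_functions_supportI[OF open_patch[OF c(1)] _ K]) (use KW zero in auto)
  moreover have "0 \<le> b q" for q by (simp add: b_def ball_bump_nonneg)
  moreover have "0 < b p" using c(2) r(1) by (simp add: b_def ball_bump_pos_iff)
  ultimately show ?thesis using that K KW zero by blast
qed

subsection \<open>Vector fields and derivatives along them\<close>

definition smooth_field :: "('a, 'n) vfield \<Rightarrow> bool" where
  "smooth_field V \<longleftrightarrow>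
     (\<forall>c\<in>A. \<forall>i. smooth_on (coord_image c) (in_chart c (\<lambda>q. V c q $ i))) \<and>
     (\<forall>c\<in>A. \<forall>c'\<in>A. \<forall>p \<in> patch c \<inter> patch c'. V c' p = transition_jacobian c c' p *v V c p)"

definition along :: "('a, 'n) vfield \<Rightarrow> ('a \<Rightarrow> real) \<Rightarrow> 'a \<Rightarrow> real" where
  "along V f p = (let c = chart_at A p in frechet_derivative (in_chart c f) (at (coord c p)) (V c p))"

lemma differential_transition:
  assumes W: "open W" "smooth_in W f" "p \<in> W" and c: "c \<in> A" "c' \<in> A" "p \<in> patch c" "p \<in> patch c'"
  shows "frechet_derivative (in_chart c f) (at (coord c p)) v
    = frechet_derivative (in_chart c' f) (at (coord c' p)) (transition_jacobian c c' p *v v)"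
proof -
  let ?S = "coord c ` (patch c \<inter> (patch c' \<inter> W))"
  have S: "open ?S" using open_coord_subset[OF c(1)] open_patch[OF c(2)] W(1) by blast
  have "(in_chart c' f has_derivative frechet_derivative (in_chart c' f) (at (coord c' p)))
      (at (in_chart c (coord c') (coord c p)))"
    using smooth_in_chart_differentiable[OF W(2) c(2) W(3) c(4)] c
    by (simp add: frechet_derivative_works in_chart_coord)
  from diff_chain_at[OF transition_has_derivative this]
  have "((\<lambda>y. in_chart c' f (in_chart c (coord c') y)) has_derivative
      (\<lambda>v. frechet_derivative (in_chart c' f) (at (coord c' p)) (transition_jacobian c c' p *v v))) (at (coord c p))"
    using c by (simp add: o_def)
  then have "(in_chart c f has_derivative
      (\<lambda>v. frechet_derivative (in_chart c' f) (at (coord c' p)) (transition_jacobian c c' p *v v))) (at (coord c p))"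
    by (rule has_derivative_transform_within_open[OF _ S])
      (use W c in_chart_transition[OF c(1,2)] in auto)
  from frechet_derivative_at[OF this] show ?thesis by metis
qed

lemma along_chart:
  assumes "smooth_field V" "open W" "smooth_in W f" "p \<in> W" "c \<in> A" "p \<in> patch c"
  shows "along V f p = frechet_derivative (in_chart c f) (at (coord c p)) (V c p)"
proof -
  have "V c p = transition_jacobian (chart_at A p) c p *v V (chart_at A p) p"
    using assms chart_at[of p] unfolding smooth_field_def by blast
  then show ?thesis
    using differential_transition[OF assms(2-4) chart_at(1) assms(5) chart_at(2) assms(6)]
    by (simp add: along_def Let_def)
qed

lemma along_coordinates:
  assumes "smooth_field V" "open W" "smooth_in W f" "c \<in> A" "p \<in> W" "p \<in> patch c"
  shows "along V f p = (\<Sum>i\<in>UNIV. V c p $ i * partial_deriv i (in_chart c f) (coord c p))"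
  using assms by (simp add: along_chart frechet_derivative_partial_sum smooth_in_chart_differentiable)

lemma along_smooth:
  assumes V: "smooth_field V" and f: "f \<in> smooth_functions A"
  shows "along V f \<in> smooth_functions A"
  unfolding smooth_functions_def
proof (intro CollectI ballI)
  fix c assume c: "c \<in> A"
  have "smooth_on (coord_image c)
      (\<lambda>y. \<Sum>i\<in>UNIV. in_chart c (\<lambda>q. V c q $ i) y * partial_deriv i (in_chart c f) y)"
    using V f c by (auto simp: smooth_field_def smooth_functions_def
        intro!: smooth_on_sum smooth_on_mult smooth_on_partial_deriv open_coord_image)
  then show "smooth_on (coord_image c) (in_chart c (along V f))"
    by (rule smooth_on_cong[OF open_coord_image[OF c]])
      (use c f in \<open>auto simp: in_chart_coord along_coordinates[OF V, of UNIV] smooth_functions_iff\<close>)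
qed

lemma along_eq_0_outside_support:
  assumes "closed K" "\<And>q. q \<notin> K \<Longrightarrow> f q = 0" "p \<notin> K"
  shows "along V f p = 0"
proof -
  let ?c = "chart_at A p"
  have "open (coord ?c ` (patch ?c \<inter> - K))" using open_coord_subset chart_at(1) assms(1) by blast
  moreover have "coord ?c p \<in> coord ?c ` (patch ?c \<inter> - K)" using chart_at[of p] assms(3) by auto
  ultimately have "(in_chart ?c f has_derivative (\<lambda>_. 0)) (at (coord ?c p))"
    using assms(2) chart_at(1)[of p]
    by (intro has_derivative_transform_within_open[OF has_derivative_const[of 0]]) (auto simp: in_chart_coord)
  from fun_cong[OF frechet_derivative_at[OF this], of "V ?c p"] show ?thesis by (simp add: along_def Let_def)
qed

lemma along_mult:
  assumes "f \<in> smooth_functions A" "h \<in> smooth_functions A"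
  shows "along V (\<lambda>q. f q * h q) p = f p * along V h p + h p * along V f p"
proof -
  let ?c = "chart_at A p"
  note c = chart_at[of p]
  have d: "in_chart ?c f differentiable (at (coord ?c p))" "in_chart ?c h differentiable (at (coord ?c p))"
    using assms c smooth_in_chart_differentiable[of UNIV] by (auto simp: smooth_functions_iff)
  have "((\<lambda>y. in_chart ?c f y * in_chart ?c h y) has_derivative
      (\<lambda>v. in_chart ?c f (coord ?c p) * frechet_derivative (in_chart ?c h) (at (coord ?c p)) v
        + frechet_derivative (in_chart ?c f) (at (coord ?c p)) v * in_chart ?c h (coord ?c p))) (at (coord ?c p))"
    using d by (intro has_derivative_mult) (simp_all add: frechet_derivative_works)
  moreover have "(\<lambda>y. in_chart ?c f y * in_chart ?c h y) = in_chart ?c (\<lambda>q. f q * h q)"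
    by (simp add: in_chart_def)
  ultimately show ?thesis
    using fun_cong[OF frechet_derivative_at, of "in_chart ?c (\<lambda>q. f q * h q)" _ "coord ?c p" "V ?c p"] c
    by (simp add: along_def Let_def in_chart_coord)
qed

lemma along_const: "along V (\<lambda>_. k) p = 0"
  by (simp add: along_def Let_def in_chart_def)

lemma along_sum:
  assumes "finite I" "\<And>i. i \<in> I \<Longrightarrow> f i \<in> smooth_functions A"
  shows "along V (\<lambda>q. \<Sum>i\<in>I. f i q) p = (\<Sum>i\<in>I. along V (f i) p)"
proof -
  let ?c = "chart_at A p"
  note c = chart_at[of p]
  have "((\<lambda>y. \<Sum>i\<in>I. in_chart ?c (f i) y) has_derivative
      (\<lambda>v. \<Sum>i\<in>I. frechet_derivative (in_chart ?c (f i)) (at (coord ?c p)) v)) (at (coord ?c p))"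
    using assms c smooth_in_chart_differentiable[of UNIV]
    by (intro has_derivative_sum) (auto simp: smooth_functions_iff frechet_derivative_works[symmetric])
  from fun_cong[OF frechet_derivative_at[OF this], of "V ?c p"] show ?thesis
    by (simp add: along_def Let_def in_chart_def)
qed

lemma smooth_field_scale:
  assumes f: "f \<in> smooth_functions A" and V: "smooth_field V"
  shows "smooth_field (\<lambda>c p. f p *\<^sub>R V c p)"
  unfolding smooth_field_def
proof (intro conjI ballI allI)
  fix c i assume c: "c \<in> A"
  have "smooth_on (coord_image c) (\<lambda>y. in_chart c f y * in_chart c (\<lambda>q. V c q $ i) y)"
    using f V c by (intro smooth_on_mult open_coord_image) (auto simp: smooth_field_def smooth_functions_def)
  then show "smooth_on (coord_image c) (in_chart c (\<lambda>q. (f q *\<^sub>R V c q) $ i))"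
    by (simp add: in_chart_def)
next
  fix c c' p assume "c \<in> A" "c' \<in> A" "p \<in> patch c \<inter> patch c'"
  then show "f p *\<^sub>R V c' p = transition_jacobian c c' p *v (f p *\<^sub>R V c p)"
    using V unfolding smooth_field_def by (metis matrix_vector_mult_scaleR)
qed

subsection \<open>The metric and gradients\<close>

lemma metric_commute: "c \<in> A \<Longrightarrow> p \<in> patch c \<Longrightarrow> v \<bullet> (g c p *v w) = (g c p *v v) \<bullet> w"
  using metric_symmetric dot_lmul_matrix[of v "g c p" w]
  by (metis vector_transpose_matrix)

text \<open>The determinant does not vanish on the segment of positive definite matrices from \<open>mat 1\<close> to
  \<open>g c p\<close>.\<close>

lemma det_metric_pos:
  assumes c: "c \<in> A" "p \<in> patch c" shows "0 < det (g c p)"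
proof (rule ccontr)
  assume neg: "\<not> 0 < det (g c p)"
  define M where "M t = (1 - t) *\<^sub>R mat 1 + t *\<^sub>R g c p" for t
  have nz: "det (M t) \<noteq> 0" if t: "0 \<le> t" "t \<le> 1" for t
  proof
    assume "det (M t) = 0"
    then obtain v where v: "v \<noteq> 0" "M t *v v = 0"
      using invertible_det_nz[of "M t"] invertible_left_inverse[of "M t"] matrix_left_invertible_ker[of "M t"]
      by auto
    have "v \<bullet> (M t *v v) = (1 - t) * (v \<bullet> v) + t * (v \<bullet> (g c p *v v))"
      by (simp add: M_def matrix_vector_mult_add_rdistrib inner_add_right flip: scaleR_matrix_vector_assoc)
    moreover have "0 < v \<bullet> v" "0 < v \<bullet> (g c p *v v)" using v c metric_pos_def by auto
    then have "0 < (1 - t) * (v \<bullet> v) + t * (v \<bullet> (g c p *v v))"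
      using t by (cases "t = 1") (auto intro!: add_pos_nonneg mult_nonneg_nonneg mult_pos_pos)
    ultimately show False using v by simp
  qed
  have "continuous_on {0..1} (\<lambda>t. det (M t))"
    unfolding M_def det_def by (intro continuous_intros)
  moreover have "det (M 1) \<le> 0" "0 \<le> det (M 0)" using neg by (auto simp: M_def)
  ultimately obtain t where "0 \<le> t" "t \<le> 1" "det (M t) = 0"
    using IVT2'[of "\<lambda>t. det (M t)" 1 0 0] by auto
  then show False using nz by blast
qed

abbreviation volume_density :: "('a, 'n) chart \<Rightarrow> 'a \<Rightarrow> real" where
  "volume_density c p \<equiv> sqrt (det (g c p))"

lemma volume_density_pos: "c \<in> A \<Longrightarrow> p \<in> patch c \<Longrightarrow> 0 < volume_density c p"
  by (simp add: det_metric_pos)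

lemma metric_entry_smooth: "c \<in> A \<Longrightarrow> smooth_on (coord_image c) (\<lambda>y. in_chart c (g c) y $ i $ j)"
  by (rule smooth_on_bounded_linear[OF open_coord_image, where L="\<lambda>M. M $ i $ j"])
    (auto intro: bounded_linear_compose[OF bounded_linear_vec_nth bounded_linear_vec_nth] metric_smooth)

lemma volume_density_smooth: "c \<in> A \<Longrightarrow> smooth_on (coord_image c) (in_chart c (volume_density c))"
  unfolding in_chart_def
  by (intro smooth_on_sqrt smooth_on_det open_coord_image metric_entry_smooth[unfolded in_chart_def])
    (auto simp: inv_coord_coord det_metric_pos)

text \<open>By \<open>metric_transform\<close>, the matrix of the metric in \<open>c\<close> is \<open>J\<^sup>T g' J\<close> with the Jacobian \<open>J\<close> and
  the matrix \<open>g'\<close> in \<open>c'\<close>.\<close>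

lemma volume_density_transition:
  assumes "c \<in> A" "c' \<in> A" "p \<in> patch c \<inter> patch c'"
  shows "volume_density c p = \<bar>det (transition_jacobian c c' p)\<bar> * volume_density c' p"
proof -
  let ?J = "transition_jacobian c c' p"
  have "v \<bullet> (g c p *v w) = v \<bullet> ((transpose ?J ** g c' p ** ?J) *v w)" for v w
    using metric_transform[OF assms, of v w]
    by (metis dot_lmul_matrix matrix_vector_mul_assoc transpose_matrix_vector vector_transpose_matrix)
  then have "g c p *v w = (transpose ?J ** g c' p ** ?J) *v w" for w
    by (metis vector_eq_ldot)
  then have "g c p = transpose ?J ** g c' p ** ?J" by (simp add: matrix_eq)
  then have "det (g c p) = (det ?J)\<^sup>2 * det (g c' p)"
    by (simp add: det_mul det_transpose power2_eq_square)
  then show ?thesis by (simp add: real_sqrt_mult)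
qed

text \<open>Cramer's rule, as a formula for gradients that is visibly smooth.\<close>

definition grad_components :: "('a \<Rightarrow> real) \<Rightarrow> ('a, 'n) vfield" where
  "grad_components f c p = (\<chi> k. det (\<chi> i j. if j = k then partial_deriv i (in_chart c f) (coord c p)
     else g c p $ i $ j) / det (g c p))"

lemma
  assumes f: "f \<in> smooth_functions A" and c: "c \<in> A" "p \<in> patch c"
  shows grad_eq_components: "grad A g f c p = grad_components f c p"
    and grad_inner: "grad A g f c p \<bullet> (g c p *v w) = frechet_derivative (in_chart c f) (at (coord c p)) w"
proof -
  have d: "in_chart c f differentiable (at (coord c p))"
    using smooth_in_chart_differentiable[of UNIV] f c by (simp add: smooth_functions_iff)
  let ?v = "grad_components f c p"
  have gv: "g c p *v ?v = (\<chi> i. partial_deriv i (in_chart c f) (coord c p))"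
    using det_metric_pos[OF c] by (subst cramer) (simp_all add: grad_components_def cong: if_cong)
  have *: "?v \<bullet> (g c p *v w) = frechet_derivative (in_chart c f) (at (coord c p)) w" for w
    unfolding metric_commute[OF c] gv by (simp add: frechet_derivative_partial_sum[OF d] inner_vec_def mult.commute)
  have "grad A g f c p = (THE v. \<forall>w. v \<bullet> (g c p *v w) = frechet_derivative (in_chart c f) (at (coord c p)) w)"
    using c by (simp add: grad_def)
  also have "\<dots> = ?v"
  proof (rule the_equality)
    fix v assume v: "\<forall>w. v \<bullet> (g c p *v w) = frechet_derivative (in_chart c f) (at (coord c p)) w"
    have "(v - ?v) \<bullet> (g c p *v (v - ?v)) = 0" using v * by (simp add: inner_diff_left)
    then show "v = ?v" using metric_pos_def[OF c, of "v - ?v"] by force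
  qed (use * in blast)
  finally show "grad A g f c p = ?v" .
  then show "grad A g f c p \<bullet> (g c p *v w) = frechet_derivative (in_chart c f) (at (coord c p)) w"
    using * by simp
qed

lemma grad_smooth_field:
  assumes f: "f \<in> smooth_functions A" shows "smooth_field (grad A g f)"
  unfolding smooth_field_def
proof (intro conjI ballI allI)
  fix c i assume c: "c \<in> A"
  let ?num = "\<lambda>y. det (\<chi> k j. if j = i then partial_deriv k (in_chart c f) y else in_chart c (g c) y $ k $ j)"
  have entry: "smooth_on (coord_image c) (\<lambda>y. if j = i then partial_deriv k (in_chart c f) y else in_chart c (g c) y $ k $ j)"
    for j k
    using metric_entry_smooth[OF c] smooth_on_partial_deriv[OF smooth_functions_in_chart[OF f c]]
    by (cases "j = i") simp_all
  have num: "smooth_on (coord_image c) ?num"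
    by (rule smooth_on_det[OF open_coord_image[OF c]]) (simp only: vec_lambda_beta entry)
  have den: "smooth_on (coord_image c) (\<lambda>y. det (in_chart c (g c) y))"
    by (intro smooth_on_det open_coord_image c metric_entry_smooth)
  have "smooth_on (coord_image c) (\<lambda>y. ?num y / det (in_chart c (g c) y))"
    by (rule smooth_on_divide[OF open_coord_image[OF c] num den])
      (use det_metric_pos[OF c] c in \<open>auto simp: in_chart_coord less_imp_neq[symmetric]\<close>)
  then show "smooth_on (coord_image c) (in_chart c (\<lambda>q. grad A g f c q $ i))"
    by (rule smooth_on_cong[OF open_coord_image[OF c]])
      (auto simp: in_chart_coord c grad_eq_components[OF f c] grad_components_def cong: if_cong)
next
  fix c c' p assume c: "c \<in> A" "c' \<in> A" and p: "p \<in> patch c \<inter> patch c'"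
  let ?J = "transition_jacobian c c' p"
  let ?d = "grad A g f c' p - ?J *v grad A g f c p"
  \<comment> \<open>As \<open>?J\<close> is onto, the difference \<open>?d\<close> is itself a test vector for the defining property of \<open>grad\<close>.\<close>
  have "invertible ?J" using oriented[OF c p] by (simp add: invertible_det_nz)
  then obtain w where w: "?J *v w = ?d" using matrix_right_invertible_surjective[of ?J]
    unfolding invertible_def surj_def by metis
  have "(?J *v grad A g f c p) \<bullet> (g c' p *v (?J *v w)) = grad A g f c p \<bullet> (g c p *v w)"
    using metric_transform[OF c p] by simp
  also have "\<dots> = frechet_derivative (in_chart c f) (at (coord c p)) w"
    using grad_inner[OF f] c p by simp
  also have "\<dots> = frechet_derivative (in_chart c' f) (at (coord c' p)) (?J *v w)"
    by (rule differential_transition[of UNIV]) (use f c p in \<open>simp_all add: smooth_functions_iff\<close>)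
  also have "\<dots> = grad A g f c' p \<bullet> (g c' p *v (?J *v w))"
    using grad_inner[OF f] c p by simp
  finally have "?d \<bullet> (g c' p *v ?d) = 0" using w by (simp add: inner_diff_left)
  then show "grad A g f c' p = ?J *v grad A g f c p" using metric_pos_def[of c' p ?d] c p by force
qed

text \<open>\<open>along (grad A g f) f\<close> is the function \<open>|\<nabla>f|\<^sup>2\<close>.\<close>

lemma
  assumes f: "f \<in> smooth_functions A"
  shows along_grad_nonneg: "0 \<le> along (grad A g f) f p"
    and grad_eq_0_if_along_eq_0: "along (grad A g f) f p = 0 \<Longrightarrow> c \<in> A \<Longrightarrow> p \<in> patch c \<Longrightarrow> grad A g f c p = 0"
proof -
  have eq: "along (grad A g f) f p = grad A g f c p \<bullet> (g c p *v grad A g f c p)" if "c \<in> A" "p \<in> patch c" for c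
    using along_chart[OF grad_smooth_field[OF f], of UNIV f p c] f grad_inner[OF f that] that
    by (simp add: smooth_functions_iff)
  show "0 \<le> along (grad A g f) f p"
    using eq[OF chart_at] metric_pos_def[OF chart_at[of p], of "grad A g f (chart_at A p) p"]
    by (cases "grad A g f (chart_at A p) p = 0") (auto intro: less_imp_le)
  show "along (grad A g f) f p = 0 \<Longrightarrow> c \<in> A \<Longrightarrow> p \<in> patch c \<Longrightarrow> grad A g f c p = 0"
    using eq metric_pos_def by fastforce
qed

text \<open>The factor vanishes to second order at the zeros of \<open>f\<close>, whereas the gradient of \<open>f\<close> itself need not
  vanish there.\<close>

lemma grad_cube:
  assumes f: "f \<in> smooth_functions A"
  shows "grad A g (\<lambda>q. f q * (f q * f q)) = (\<lambda>c p. (3 * (f p * f p)) *\<^sub>R grad A g f c p)"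
proof (intro ext)
  fix c p
  show "grad A g (\<lambda>q. f q * (f q * f q)) c p = (3 * (f p * f p)) *\<^sub>R grad A g f c p"
  proof (cases "c \<in> A \<and> p \<in> patch c")
    case True
    let ?h = "\<lambda>q. f q * (f q * f q)" and ?y = "coord c p"
    let ?d = "grad A g ?h c p - (3 * (f p * f p)) *\<^sub>R grad A g f c p"
    have h: "?h \<in> smooth_functions A" by (intro smooth_functions_mult f)
    have D: "(in_chart c f has_derivative frechet_derivative (in_chart c f) (at ?y)) (at ?y)"
      using smooth_in_chart_differentiable[of UNIV] f True by (simp add: smooth_functions_iff frechet_derivative_works[symmetric])
    have fy: "in_chart c f ?y = f p" using True by (simp add: in_chart_coord)
    have "((\<lambda>y. in_chart c f y * (in_chart c f y * in_chart c f y)) has_derivative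
        (\<lambda>w. (3 * (f p * f p)) * frechet_derivative (in_chart c f) (at ?y) w)) (at ?y)"
      by (rule has_derivative_eq_rhs[OF has_derivative_mult[OF D has_derivative_mult[OF D D]]])
        (simp add: fy fun_eq_iff algebra_simps)
    then have "frechet_derivative (in_chart c ?h) (at ?y) w = (3 * (f p * f p)) * frechet_derivative (in_chart c f) (at ?y) w" for w
      by (drule_tac fun_cong[OF frechet_derivative_at, where x=w]) (simp add: in_chart_def)
    then have "?d \<bullet> (g c p *v ?d) = 0"
      using grad_inner[OF h] grad_inner[OF f] True by (simp add: inner_diff_left)
    then show ?thesis using metric_pos_def[of c p ?d] True by force
  qed (auto simp: grad_def)
qed

end

section \<open>The Riemannian measure\<close>

context ordered_closed_riemannian_manifold
begin

subsection \<open>The measure of a chart\<close>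

definition chart_volume :: "('a, 'n) chart \<Rightarrow> 'a set \<Rightarrow> ennreal" where
  "chart_volume c B = (\<integral>\<^sup>+ y \<in> coord c ` B. ennreal (sqrt (det (in_chart c (g c) y))) \<partial>lborel)"

text \<open>\<open>chart_volume c\<close> on the subsets of the patch, made into a measure on the whole manifold: the
  points outside the image of the chart have density zero, and are sent to an arbitrary point.\<close>

definition chart_measure :: "('a, 'n) chart \<Rightarrow> 'a measure" where
  "chart_measure c =
     distr (density lborel (\<lambda>y. ennreal (indicator (coord_image c) y * sqrt (det (in_chart c (g c) y)))))
       borel (\<lambda>y. if y \<in> coord_image c then inv_coord c y else undefined)"

lemma in_chart_density: "sqrt (det (in_chart c (g c) y)) = in_chart c (volume_density c) y"
  by (simp add: in_chart_def)

lemma chart_density_pos: "c \<in> A \<Longrightarrow> y \<in> coord_image c \<Longrightarrow> 0 < sqrt (det (in_chart c (g c) y))"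
  unfolding in_chart_density by (auto simp: in_chart_coord det_metric_pos)

lemma chart_density_continuous: "c \<in> A \<Longrightarrow> continuous_on (coord_image c) (\<lambda>y. sqrt (det (in_chart c (g c) y)))"
  unfolding in_chart_density by (intro smooth_on_continuous_on volume_density_smooth)

lemma indicator_mult_borel_measurable:
  fixes h :: "real ^ 'm::finite \<Rightarrow> real"
  assumes "S \<in> sets borel" "continuous_on S h"
  shows "(\<lambda>y. indicator S y * h y) \<in> borel_measurable borel"
proof -
  have "(\<lambda>y. indicator S y *\<^sub>R h y) \<in> borel_measurable borel"
    by (rule borel_measurable_continuous_on_indicator[OF assms])
  then show ?thesis by simp
qed

lemma chart_density_measurable:
  "c \<in> A \<Longrightarrow> (\<lambda>y. indicator (coord_image c) y * sqrt (det (in_chart c (g c) y))) \<in> borel_measurable borel"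
  using indicator_mult_borel_measurable chart_density_continuous open_coord_image borel_open by blast

lemma inv_coord_measurable:
  assumes "c \<in> A"
  shows "(\<lambda>y. if y \<in> coord_image c then inv_coord c y else undefined) \<in> borel_measurable borel"
proof (rule measurable_If_restrict_space_iff[THEN iffD2, rule_format])
  have U: "coord_image c \<in> sets borel" using open_coord_image[OF assms] by simp
  then show "{y \<in> space borel. y \<in> coord_image c} \<in> sets borel" by simp
  show "inv_coord c \<in> borel_measurable (restrict_space borel {y. y \<in> coord_image c}) \<and>
      (\<lambda>_. undefined) \<in> borel_measurable (restrict_space borel {y. y \<notin> coord_image c})"
    using borel_measurable_continuous_on_restrict[OF continuous_on_inv_coord[OF assms]] by simp
qed

lemma coord_image_borel:
  assumes c: "c \<in> A" and B: "B \<in> sets borel" "B \<subseteq> patch c"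
  shows "coord c ` B \<in> sets borel"
proof -
  have "coord c ` B = (\<lambda>y. if y \<in> coord_image c then inv_coord c y else undefined) -` B \<inter> coord_image c"
    using coord_image_eq_vimage[OF c B(2)] by auto
  moreover have "(\<lambda>y. if y \<in> coord_image c then inv_coord c y else undefined) -` B \<in> sets borel"
    using measurable_sets[OF inv_coord_measurable[OF c] B(1)] by simp
  ultimately show ?thesis using open_coord_image[OF c] by auto
qed

lemma sets_chart_measure: "sets (chart_measure c) = sets borel"
  by (simp add: chart_measure_def)

lemma emeasure_chart_measure:
  assumes c: "c \<in> A" and B: "B \<in> sets borel"
  shows "emeasure (chart_measure c) B = chart_volume c (B \<inter> patch c)"
proof -
  let ?h = "\<lambda>y. if y \<in> coord_image c then inv_coord c y else undefined"
  let ?w = "\<lambda>y. sqrt (det (in_chart c (g c) y))"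
  have [measurable]: "(\<lambda>y. ennreal (indicator (coord_image c) y * ?w y)) \<in> borel_measurable borel"
    using chart_density_measurable[OF c] by measurable
  have hB: "?h -` B \<in> sets borel"
    using measurable_sets[OF inv_coord_measurable[OF c] B] by simp
  have "emeasure (chart_measure c) B
      = (\<integral>\<^sup>+y. ennreal (indicator (coord_image c) y * ?w y) * indicator (?h -` B) y \<partial>lborel)"
    unfolding chart_measure_def using inv_coord_measurable[OF c] B hB
    by (simp add: emeasure_distr emeasure_density)
  also have "\<dots> = chart_volume c (B \<inter> patch c)"
    unfolding chart_volume_def
  proof (intro nn_integral_cong)
    fix y
    have "y \<in> coord c ` (B \<inter> patch c) \<longleftrightarrow> y \<in> coord_image c \<and> ?h y \<in> B"
      using coord_image_eq_vimage[OF c, of "B \<inter> patch c"] inv_coord_in_patch[of y c] by auto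
    then show "ennreal (indicator (coord_image c) y * ?w y) * indicator (?h -` B) y
        = ennreal (?w y) * indicator (coord c ` (B \<inter> patch c)) y"
      by (simp add: indicator_def)
  qed
  finally show ?thesis .
qed

text \<open>This is the change of variables formula for the transition map: its Jacobian determinant is the
  quotient of the two volume densities.\<close>

lemma chart_volume_transition:
  assumes c: "c \<in> A" "c' \<in> A" and B: "B \<in> sets borel" "B \<subseteq> patch c" "B \<subseteq> patch c'"
  shows "chart_volume c B = chart_volume c' B"
proof -
  let ?T = "in_chart c (coord c')"
  let ?T' = "\<lambda>y. (*v) (transition_jacobian c c' (inv_coord c y))"
  let ?w = "\<lambda>c y. sqrt (det (in_chart c (g c) y))"
  have img: "?T ` (coord c ` B) = coord c' ` B"
    unfolding image_image by (rule image_cong) (use B c in \<open>auto simp: in_chart_coord\<close>)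
  have eq: "\<bar>det (matrix (?T' y))\<bar> * ?w c' (?T y) = ?w c y" if y: "y \<in> coord c ` B" for y
  proof -
    obtain p where p: "p \<in> B" "y = coord c p" using y by auto
    then show ?thesis
      using volume_density_transition[OF c, of p] B c
      by (auto simp: in_chart_coord inv_coord_coord subset_iff)
  qed
  have "(\<integral>\<^sup>+y\<in>?T ` (coord c ` B). ennreal (?w c' y) \<partial>lborel)
      = (\<integral>\<^sup>+x\<in>coord c ` B. ennreal (\<bar>det (matrix (?T' x))\<bar> * ?w c' (?T x)) \<partial>lborel)"
  proof (rule set_nn_integral_change_of_variables)
    show "coord c ` B \<in> sets borel" by (rule coord_image_borel[OF c(1) B(1,2)])
    show "(?T has_derivative ?T' y) (at y)" if "y \<in> coord c ` B" for y
      using transition_has_derivative[OF c] that B c by (auto simp: inv_coord_coord subset_iff)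
    show "inj_on ?T (coord c ` B)"
    proof (rule inj_onI)
      fix x y assume "x \<in> coord c ` B" "y \<in> coord c ` B" and xy: "?T x = ?T y"
      then obtain p q where p: "p \<in> B" "x = coord c p" and q: "q \<in> B" "y = coord c q" by blast
      then have "coord c' p = coord c' q" using xy B c by (simp add: in_chart_coord subset_iff)
      then have "p = q" using inv_coord_coord[OF c(2), of p] inv_coord_coord[OF c(2), of q] p(1) q(1) B(3) by auto
      then show "x = y" using p q by simp
    qed
    show "(\<lambda>y. indicator (?T ` coord c ` B) y * ?w c' y) \<in> borel_measurable borel"
      unfolding img using B c
      by (intro indicator_mult_borel_measurable coord_image_borel continuous_on_subset[OF chart_density_continuous]) auto
    have "(\<lambda>x. indicator (coord c ` B) x * ?w c x) \<in> borel_measurable borel"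
      using B c
      by (intro indicator_mult_borel_measurable coord_image_borel continuous_on_subset[OF chart_density_continuous]) auto
    moreover have "(\<lambda>x. indicator (coord c ` B) x * ?w c x)
        = (\<lambda>x. indicator (coord c ` B) x * (\<bar>det (matrix (?T' x))\<bar> * ?w c' (?T x)))"
    proof
      fix x show "indicator (coord c ` B) x * ?w c x
          = indicator (coord c ` B) x * (\<bar>det (matrix (?T' x))\<bar> * ?w c' (?T x))"
        by (cases "x \<in> coord c ` B") (simp only: eq, simp)
    qed
    ultimately show "(\<lambda>x. indicator (coord c ` B) x * (\<bar>det (matrix (?T' x))\<bar> * ?w c' (?T x))) \<in> borel_measurable borel"
      by simp
    show "0 \<le> ?w c' (?T y)" if "y \<in> coord c ` B" for y
    proof -
      have "?T y \<in> coord c' ` B" using that img by blast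
      then show ?thesis using chart_density_pos[OF c(2), of "?T y"] B(3) by (intro less_imp_le) blast
    qed
  qed
  also have "\<dots> = chart_volume c B"
    unfolding chart_volume_def
  proof (rule nn_integral_cong)
    fix x show "ennreal (\<bar>det (matrix (?T' x))\<bar> * ?w c' (?T x)) * indicator (coord c ` B) x
        = ennreal (?w c x) * indicator (coord c ` B) x"
      by (cases "x \<in> coord c ` B") (simp only: eq, simp)
  qed
  finally show ?thesis unfolding img by (simp add: chart_volume_def)
qed

subsection \<open>Existence and uniqueness\<close>

lemma chart_partition:
  obtains m :: nat and c D where "\<And>i. c i \<in> A" "\<And>i. D i \<in> sets borel" "\<And>i. D i \<subseteq> patch (c i)"
    "disjoint_family D" "(\<Union>i<m. D i) = UNIV"
proof -
  have "\<And>T. T \<in> patch ` A \<Longrightarrow> open T" using open_patch by auto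
  moreover have "UNIV \<subseteq> \<Union>(patch ` A)" using charts_cover by simp
  ultimately obtain \<F> where F: "\<F> \<subseteq> patch ` A" "finite \<F>" "UNIV \<subseteq> \<Union>\<F>"
    using compactE[OF compact_M] by (metis (no_types, lifting))
  obtain C where C: "C \<subseteq> A" "finite C" "\<F> = patch ` C"
    using finite_subset_image[OF F(2,1)] by blast
  have ne: "C \<noteq> {}" using F(3) C(3) by auto
  obtain f where f: "f ` {..<card C} = C"
    using ex_bij_betw_nat_finite[OF C(2)] bij_betw_imp_surj_on by (metis atLeast0LessThan)
  define c where "c i = (if i < card C then f i else (SOME c. c \<in> C))" for i
  define D where "D = disjointed (\<lambda>i. patch (c i))"
  have cC: "c i \<in> C" for i using f ne by (auto simp: c_def some_in_eq)
  have cA: "c i \<in> A" for i using cC C(1) by blast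
  moreover have "D i \<in> sets borel" for i
    unfolding D_def disjointed_def
    by (intro sets.Diff sets.finite_UN borel_open open_patch cA) simp
  moreover have "D i \<subseteq> patch (c i)" for i unfolding D_def by (rule disjointed_subset)
  moreover have "disjoint_family D" unfolding D_def by (rule disjoint_family_disjointed)
  moreover have "(\<Union>i<card C. D i) = UNIV"
  proof -
    have "(\<Union>i<card C. D i) = (\<Union>i<card C. patch (c i))"
      unfolding D_def using finite_UN_disjointed_eq[of "\<lambda>i. patch (c i)" "card C"] by (simp add: atLeast0LessThan)
    also have "\<dots> = \<Union>(patch ` c ` {..<card C})" by (simp add: image_image)
    also have "c ` {..<card C} = f ` {..<card C}" by (rule image_cong) (simp_all add: c_def)
    finally show ?thesis using F(3) C(3) f by auto
  qed
  ultimately show ?thesis by (rule that[of c D "card C"])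
qed

lemma emeasure_partition:
  fixes \<mu> :: "'a measure" and D :: "nat \<Rightarrow> 'a set"
  assumes "sets \<mu> = sets borel" "\<And>i. D i \<in> sets borel" "disjoint_family D" "(\<Union>i<m. D i) = UNIV" "B \<in> sets borel"
  shows "emeasure \<mu> B = (\<Sum>i<m. emeasure \<mu> (B \<inter> D i))"
proof -
  have "(\<Sum>i<m. emeasure \<mu> (B \<inter> D i)) = emeasure \<mu> (\<Union>i<m. B \<inter> D i)"
  proof (rule sum_emeasure)
    show "disjoint_family_on (\<lambda>i. B \<inter> D i) {..<m}"
      using assms(3) unfolding disjoint_family_on_def by blast
  qed (use assms in auto)
  moreover have "(\<Union>i<m. B \<inter> D i) = B" using assms(4) by blast
  ultimately show ?thesis by simp
qed

text \<open>A measure with the prescribed values on the subsets of patches is glued from the measures of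
  finitely many charts. By \<open>chart_volume_transition\<close> it does not matter which chart
  measures a set in an overlap.\<close>

lemma riemannian_volume_unique:
  "\<exists>!\<mu>. sets \<mu> = sets borel \<and> (\<forall>c\<in>A. \<forall>B\<in>sets borel. B \<subseteq> patch c \<longrightarrow> emeasure \<mu> B = chart_volume c B)"
proof -
  obtain m :: nat and c D where c: "\<And>i. c i \<in> A" and D: "\<And>i. D i \<in> sets borel" "\<And>i. D i \<subseteq> patch (c i)"
    and dis: "disjoint_family D" "(\<Union>i<m. D i) = UNIV"
    using chart_partition by metis
  define \<mu> where "\<mu> = measure_of UNIV (sets borel) (\<lambda>B. \<Sum>i<m. emeasure (chart_measure (c i)) (B \<inter> D i))"
  have sets: "sets \<mu> = sets borel"
    unfolding \<mu>_def using sets.sigma_sets_eq[of "borel :: 'a measure"] by (subst sets_measure_of) simp_all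
  have em: "emeasure \<mu> B = (\<Sum>i<m. emeasure (chart_measure (c i)) (B \<inter> D i))" if "B \<in> sets borel" for B
    unfolding \<mu>_def
  proof (rule emeasure_measure_of_sigma)
    show "sigma_algebra UNIV (sets borel :: 'a set set)" using sets.sigma_algebra_axioms[of borel] by simp
    show "positive (sets borel) (\<lambda>B. \<Sum>i<m. emeasure (chart_measure (c i)) (B \<inter> D i))"
      by (simp add: positive_def)
    show "countably_additive (sets borel) (\<lambda>B. \<Sum>i<m. emeasure (chart_measure (c i)) (B \<inter> D i))"
    proof (rule countably_additiveI)
      fix E :: "nat \<Rightarrow> 'a set" assume E: "range E \<subseteq> sets borel" "disjoint_family E"
      have "(\<Sum>n. emeasure (chart_measure (c i)) (E n \<inter> D i)) = emeasure (chart_measure (c i)) ((\<Union>n. E n) \<inter> D i)" for i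
      proof -
        have "(\<Sum>n. emeasure (chart_measure (c i)) (E n \<inter> D i)) = emeasure (chart_measure (c i)) (\<Union>n. E n \<inter> D i)"
          using E D by (intro suminf_emeasure) (auto simp: sets_chart_measure disjoint_family_on_def)
        moreover have "(\<Union>n. E n \<inter> D i) = (\<Union>n. E n) \<inter> D i" by blast
        ultimately show ?thesis by (simp only:)
      qed
      then show "(\<Sum>n. \<Sum>i<m. emeasure (chart_measure (c i)) (E n \<inter> D i))
          = (\<Sum>i<m. emeasure (chart_measure (c i)) (\<Union> (range E) \<inter> D i))"
        by (simp add: suminf_sum)
    qed
  qed (use that in simp)
  have vol: "emeasure \<mu> B = chart_volume c' B" if c': "c' \<in> A" and B: "B \<in> sets borel" "B \<subseteq> patch c'" for c' B
  proof -
    have "emeasure (chart_measure (c i)) (B \<inter> D i) = emeasure (chart_measure c') (B \<inter> D i)" for i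
    proof -
      have "B \<inter> D i \<in> sets borel" using B(1) D(1) by auto
      moreover have "B \<inter> D i \<inter> patch (c i) = B \<inter> D i" "B \<inter> D i \<inter> patch c' = B \<inter> D i" using B(2) D(2) by auto
      moreover have "chart_volume (c i) (B \<inter> D i) = chart_volume c' (B \<inter> D i)"
        by (rule chart_volume_transition) (use c c' B D(1) D(2)[of i] in auto)
      ultimately show ?thesis using c c' by (simp add: emeasure_chart_measure)
    qed
    then have "emeasure \<mu> B = emeasure (chart_measure c') B"
      using em[OF B(1)] emeasure_partition[OF sets_chart_measure D(1) dis B(1)] by simp
    then show ?thesis using emeasure_chart_measure[OF c' B(1)] B(2) by (simp add: inf.absorb1)
  qed
  show ?thesis
  proof (rule ex1I[of _ \<mu>])
    fix \<nu> assume \<nu>: "sets \<nu> = sets borel \<and> (\<forall>c\<in>A. \<forall>B\<in>sets borel. B \<subseteq> patch c \<longrightarrow> emeasure \<nu> B = chart_volume c B)"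
    show "\<nu> = \<mu>"
    proof (rule measure_eqI)
      fix B assume "B \<in> sets \<nu>"
      then have B: "B \<in> sets borel" using \<nu> by simp
      have "emeasure \<nu> (B \<inter> D i) = emeasure \<mu> (B \<inter> D i)" for i
      proof -
        have "B \<inter> D i \<in> sets borel" "B \<inter> D i \<subseteq> patch (c i)" using B D by auto
        then show ?thesis using vol[OF c] \<nu> c by metis
      qed
      then show "emeasure \<nu> B = emeasure \<mu> B"
        using emeasure_partition[of \<nu>, OF _ D(1) dis B] emeasure_partition[OF sets D(1) dis B] \<nu> by simp
    qed (use sets \<nu> in simp)
  qed (use sets vol in blast)
qed

abbreviation vol :: "'a measure" where "vol \<equiv> riemannian_volume A g"

lemma sets_vol: "sets vol = sets borel"
  and emeasure_vol: "c \<in> A \<Longrightarrow> B \<in> sets borel \<Longrightarrow> B \<subseteq> patch c \<Longrightarrow> emeasure vol B = chart_volume c B"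
  using theI'[OF riemannian_volume_unique] unfolding riemannian_volume_def chart_volume_def by blast+

lemma space_vol: "space vol = UNIV"
  using sets_eq_imp_space_eq[OF sets_vol] by simp

lemma borel_measurable_vol: "borel_measurable vol = borel_measurable borel"
  by (rule measurable_cong_sets) (simp_all add: sets_vol)

subsection \<open>Integrals\<close>

lemma integral_in_chart:
  fixes f :: "'a \<Rightarrow> real"
  assumes c: "c \<in> A" and f: "f \<in> borel_measurable borel" and zero: "\<And>p. p \<notin> patch c \<Longrightarrow> f p = 0"
  shows "(\<integral>p. f p \<partial>vol) = (\<integral>y. indicator (coord_image c) y * in_chart c (volume_density c) y * in_chart c f y \<partial>lborel)"
proof -
  let ?w = "\<lambda>y. indicator (coord_image c) y * sqrt (det (in_chart c (g c) y))"
  let ?h = "\<lambda>y. if y \<in> coord_image c then inv_coord c y else undefined"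
  have patch: "patch c \<in> sets borel" using open_patch[OF c] by simp
  have "density vol (\<lambda>p. ennreal (indicator (patch c) p)) = chart_measure c"
  proof (rule measure_eqI)
    fix B assume "B \<in> sets (density vol (\<lambda>p. ennreal (indicator (patch c) p)))"
    then have B: "B \<in> sets borel" by (simp add: sets_vol)
    have "emeasure (density vol (\<lambda>p. ennreal (indicator (patch c) p))) B
        = (\<integral>\<^sup>+p. ennreal (indicator (patch c) p) * indicator B p \<partial>vol)"
      using B patch by (intro emeasure_density) (auto simp: sets_vol borel_measurable_vol)
    also have "\<dots> = (\<integral>\<^sup>+p. indicator (B \<inter> patch c) p \<partial>vol)"
      by (intro nn_integral_cong) (auto simp: indicator_def)
    also have "\<dots> = emeasure (chart_measure c) B"
      using B patch emeasure_vol[OF c, of "B \<inter> patch c"] by (simp add: emeasure_chart_measure[OF c B] sets_vol)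
    finally show "emeasure (density vol (\<lambda>p. ennreal (indicator (patch c) p))) B = emeasure (chart_measure c) B" .
  qed (simp add: sets_vol sets_chart_measure)
  moreover have "(\<integral>p. f p \<partial>density vol (\<lambda>p. ennreal (indicator (patch c) p))) = (\<integral>p. indicator (patch c) p *\<^sub>R f p \<partial>vol)"
    using f patch by (intro integral_density) (auto simp: borel_measurable_vol)
  moreover have "(\<lambda>p. indicator (patch c) p *\<^sub>R f p) = f"
    by (rule ext) (metis indicator_simps scaleR_one scaleR_zero_left zero)
  ultimately have "(\<integral>p. f p \<partial>vol) = (\<integral>p. f p \<partial>chart_measure c)" by simp
  also have "\<dots> = (\<integral>y. f (?h y) \<partial>density lborel (\<lambda>y. ennreal (?w y)))"
    unfolding chart_measure_def using f inv_coord_measurable[OF c] by (intro integral_distr) auto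
  also have "\<dots> = (\<integral>y. ?w y *\<^sub>R f (?h y) \<partial>lborel)"
  proof (rule integral_density)
    show "(\<lambda>y. f (?h y)) \<in> borel_measurable lborel"
      using measurable_compose[OF inv_coord_measurable[OF c] f] by simp
    show "?w \<in> borel_measurable lborel" using chart_density_measurable[OF c] by simp
    show "AE y in lborel. 0 \<le> ?w y"
      using chart_density_pos[OF c] by (intro AE_I2) (auto simp: indicator_def intro: less_imp_le)
  qed
  also have "\<dots> = (\<integral>y. indicator (coord_image c) y * in_chart c (volume_density c) y * in_chart c f y \<partial>lborel)"
    by (intro Bochner_Integration.integral_cong) (auto simp: in_chart_def indicator_def)
  finally show ?thesis .
qed

lemma emeasure_vol_open_pos:
  assumes W: "open W" "p \<in> W" shows "emeasure vol W \<noteq> 0"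
proof
  assume 0: "emeasure vol W = 0"
  let ?c = "chart_at A p" and ?W = "patch (chart_at A p) \<inter> W"
  let ?w = "\<lambda>y. sqrt (det (in_chart ?c (g ?c) y))"
  note c = chart_at[of p]
  have S: "open (coord ?c ` ?W)" using open_coord_subset[OF c(1) W(1)] .
  have B: "?W \<in> sets borel" using open_patch[OF c(1)] W(1) by auto
  have "(\<lambda>y. indicator (coord ?c ` ?W) y * ?w y) \<in> borel_measurable borel"
    using S by (intro indicator_mult_borel_measurable continuous_on_subset[OF chart_density_continuous[OF c(1)]]) auto
  moreover have "(\<lambda>y. ennreal (?w y) * indicator (coord ?c ` ?W) y)
      = (\<lambda>y. ennreal (indicator (coord ?c ` ?W) y * ?w y))"
    by (auto simp: indicator_def)
  ultimately have meas: "(\<lambda>y. ennreal (?w y) * indicator (coord ?c ` ?W) y) \<in> borel_measurable lborel"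
    by simp
  have "emeasure vol ?W \<le> emeasure vol W" using B W(1) by (intro emeasure_mono) (auto simp: sets_vol)
  then have "(\<integral>\<^sup>+ y \<in> coord ?c ` ?W. ennreal (?w y) \<partial>lborel) = 0"
    using 0 emeasure_vol[OF c(1) B] by (simp add: chart_volume_def)
  then have "emeasure lborel {y \<in> space lborel. ennreal (?w y) * indicator (coord ?c ` ?W) y \<noteq> 0} = 0"
    using nn_integral_0_iff[OF meas] by simp
  moreover have "{y \<in> space lborel. ennreal (?w y) * indicator (coord ?c ` ?W) y \<noteq> 0} = coord ?c ` ?W"
    using chart_density_pos[OF c(1)] by (auto simp: indicator_def ennreal_eq_0_iff not_le)
  ultimately have "emeasure lborel (coord ?c ` ?W) = 0" by metis
  then have "negligible (coord ?c ` ?W)" using S by (simp add: negligible_iff_emeasure0 borel_open)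
  moreover have "coord ?c ` ?W \<noteq> {}" using c W by auto
  ultimately show False using open_not_negligible[OF S] by blast
qed

lemma finite_measure_vol: "finite_measure vol"
proof
  have "\<exists>W. open W \<and> p \<in> W \<and> emeasure vol W < \<infinity>" for p
  proof -
    let ?c = "chart_at A p"
    let ?w = "\<lambda>y. sqrt (det (in_chart ?c (g ?c) y))"
    note c = chart_at[of p]
    obtain r where r: "r > 0" "cball (coord ?c p) r \<subseteq> coord_image ?c"
      using open_coord_image[OF c(1)] c(2) open_contains_cball by blast
    let ?W = "coord ?c -` ball (coord ?c p) r \<inter> patch ?c"
    have W: "open ?W" "p \<in> ?W" using open_coord_preimage[OF c(1)] c(2) r(1) by auto
    have "integrable lborel (\<lambda>y. indicator (cball (coord ?c p) r) y *\<^sub>R ?w y)"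
      by (intro borel_integrable_compact continuous_on_subset[OF chart_density_continuous[OF c(1)]] r compact_cball)
    then have fin: "(\<integral>\<^sup>+y. ennreal (indicator (cball (coord ?c p) r) y *\<^sub>R ?w y) \<partial>lborel) < \<infinity>"
      using integrableD(2) r(2) chart_density_pos[OF c(1)] nn_integral_eq_integral
      by (subst nn_integral_eq_integral) (auto simp: indicator_def subset_iff intro!: AE_I2 less_imp_le)
    have "emeasure vol ?W = (\<integral>\<^sup>+ y \<in> coord ?c ` ?W. ennreal (?w y) \<partial>lborel)"
      using emeasure_vol[OF c(1), of ?W] W(1) by (simp add: chart_volume_def)
    also have "\<dots> \<le> (\<integral>\<^sup>+y. ennreal (indicator (cball (coord ?c p) r) y *\<^sub>R ?w y) \<partial>lborel)"
      by (intro nn_integral_mono) (auto simp: indicator_def)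
    finally show ?thesis using W fin by (meson le_less_trans)
  qed
  then obtain W where W: "\<And>p. open (W p)" "\<And>p. p \<in> W p" "\<And>p. emeasure vol (W p) < \<infinity>" by metis
  obtain F where F: "finite F" "UNIV \<subseteq> (\<Union>p\<in>F. W p)"
    by (rule compactE_image[OF compact_M, of UNIV W]) (use W in auto)
  have "emeasure vol (space vol) \<le> emeasure vol (\<Union>p\<in>F. W p)"
    using F(2) W(1) F(1) by (intro emeasure_mono) (auto simp: sets_vol)
  also have "\<dots> \<le> (\<Sum>p\<in>F. emeasure vol (W p))"
    using F(1) W(1) by (intro emeasure_subadditive_finite) (auto simp: sets_vol)
  also have "\<dots> < \<infinity>" using F(1) W(3) by simp
  finally show "emeasure vol (space vol) \<noteq> \<infinity>" by simp
qed

lemma continuous_measurable_vol: "continuous_on UNIV f \<Longrightarrow> f \<in> borel_measurable (borel :: 'a measure)"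
  for f :: "'a \<Rightarrow> real"
  by (rule borel_measurable_continuous_onI)

lemma smooth_function_bounded:
  assumes "f \<in> smooth_functions A" obtains B where "\<And>p. \<bar>f p\<bar> \<le> B"
proof -
  have "compact (f ` UNIV)"
    using compact_continuous_image[OF smooth_functions_continuous_on[OF assms] compact_M] .
  then obtain B where "\<forall>y\<in>range f. norm y \<le> B" using compact_imp_bounded bounded_iff by blast
  then show ?thesis using that[of B] by auto
qed

lemma smooth_integrable:
  assumes "f \<in> smooth_functions A" shows "integrable vol f"
proof -
  interpret finite_measure vol by (rule finite_measure_vol)
  obtain B where "\<And>p. \<bar>f p\<bar> \<le> B" using smooth_function_bounded[OF assms] by blast
  then show ?thesis
    by (intro integrable_const_bound[of _ B])
      (auto simp: borel_measurable_vol continuous_measurable_vol smooth_functions_continuous_on assms)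
qed

lemma integral_nonneg_eq_0:
  assumes f: "f \<in> smooth_functions A" "\<And>p. 0 \<le> f p" and 0: "(\<integral>p. f p \<partial>vol) = 0"
  shows "f p = 0"
proof (rule ccontr)
  assume p: "f p \<noteq> 0"
  have "AE q in vol. f q = 0"
    using integral_nonneg_eq_0_iff_AE[OF smooth_integrable[OF f(1)]] f(2) 0 by simp
  moreover have "open {q. 0 < f q}"
    using smooth_functions_continuous_on[OF f(1)] by (intro open_Collect_less) auto
  ultimately have "emeasure vol {q. 0 < f q} = 0"
    by (subst (asm) AE_iff_measurable[of "{q. 0 < f q}"])
      (use f(2) in \<open>auto simp: sets_vol space_vol order_less_le\<close>)
  then show False using emeasure_vol_open_pos[OF \<open>open {q. 0 < f q}\<close>, of p] p f(2)[of p] by (simp add: less_le)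
qed

end

section \<open>The divergence theorem\<close>

context ordered_closed_riemannian_manifold
begin

definition chart_divergence :: "('a, 'n) chart \<Rightarrow> ('a, 'n) vfield \<Rightarrow> 'a \<Rightarrow> real" where
  "chart_divergence c V p =
     (\<Sum>i\<in>UNIV. partial_deriv i (in_chart c (\<lambda>q. volume_density c q * V c q $ i)) (coord c p)) / volume_density c p"

lemma divergence_chart_at: "divergence A g V p = chart_divergence (chart_at A p) V p"
  by (simp add: divergence_def chart_divergence_def Let_def)

lemma weighted_component_smooth:
  assumes "smooth_field V" "c \<in> A"
  shows "smooth_on (coord_image c) (in_chart c (\<lambda>q. volume_density c q * V c q $ i))"
proof -
  have "smooth_on (coord_image c) (\<lambda>y. in_chart c (volume_density c) y * in_chart c (\<lambda>q. V c q $ i) y)"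
    using assms by (intro smooth_on_mult open_coord_image volume_density_smooth) (auto simp: smooth_field_def)
  then show ?thesis by (simp add: in_chart_def)
qed

lemma chart_divergence_smooth:
  assumes V: "smooth_field V" and c: "c \<in> A" shows "smooth_in (patch c) (chart_divergence c V)"
proof (rule smooth_in_chartI[OF c open_patch[OF c] subset_refl])
  have "smooth_on (coord_image c) (\<lambda>y. (\<Sum>i\<in>UNIV. partial_deriv i (in_chart c (\<lambda>q. volume_density c q * V c q $ i)) y)
      / in_chart c (volume_density c) y)"
    by (intro smooth_on_divide smooth_on_sum smooth_on_partial_deriv weighted_component_smooth open_coord_image
        volume_density_smooth V c)
      (use volume_density_pos[OF c] c in \<open>force simp: in_chart_coord\<close>)
  then show "smooth_on (coord_image c) (in_chart c (chart_divergence c V))"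
    by (rule smooth_on_cong[OF open_coord_image[OF c]]) (auto simp: in_chart_coord c chart_divergence_def)
qed

lemma supported_mult_smooth:
  assumes W: "open W" and f: "smooth_in W f" and h: "h \<in> smooth_functions A"
    and K: "compact K" "K \<subseteq> W" "\<And>p. p \<notin> K \<Longrightarrow> h p = 0"
  shows "(\<lambda>p. h p * f p) \<in> smooth_functions A"
proof (rule smooth_functions_supportI[OF W _ K(1,2)])
  have "smooth_in W h" using h by (simp add: smooth_functions_iff smooth_in_subset[of UNIV])
  then show "smooth_in W (\<lambda>p. h p * f p)" by (intro smooth_in_mult W f)
qed (simp add: K(3))

text \<open>Integration by parts in one chart: the sum of the two integrands is, in coordinates and after
  multiplication with the volume density, the Euclidean divergence of a compactly supported field.\<close>

lemma chart_divergence_by_parts: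
  assumes V: "smooth_field V" and c: "c \<in> A" and h: "h \<in> smooth_functions A"
    and K: "compact K" "K \<subseteq> patch c" "\<And>p. p \<notin> K \<Longrightarrow> h p = 0"
  shows "(\<integral>p. h p * chart_divergence c V p \<partial>vol) = - (\<integral>p. along V h p \<partial>vol)"
proof -
  let ?U = "coord_image c" and ?w = "in_chart c (volume_density c)"
  let ?q = "\<lambda>i y. in_chart c h y * in_chart c (\<lambda>q. volume_density c q * V c q $ i) y"
  define F where "F i y = (if y \<in> ?U then ?q i y else 0)" for i y
  have U: "open ?U" using open_coord_image[OF c] .
  have wq: "smooth_on ?U (in_chart c (\<lambda>q. volume_density c q * V c q $ i))" for i
    by (rule weighted_component_smooth[OF V c])
  have hq: "smooth_on ?U (in_chart c h)" by (rule smooth_functions_in_chart[OF h c])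
  have q: "smooth_on ?U (?q i)" for i by (intro smooth_on_mult U wq hq)
  have K': "compact (coord c ` K)"
    using compact_continuous_image[OF continuous_on_subset[OF continuous_on_coord[OF c] K(2)] K(1)] .
  have F0: "F i y = 0" if "y \<notin> coord c ` K" for i y
  proof (cases "y \<in> ?U")
    case True
    then have "inv_coord c y \<notin> K" using that coord_inv_coord[of y c] by (metis image_eqI)
    then show ?thesis by (simp add: F_def in_chart_def K(3))
  qed (simp add: F_def)
  have opK: "open (- (coord c ` K))" using compact_imp_closed[OF K'] by (rule open_Compl)
  have F: "smooth_on UNIV (F i)" for i
  proof -
    have "smooth_on ?U (F i)" by (rule smooth_on_cong[OF U q[of i]]) (simp add: F_def)
    moreover have "smooth_on (- (coord c ` K)) (F i)"
      by (rule smooth_on_cong[OF opK smooth_on_const[OF opK, of 0]]) (simp add: F0)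
    moreover have "\<Union>{?U, - (coord c ` K)} = UNIV" using K(2) by auto
    ultimately show ?thesis using smooth_on_Union[of "{?U, - (coord c ` K)}" "F i"] by auto
  qed
  have zero: "has_bochner_integral lborel (\<lambda>y. \<Sum>i\<in>UNIV. partial_deriv i (F i) y) (\<Sum>i\<in>(UNIV::'n set). 0)"
  proof (rule has_bochner_integral_sum)
    fix i
    show "has_bochner_integral lborel (partial_deriv i (F i)) 0"
      by (rule has_bochner_integral_partial_deriv_0[OF smooth_on_differentiable[OF F UNIV_I] _ K' F0])
        (rule smooth_on_continuous_on[OF smooth_on_partial_deriv[OF F]])
  qed
  have pointwise: "indicator ?U y * ?w y * in_chart c (\<lambda>p. h p * chart_divergence c V p + along V h p) y
      = (\<Sum>i\<in>UNIV. partial_deriv i (F i) y)" for y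
  proof (cases "y \<in> ?U")
    case True
    define p where "p = inv_coord c y"
    have p: "p \<in> patch c" "coord c p = y" using True by (simp_all add: p_def inv_coord_in_patch coord_inv_coord)
    have "partial_deriv i (F i) y = h p * partial_deriv i (in_chart c (\<lambda>q. volume_density c q * V c q $ i)) y
        + partial_deriv i (in_chart c h) y * (volume_density c p * V c p $ i)" for i
    proof -
      have "partial_deriv i (F i) y = partial_deriv i (?q i) y"
        by (rule partial_deriv_cong[OF U True smooth_on_differentiable[OF F UNIV_I]]) (simp add: F_def)
      also have "\<dots> = h p * partial_deriv i (in_chart c (\<lambda>q. volume_density c q * V c q $ i)) y
          + partial_deriv i (in_chart c h) y * (volume_density c p * V c p $ i)"
      proof -
        have "(?q i has_derivative (\<lambda>v. in_chart c h y * frechet_derivative (in_chart c (\<lambda>q. volume_density c q * V c q $ i)) (at y) v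
            + frechet_derivative (in_chart c h) (at y) v * in_chart c (\<lambda>q. volume_density c q * V c q $ i) y)) (at y)"
          using smooth_on_differentiable[OF hq True] smooth_on_differentiable[OF wq True]
          by (intro has_derivative_mult) (simp_all add: frechet_derivative_works)
        from partial_deriv_eq[OF this] show ?thesis
          by (simp add: partial_deriv_def in_chart_coord[OF c p(1), unfolded p(2)])
      qed
      finally show ?thesis .
    qed
    then have "(\<Sum>i\<in>UNIV. partial_deriv i (F i) y)
        = h p * (\<Sum>i\<in>UNIV. partial_deriv i (in_chart c (\<lambda>q. volume_density c q * V c q $ i)) y)
          + volume_density c p * (\<Sum>i\<in>UNIV. V c p $ i * partial_deriv i (in_chart c h) y)"
      by (simp add: sum.distrib sum_distrib_left mult_ac)
    also have "\<dots> = volume_density c p * (h p * chart_divergence c V p + along V h p)"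
      using volume_density_pos[OF c p(1)] along_coordinates[OF V, of UNIV h c p] h c p
      by (simp add: chart_divergence_def smooth_functions_iff field_simps)
    also have "\<dots> = indicator ?U y * ?w y * in_chart c (\<lambda>p. h p * chart_divergence c V p + along V h p) y"
      using True by (simp add: in_chart_coord[OF c p(1), unfolded p(2)])
    finally show ?thesis by simp
  next
    case False
    have "partial_deriv i (F i) y = 0" for i
    proof -
      have "partial_deriv i (F i) y = partial_deriv i (\<lambda>_. 0) y"
        by (rule partial_deriv_cong[OF opK _ smooth_on_differentiable[OF F UNIV_I]])
          (use False K(2) F0 in auto)
      then show ?thesis by (simp add: partial_deriv_def)
    qed
    then show ?thesis using False by simp
  qed
  have sm: "(\<lambda>p. h p * chart_divergence c V p) \<in> smooth_functions A" "along V h \<in> smooth_functions A"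
    using supported_mult_smooth[OF open_patch[OF c] chart_divergence_smooth[OF V c] h K] along_smooth[OF V h] by auto
  have "(\<integral>p. h p * chart_divergence c V p + along V h p \<partial>vol)
      = (\<integral>y. indicator ?U y * ?w y * in_chart c (\<lambda>p. h p * chart_divergence c V p + along V h p) y \<partial>lborel)"
  proof (rule integral_in_chart[OF c])
    show "(\<lambda>p. h p * chart_divergence c V p + along V h p) \<in> borel_measurable borel"
      by (intro continuous_measurable_vol smooth_functions_continuous_on smooth_functions_add sm)
    show "h p * chart_divergence c V p + along V h p = 0" if "p \<notin> patch c" for p
    proof -
      have "p \<notin> K" using that K(2) by blast
      then show ?thesis
        using along_eq_0_outside_support[OF compact_imp_closed[OF K(1)] K(3)] by (simp add: K(3))
    qed
  qed
  also have "\<dots> = 0" using zero by (simp only: pointwise) (simp add: has_bochner_integral_iff)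
  finally show ?thesis using smooth_integrable[OF sm(1)] smooth_integrable[OF sm(2)] by simp
qed

text \<open>The right hand side of the integration by parts does not depend on the chart. So the
  difference \<open>D\<close> of the divergences in two charts is orthogonal to all smooth functions
  with compact support in the overlap, in particular to \<open>b D\<close> for a bump function \<open>b\<close>.\<close>

lemma chart_divergence_unique:
  assumes V: "smooth_field V" and c: "c \<in> A" "c' \<in> A" and p: "p \<in> patch c" "p \<in> patch c'"
  shows "chart_divergence c V p = chart_divergence c' V p"
proof -
  let ?W = "patch c \<inter> patch c'"
  define D where "D q = chart_divergence c V q - chart_divergence c' V q" for q
  have W: "open ?W" by (intro open_Int open_patch c)
  obtain b K where b: "b \<in> smooth_functions A" "\<And>q. 0 \<le> b q" "0 < b p" and K: "compact K" "K \<subseteq> ?W"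
    "\<And>q. q \<notin> K \<Longrightarrow> b q = 0"
    using bump_around[OF W] p by (metis IntI)
  have sm: "smooth_in ?W (chart_divergence c V)" "smooth_in ?W (chart_divergence c' V)"
    using chart_divergence_smooth[OF V] c by (blast intro: smooth_in_subset)+
  then have D: "smooth_in ?W D" unfolding D_def[abs_def] by (intro smooth_in_diff W)
  have bD: "(\<lambda>q. b q * D q) \<in> smooth_functions A" by (rule supported_mult_smooth[OF W D b(1) K])
  have bDK: "\<And>q. q \<notin> K \<Longrightarrow> b q * D q = 0" using K(3) by simp
  have bDd: "(\<lambda>q. b q * D q * chart_divergence c V q) \<in> smooth_functions A"
      "(\<lambda>q. b q * D q * chart_divergence c' V q) \<in> smooth_functions A"
    by (rule supported_mult_smooth[OF W sm(1) bD K(1,2) bDK], assumption,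
        rule supported_mult_smooth[OF W sm(2) bD K(1,2) bDK], assumption)
  have "(\<integral>q. b q * D q * chart_divergence c V q \<partial>vol) = (\<integral>q. b q * D q * chart_divergence c' V q \<partial>vol)"
    using chart_divergence_by_parts[OF V c(1) bD K(1) _ bDK] chart_divergence_by_parts[OF V c(2) bD K(1) _ bDK] K(2)
    by simp
  then have "(\<integral>q. b q * D q * chart_divergence c V q - b q * D q * chart_divergence c' V q \<partial>vol) = 0"
    using smooth_integrable[OF bDd(1)] smooth_integrable[OF bDd(2)] by simp
  moreover have eq: "(\<lambda>q. b q * D q * chart_divergence c V q - b q * D q * chart_divergence c' V q) = (\<lambda>q. b q * (D q * D q))"
    by (simp add: D_def algebra_simps)
  ultimately have int0: "(\<integral>q. b q * (D q * D q) \<partial>vol) = 0" by (simp only:)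
  have sm2: "(\<lambda>q. b q * (D q * D q)) \<in> smooth_functions A"
    using smooth_functions_diff[OF bDd] unfolding eq .
  have "b p * (D p * D p) = 0"
    by (rule integral_nonneg_eq_0[OF sm2 _ int0]) (simp add: b(2))
  then show ?thesis using b(3) by (simp add: D_def)
qed

lemma divergence_chart:
  "smooth_field V \<Longrightarrow> c \<in> A \<Longrightarrow> p \<in> patch c \<Longrightarrow> divergence A g V p = chart_divergence c V p"
  unfolding divergence_chart_at by (rule chart_divergence_unique[OF _ chart_at(1) _ chart_at(2)])

lemma divergence_smooth:
  assumes V: "smooth_field V" shows "divergence A g V \<in> smooth_functions A"
proof -
  have "smooth_in (patch c) (divergence A g V)" if "c \<in> A" for c
    by (rule smooth_in_cong[OF open_patch[OF that] chart_divergence_smooth[OF V that]])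
      (simp add: divergence_chart[OF V that])
  then have "smooth_in (\<Union>(patch ` A)) (divergence A g V)" by (intro smooth_in_Union) auto
  then show ?thesis using charts_cover by (simp add: smooth_functions_iff)
qed

lemma divergence_scale:
  assumes V: "smooth_field V" and f: "f \<in> smooth_functions A"
  shows "divergence A g (\<lambda>c p. f p *\<^sub>R V c p) p = f p * divergence A g V p + along V f p"
proof -
  let ?c = "chart_at A p"
  note c = chart_at[of p]
  let ?h = "\<lambda>i. in_chart ?c (\<lambda>q. volume_density ?c q * V ?c q $ i)"
  have y: "coord ?c p \<in> coord_image ?c" using c by blast
  have pd: "partial_deriv i (in_chart ?c (\<lambda>q. volume_density ?c q * (f q *\<^sub>R V ?c q) $ i)) (coord ?c p)
      = f p * partial_deriv i (?h i) (coord ?c p)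
        + partial_deriv i (in_chart ?c f) (coord ?c p) * (volume_density ?c p * V ?c p $ i)" for i
  proof -
    have "((\<lambda>y. in_chart ?c f y * ?h i y) has_derivative (\<lambda>v. in_chart ?c f (coord ?c p) * frechet_derivative (?h i) (at (coord ?c p)) v
        + frechet_derivative (in_chart ?c f) (at (coord ?c p)) v * ?h i (coord ?c p))) (at (coord ?c p))"
      using smooth_on_differentiable[OF smooth_functions_in_chart[OF f c(1)] y]
        smooth_on_differentiable[OF weighted_component_smooth[OF V c(1)] y]
      by (intro has_derivative_mult) (simp_all add: frechet_derivative_works)
    moreover have "(\<lambda>y. in_chart ?c f y * ?h i y) = in_chart ?c (\<lambda>q. volume_density ?c q * (f q *\<^sub>R V ?c q) $ i)"
      by (simp add: in_chart_def mult_ac)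
    ultimately show ?thesis
      using partial_deriv_eq[of "in_chart ?c (\<lambda>q. volume_density ?c q * (f q *\<^sub>R V ?c q) $ i)" _ "coord ?c p" i]
        by (simp add: partial_deriv_def in_chart_coord[OF c])
  qed
  have along: "along V f p = (\<Sum>i\<in>UNIV. V ?c p $ i * partial_deriv i (in_chart ?c f) (coord ?c p))"
    using along_coordinates[OF V, of UNIV f ?c p] f c by (simp add: smooth_functions_iff)
  have "(\<Sum>i\<in>UNIV. partial_deriv i (in_chart ?c (\<lambda>q. volume_density ?c q * (f q *\<^sub>R V ?c q) $ i)) (coord ?c p))
      = f p * (\<Sum>i\<in>UNIV. partial_deriv i (?h i) (coord ?c p)) + volume_density ?c p * along V f p"
    unfolding pd along by (simp add: sum.distrib sum_distrib_left mult_ac)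
  then show ?thesis
    unfolding divergence_chart_at chart_divergence_def using volume_density_pos[OF c]
    by (simp add: add_divide_distrib)
qed

lemma partition_of_unity:
  obtains F :: "'a set" and u :: "'a \<Rightarrow> 'a \<Rightarrow> real" and K where "finite F" "\<And>p. u p \<in> smooth_functions A"
    "\<And>q. (\<Sum>p\<in>F. u p q) = 1" "\<And>p. compact (K p)" "\<And>p. K p \<subseteq> patch (chart_at A p)"
    "\<And>p q. q \<notin> K p \<Longrightarrow> u p q = 0"
proof -
  have "\<exists>b K. b \<in> smooth_functions A \<and> (\<forall>q. 0 \<le> b q) \<and> 0 < b p \<and> compact K \<and> K \<subseteq> patch (chart_at A p)
      \<and> (\<forall>q. q \<notin> K \<longrightarrow> b q = 0)" for p
    using bump_around[OF open_patch[OF chart_at(1)[of p]] chart_at(2)[of p]] by metis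
  then obtain b K where b: "\<And>p. b p \<in> smooth_functions A" "\<And>p q. 0 \<le> (b p q :: real)" "\<And>p. 0 < b p p"
    and K: "\<And>p. compact (K p)" "\<And>p. K p \<subseteq> patch (chart_at A p)" "\<And>p q. q \<notin> K p \<Longrightarrow> b p q = 0"
    by metis
  have op: "open {q. 0 < b p q}" for p
    using smooth_functions_continuous_on[OF b(1)] by (intro open_Collect_less) auto
  have cover: "UNIV \<subseteq> (\<Union>p\<in>UNIV. {q. 0 < b p q})" using b(3) by auto
  obtain F where F: "finite F" "UNIV \<subseteq> (\<Union>p\<in>F. {q. 0 < b p q})"
    by (rule compactE_image[OF compact_M, of UNIV "\<lambda>p. {q. 0 < b p q}"]) (use op cover in auto)
  let ?S = "\<lambda>q. \<Sum>p\<in>F. b p q"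
  have S: "0 < ?S q" for q
  proof -
    obtain p where "p \<in> F" "0 < b p q" using F(2) by auto
    then show ?thesis using F(1) b(2) by (intro sum_pos2) auto
  qed
  show ?thesis
  proof (rule that[of F "\<lambda>p q. b p q / ?S q" K])
    show "(\<lambda>q. b p q / ?S q) \<in> smooth_functions A" for p
      using b(1) S unfolding smooth_functions_iff
      by (intro smooth_in_divide smooth_in_sum open_UNIV) (auto simp: less_imp_neq[symmetric])
    show "(\<Sum>p\<in>F. b p q / ?S q) = 1" for q
      using S[of q] by (simp flip: sum_divide_distrib)
  qed (use F K in auto)
qed

text \<open>For each function \<open>u\<close> of a partition of unity, the integral of \<open>u div V\<close> is that of \<open>- V(u)\<close>. The
  functions \<open>V(u)\<close> add up to the derivative of the constant \<open>1\<close>.\<close>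

theorem divergence_integral_0:
  assumes V: "smooth_field V" shows "(\<integral>p. divergence A g V p \<partial>vol) = 0"
proof -
  obtain F :: "'a set" and u :: "'a \<Rightarrow> 'a \<Rightarrow> real" and K where F: "finite F" and u: "\<And>p. u p \<in> smooth_functions A"
    "\<And>q. (\<Sum>p\<in>F. u p q) = 1" and K: "\<And>p. compact (K p)" "\<And>p. K p \<subseteq> patch (chart_at A p)"
    "\<And>p q. q \<notin> K p \<Longrightarrow> u p q = 0"
    using partition_of_unity by metis
  have div: "divergence A g V \<in> smooth_functions A" by (rule divergence_smooth[OF V])
  have part: "(\<integral>q. u p q * divergence A g V q \<partial>vol) = - (\<integral>q. along V (u p) q \<partial>vol)" for p
  proof -
    have "(\<lambda>q. u p q * divergence A g V q) = (\<lambda>q. u p q * chart_divergence (chart_at A p) V q)"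
    proof
      fix q show "u p q * divergence A g V q = u p q * chart_divergence (chart_at A p) V q"
        using K(2)[of p] K(3)[of q p] divergence_chart[OF V chart_at(1)[of p], of q] by (cases "q \<in> K p") auto
    qed
    then show ?thesis
      using chart_divergence_by_parts[OF V chart_at(1)[of p] u(1)[of p] K(1)[of p] K(2)[of p] K(3)[of _ p]] by simp
  qed
  have "(\<integral>q. divergence A g V q \<partial>vol) = (\<integral>q. (\<Sum>p\<in>F. u p q * divergence A g V q) \<partial>vol)"
    by (simp add: u(2) flip: sum_distrib_right)
  also have "\<dots> = (\<Sum>p\<in>F. - (\<integral>q. along V (u p) q \<partial>vol))"
    by (subst Bochner_Integration.integral_sum)
      (simp_all add: part smooth_integrable smooth_functions_mult u(1) div)
  also have "\<dots> = - (\<integral>q. (\<Sum>p\<in>F. along V (u p) q) \<partial>vol)"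
    by (subst Bochner_Integration.integral_sum) (simp_all add: sum_negf smooth_integrable along_smooth V u(1))
  also have "(\<lambda>q. \<Sum>p\<in>F. along V (u p) q) = (\<lambda>q. 0)"
    using along_sum[OF F, of u V] u(1) by (simp add: u(2) along_const)
  finally show ?thesis by simp
qed

lemma along_scale:
  assumes "f \<in> smooth_functions A"
  shows "along (\<lambda>c p. r p *\<^sub>R V c p) f p = r p * along V f p"
proof -
  have "in_chart (chart_at A p) f differentiable (at (coord (chart_at A p) p))"
    using smooth_in_chart_differentiable[of UNIV] assms chart_at[of p] by (simp add: smooth_functions_iff)
  then show ?thesis using linear_cmul[OF linear_frechet_derivative] by (fastforce simp: along_def Let_def)
qed

text \<open>The energy argument: by the divergence theorem for \<open>\<phi> \<rho> \<nabla>\<phi>\<close>, the integral of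
  \<open>\<rho> |\<nabla>\<phi>|\<^sup>2\<close> vanishes.\<close>

lemma weighted_divergence_injective:
  assumes W: "W \<in> gradient_fields A g" and \<rho>: "\<rho> \<in> smooth_functions A" "\<And>p. 0 < \<rho> p"
    and 0: "\<And>p. TD_vec A g \<rho> W p = 0"
  shows "W = 0"
proof -
  obtain \<phi> where \<phi>: "\<phi> \<in> smooth_functions A" "W = grad A g \<phi>"
    using W unfolding gradient_fields_def by auto
  have V: "smooth_field W" using grad_smooth_field \<phi> by simp
  have rV: "smooth_field (\<lambda>c p. \<rho> p *\<^sub>R W c p)" by (rule smooth_field_scale[OF \<rho>(1) V])
  have "divergence A g (\<lambda>c p. \<phi> p *\<^sub>R (\<rho> p *\<^sub>R W c p)) p = \<rho> p * along W \<phi> p" for p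
    using divergence_scale[OF rV \<phi>(1), of p] 0[of p] along_scale[OF \<phi>(1), of \<rho> W p] by (simp add: TD_vec_def)
  then have "(\<integral>p. \<rho> p * along W \<phi> p \<partial>vol) = 0"
    using divergence_integral_0[OF smooth_field_scale[OF \<phi>(1) rV]] by simp
  then have "\<rho> p * along W \<phi> p = 0" for p
  proof (rule integral_nonneg_eq_0[rotated 2])
    show "(\<lambda>p. \<rho> p * along W \<phi> p) \<in> smooth_functions A"
      by (intro smooth_functions_mult along_smooth V \<rho> \<phi>)
    show "0 \<le> \<rho> p * along W \<phi> p" for p
      using \<rho>(2)[of p] along_grad_nonneg[OF \<phi>(1), of p] \<phi>(2) by simp
  qed
  then have "along W \<phi> p = 0" for p using \<rho>(2)[of p] by (metis less_irrefl mult_eq_0_iff)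
  then have "W c p = 0" for c p
    using grad_eq_0_if_along_eq_0[OF \<phi>(1), of p c] \<phi>(2) by (cases "c \<in> A \<and> p \<in> patch c") (auto simp: grad_def)
  then show ?thesis by (simp add: fun_eq_iff)
qed

end

section \<open>Directional derivatives in Frechet spaces\<close>

lemma topspace_seminorm_topology:
  assumes "P \<noteq> {}" "\<And>p. p \<in> P \<Longrightarrow> p 0 = 0"
  shows "topspace (seminorm_topology E P) = E"
proof -
  have "x \<in> \<Union>{{y \<in> E. p (y - x) < e} | p x e. p \<in> P \<and> x \<in> E \<and> 0 < e}" if x: "x \<in> E" for x
  proof -
    obtain p where p: "p \<in> P" using assms(1) by blast
    have "x \<in> {y \<in> E. p (y - x) < 1}" using x assms(2)[OF p] by simp
    moreover have "{y \<in> E. p (y - x) < 1} \<in> {{y \<in> E. p (y - x) < e} | p x e. p \<in> P \<and> x \<in> E \<and> 0 < e}"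
      using p x zero_less_one by blast
    ultimately show ?thesis by blast
  qed
  then show ?thesis
    unfolding seminorm_topology_def topology_generated_by_topspace by auto
qed

lemma Hausdorff_seminorm_topology:
  assumes zero: "\<And>p. p \<in> P \<Longrightarrow> p 0 = 0"
    and separate: "\<And>x y. x \<in> E \<Longrightarrow> y \<in> E \<Longrightarrow> x \<noteq> y \<Longrightarrow>
      \<exists>p\<in>P. 0 < p (x - y) \<and> (\<forall>z. p (x - y) \<le> p (z - x) + p (z - y))"
  shows "Hausdorff_space (seminorm_topology E P)"
  unfolding Hausdorff_space_def
proof (intro allI impI)
  fix x y assume xy: "x \<in> topspace (seminorm_topology E P) \<and> y \<in> topspace (seminorm_topology E P) \<and> x \<noteq> y"
  have "topspace (seminorm_topology E P) \<subseteq> E"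
    unfolding seminorm_topology_def topology_generated_by_topspace by blast
  then have E: "x \<in> E" "y \<in> E" "x \<noteq> y" using xy by auto
  then obtain p where p: "p \<in> P" "0 < p (x - y)" "\<And>z. p (x - y) \<le> p (z - x) + p (z - y)"
    using separate by blast
  let ?B = "\<lambda>x. {z \<in> E. p (z - x) < p (x - y) / 2}" and ?C = "{z \<in> E. p (z - y) < p (x - y) / 2}"
  have "openin (seminorm_topology E P) ?C" "openin (seminorm_topology E P) (?B x)"
    unfolding seminorm_topology_def
    by (rule topology_generated_by_Basis, use p E half_gt_zero in blast)+
  moreover have "disjnt (?B x) ?C"
    unfolding disjnt_iff
  proof (intro allI notI)
    fix z assume "z \<in> ?B x \<and> z \<in> ?C"
    then show False using p(3)[of z] by auto
  qed
  ultimately show "\<exists>U V. openin (seminorm_topology E P) U \<and> openin (seminorm_topology E P) V \<and> x \<in> U \<and> y \<in> V \<and> disjnt U V"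
    using E zero[OF p(1)] p(2) by (intro exI[of _ "?B x"] exI[of _ ?C]) simp
qed

lemma dir_deriv_eq:
  assumes "Hausdorff_space T" "has_dir_deriv T F u v l" shows "dir_deriv T F u v = l"
  unfolding dir_deriv_def
proof (rule the_equality)
  show "has_dir_deriv T F u v l" by (rule assms(2))
next
  fix l' assume "has_dir_deriv T F u v l'"
  then show "l' = l"
    using limitin_Hausdorff_unique[OF _ _ trivial_limit_at assms(1)] assms(2)
    unfolding has_dir_deriv_def by blast
qed

text \<open>All functions differentiated below are affine along the line in question, up to an open
  condition on the parameter.\<close>

lemma has_dir_deriv_affine:
  assumes "l \<in> topspace T" "\<forall>\<^sub>F t in at 0. F (u + t *\<^sub>R v) = F u + t *\<^sub>R l"
  shows "has_dir_deriv T F u v l"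
  unfolding has_dir_deriv_def limitin_def
proof (intro conjI allI impI assms(1))
  fix U assume U: "openin T U \<and> l \<in> U"
  have "\<forall>\<^sub>F t::real in at 0. t \<noteq> 0" by (auto simp: eventually_at_filter)
  with assms(2) show "\<forall>\<^sub>F t in at 0. (1 / t) *\<^sub>R (F (u + t *\<^sub>R v) - F u) \<in> U"
    by eventually_elim (use U in simp)
qed

lemma has_dir_deriv_const: "0 \<in> topspace T \<Longrightarrow> has_dir_deriv T (\<lambda>_. a) u v 0"
  by (rule has_dir_deriv_affine) simp_all

lemma frechet_smooth_const:
  assumes T: "Hausdorff_space T" and a: "a \<in> topspace T" "0 \<in> topspace T"
  shows "frechet_smooth TU TE T (\<lambda>_. a)"
proof -
  have eq: "iter_dir_deriv T (\<lambda>_. a) k = (\<lambda>u v. if k = 0 then a else 0)" for k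
    by (induction k) (simp_all add: dir_deriv_eq[OF T has_dir_deriv_const[OF a(2)]])
  have "has_dir_deriv T (\<lambda>z. iter_dir_deriv T (\<lambda>_. a) k z v) u (v k) (iter_dir_deriv T (\<lambda>_. a) (Suc k) u v)" for k u v
    by (simp only: eq) (simp add: has_dir_deriv_const[OF a(2)])
  moreover have "continuous_map S T (\<lambda>(u, v). iter_dir_deriv T (\<lambda>_. a) k u v)" for S k
    using a by (simp add: eq case_prod_unfold)
  ultimately show ?thesis unfolding frechet_smooth_def by blast
qed

text \<open>The seminorms of single points are the absolute values at these points; they separate functions.\<close>

lemma chart_seminorm_singleton: "chart_seminorm c {y} [] h = norm (in_chart c h y)"
  by (simp add: chart_seminorm_def)

context ordered_closed_riemannian_manifold
begin

lemma iter_partial_zero: "iter_partial is (\<lambda>_. 0 :: 'w::real_normed_vector) = (\<lambda>_. 0)"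
proof (induction "is")
  case (Cons i "is")
  then show ?case by (simp only: iter_partial.simps) (simp add: partial_deriv_def[abs_def])
qed simp

lemma chart_seminorm_zero: "K \<noteq> {} \<Longrightarrow> chart_seminorm c K is (0 :: 'a \<Rightarrow> 'w::real_normed_vector) = 0"
  by (simp add: chart_seminorm_def in_chart_def zero_fun_def iter_partial_zero)

lemma
  shows topspace_smooth_topology: "topspace (smooth_topology A) = smooth_functions A"
    and Hausdorff_smooth_topology: "Hausdorff_space (smooth_topology A)"
proof -
  let ?P = "{chart_seminorm c K is | c K is. c \<in> A \<and> compact K \<and> K \<noteq> {} \<and> K \<subseteq> coord c ` patch c} :: (('a \<Rightarrow> real) \<Rightarrow> real) set"
  have P: "chart_seminorm (chart_at A p) {coord (chart_at A p) p} [] \<in> ?P" for p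
    using chart_at[of p]
    by (intro CollectI exI[of _ "chart_at A p"] exI[of _ "{coord (chart_at A p) p}"] exI[of _ "[]"]) simp
  have z: "p 0 = 0" if "p \<in> ?P" for p using that chart_seminorm_zero by blast
  show "topspace (smooth_topology A) = smooth_functions A"
    unfolding smooth_topology_def
  proof (rule topspace_seminorm_topology)
    show "?P \<noteq> {}" by (rule ex_in_conv[THEN iffD1], rule exI, rule P)
  qed (rule z)
  show "Hausdorff_space (smooth_topology A)"
    unfolding smooth_topology_def
  proof (rule Hausdorff_seminorm_topology, erule z)
    fix x y :: "'a \<Rightarrow> real" assume "x \<noteq> y"
    then obtain p where "x p \<noteq> y p" by blast
    then show "\<exists>p\<in>?P. 0 < p (x - y) \<and> (\<forall>z. p (x - y) \<le> p (z - x) + p (z - y))"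
      by (intro bexI[OF _ P[of p]]) (auto simp: chart_seminorm_singleton in_chart_coord chart_at)
  qed
qed

lemma gradient_field_outside: "V \<in> gradient_fields A g \<Longrightarrow> \<not> (c \<in> A \<and> p \<in> patch c) \<Longrightarrow> V c p = 0"
  by (auto simp: gradient_fields_def grad_def)

lemma
  shows topspace_gradient_topology: "topspace (gradient_topology A g) = gradient_fields A g"
    and Hausdorff_gradient_topology: "Hausdorff_space (gradient_topology A g)"
proof -
  let ?P = "{\<lambda>V. chart_seminorm c K is (V c) | c K is. c \<in> A \<and> compact K \<and> K \<noteq> {} \<and> K \<subseteq> coord c ` patch c} :: (('a, 'n) vfield \<Rightarrow> real) set"
  have P: "(\<lambda>V. chart_seminorm c {coord c p} [] (V c)) \<in> ?P" if "c \<in> A" "p \<in> patch c" for c p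
    using that by (intro CollectI exI[of _ c] exI[of _ "{coord c p}"] exI[of _ "[]"]) simp
  have z: "p 0 = 0" if p: "p \<in> ?P" for p
  proof -
    obtain c K "is" where "p = (\<lambda>V. chart_seminorm c K is (V c))" "K \<noteq> {}" using p by blast
    then show ?thesis using chart_seminorm_zero[of K c "is"] by simp
  qed
  show "topspace (gradient_topology A g) = gradient_fields A g"
    unfolding gradient_topology_def
  proof (rule topspace_seminorm_topology)
    show "?P \<noteq> {}" by (rule ex_in_conv[THEN iffD1], rule exI, rule P[OF chart_at])
  qed (rule z)
  show "Hausdorff_space (gradient_topology A g)"
    unfolding gradient_topology_def
  proof (rule Hausdorff_seminorm_topology, erule z)
    fix x y :: "('a, 'n) vfield"
    assume xy: "x \<in> gradient_fields A g" "y \<in> gradient_fields A g" "x \<noteq> y"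
    then obtain c p where cp: "x c p \<noteq> y c p" by blast
    then have c: "c \<in> A" "p \<in> patch c" using gradient_field_outside[OF xy(1)] gradient_field_outside[OF xy(2)] by metis+
    have "norm (x c p - y c p) \<le> norm (z c p - x c p) + norm (z c p - y c p)" for z :: "('a, 'n) vfield"
      using norm_triangle_ineq4[of "z c p - y c p" "z c p - x c p"] by simp
    then show "\<exists>p\<in>?P. 0 < p (x - y) \<and> (\<forall>z. p (x - y) \<le> p (z - x) + p (z - y))"
      using cp by (intro bexI[OF _ P[OF c]]) (simp add: chart_seminorm_singleton in_chart_coord c)
  qed
qed

lemma
  shows topspace_TTD_topology: "topspace (TTD_topology A g) = TTD A g"
    and Hausdorff_TTD_topology: "Hausdorff_space (TTD_topology A g)"
proof -
  have "zero_mean A g \<subseteq> smooth_functions A" by (auto simp: zero_mean_def)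
  then show "topspace (TTD_topology A g) = TTD A g"
    by (simp add: TTD_topology_def TTD_def topspace_smooth_topology Hausdorff_smooth_topology topspace_gradient_topology Hausdorff_gradient_topology inf.absorb2)
  show "Hausdorff_space (TTD_topology A g)"
    by (simp add: TTD_topology_def Hausdorff_space_prod_topology Hausdorff_space_subtopology
        topspace_smooth_topology Hausdorff_smooth_topology topspace_gradient_topology Hausdorff_gradient_topology)
qed

section \<open>The almost complex structure on vertical vectors\<close>

lemma zero_in_gradient_fields: "0 \<in> gradient_fields A g"
proof -
  have "grad A g (\<lambda>_. 0) c p = 0" for c p
  proof (cases "c \<in> A \<and> p \<in> patch c")
    case True
    then have "grad A g (\<lambda>_. 0) c p \<bullet> (g c p *v grad A g (\<lambda>_. 0) c p) = 0"
      using grad_inner[OF smooth_functions_const[of 0], of c p] by (simp add: in_chart_def)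
    then show ?thesis using metric_pos_def[of c p] True by force
  qed (auto simp: grad_def)
  then have "0 = grad A g (\<lambda>_. 0)" by (simp add: fun_eq_iff)
  then show ?thesis unfolding gradient_fields_def using smooth_functions_const by blast
qed

lemma gradient_field_smooth: "W \<in> gradient_fields A g \<Longrightarrow> smooth_field W"
  unfolding gradient_fields_def using grad_smooth_field by auto

lemma TD_vec_eq:
  "W \<in> gradient_fields A g \<Longrightarrow> \<rho> \<in> smooth_functions A \<Longrightarrow>
    TD_vec A g \<rho> W p = \<rho> p * divergence A g W p + along W \<rho> p"
  by (simp add: TD_vec_def divergence_scale gradient_field_smooth)

lemma TD_vec_smooth:
  "W \<in> gradient_fields A g \<Longrightarrow> \<rho> \<in> smooth_functions A \<Longrightarrow> TD_vec A g \<rho> W \<in> smooth_functions A"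
  unfolding TD_vec_def by (intro divergence_smooth smooth_field_scale gradient_field_smooth)

lemma TD_vec_zero_mean:
  "W \<in> gradient_fields A g \<Longrightarrow> \<rho> \<in> smooth_functions A \<Longrightarrow> TD_vec A g \<rho> W \<in> zero_mean A g"
  using TD_vec_smooth[of W \<rho>] divergence_integral_0[OF smooth_field_scale[OF _ gradient_field_smooth]]
  by (simp add: zero_mean_def TD_vec_def)

lemma zero_mean_minus: "f \<in> zero_mean A g \<Longrightarrow> - f \<in> zero_mean A g"
  using smooth_functions_minus[of f] by (simp add: zero_mean_def fun_Compl_def)

lemma zero_in_zero_mean: "0 \<in> zero_mean A g"
  using smooth_functions_const[of 0] by (simp add: zero_mean_def zero_fun_def)

lemma along_add:
  assumes "f \<in> smooth_functions A" "h \<in> smooth_functions A"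
  shows "along V (\<lambda>q. f q + h q) p = along V f p + along V h p"
  using along_sum[of "UNIV :: bool set" "\<lambda>b. if b then f else h" V p] assms by (simp add: UNIV_bool add.commute)

lemma TD_vec_affine:
  assumes "W \<in> gradient_fields A g" "\<rho> \<in> smooth_functions A" "f \<in> smooth_functions A"
  shows "TD_vec A g (\<rho> + t *\<^sub>R f) W = TD_vec A g \<rho> W + t *\<^sub>R TD_vec A g f W"
proof
  fix p
  have eq: "\<rho> + t *\<^sub>R f = (\<lambda>p. \<rho> p + t * f p)" by (simp add: fun_eq_iff)
  have sm: "(\<lambda>p. t * f p) \<in> smooth_functions A" by (intro smooth_functions_mult smooth_functions_const assms)
  have "along W (\<lambda>p. \<rho> p + t * f p) p = along W \<rho> p + t * along W f p"
    using along_add[OF assms(2) sm] along_mult[OF smooth_functions_const assms(3)] by (simp add: along_const)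
  then show "TD_vec A g (\<rho> + t *\<^sub>R f) W p = (TD_vec A g \<rho> W + t *\<^sub>R TD_vec A g f W) p"
    unfolding eq using TD_vec_eq[OF assms(1) smooth_functions_add[OF assms(2) sm]] TD_vec_eq[OF assms(1)] assms(2,3)
    by (simp add: algebra_simps)
qed

lemma TD_vec_zero_field: "\<rho> \<in> smooth_functions A \<Longrightarrow> TD_vec A g \<rho> 0 = 0"
proof
  fix p assume "\<rho> \<in> smooth_functions A"
  have "smooth_field (0 :: ('a, 'n) vfield)" by (rule gradient_field_smooth[OF zero_in_gradient_fields])
  from divergence_scale[OF this smooth_functions_const[of 0], of p]
  show "TD_vec A g \<rho> 0 p = 0 p" by (simp add: TD_vec_def along_const)
qed

text \<open>In general the value of \<open>J\<close> at \<open>(f, W)\<close> has as second component the gradient field \<open>U\<close> that solves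
  the elliptic equation \<open>div (\<rho> U) = f\<close>. For vertical vectors, where \<open>f = 0\<close>, existence is trivial and
  only the uniqueness of \<open>U\<close> has to be known.\<close>

lemma J_TD_vertical:
  assumes \<rho>: "\<rho> \<in> smooth_functions A" "\<And>p. 0 < \<rho> p" and W: "W \<in> gradient_fields A g"
  shows "J_TD A g (\<rho>, V) (0, W) = (- TD_vec A g \<rho> W, 0)"
proof -
  have "J_TD A g (\<rho>, V) (0, W)
      = (THE C. C \<in> TTD A g \<and> fst C = - TD_vec A g \<rho> W \<and> TD_vec A g \<rho> (snd C) = 0)"
    by (simp add: J_TD_def dombrowski_def connector_D_def)
  also have "\<dots> = (- TD_vec A g \<rho> W, 0)"
  proof (rule the_equality)
    show "(- TD_vec A g \<rho> W, 0) \<in> TTD A g \<and> fst (- TD_vec A g \<rho> W, 0) = - TD_vec A g \<rho> W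
        \<and> TD_vec A g \<rho> (snd (- TD_vec A g \<rho> W, 0)) = 0"
      using zero_mean_minus[OF TD_vec_zero_mean[OF W \<rho>(1)]] zero_in_gradient_fields TD_vec_zero_field[OF \<rho>(1)]
      by (simp add: TTD_def)
  next
    fix C assume C: "C \<in> TTD A g \<and> fst C = - TD_vec A g \<rho> W \<and> TD_vec A g \<rho> (snd C) = 0"
    then have "snd C \<in> gradient_fields A g" by (auto simp: TTD_def)
    then have "snd C = 0" using C by (intro weighted_divergence_injective[OF _ \<rho>]) simp_all
    then show "C = (- TD_vec A g \<rho> W, 0)" using C by (simp add: prod_eq_iff)
  qed
  finally show ?thesis .
qed

section \<open>The Nijenhuis tensor\<close>

text \<open>\<open>J\<close> turns the two constant vertical fields into fields which only depend on the density. So the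
  mixed brackets vanish, and the outer \<open>J\<close> in the Nijenhuis tensor is applied to zero vectors only.\<close>

lemma nijenhuis_vertical:
  assumes \<rho>: "\<rho> \<in> smooth_functions A" "\<And>p. 0 < \<rho> p"
    and a: "a \<in> gradient_fields A g" and b: "b \<in> gradient_fields A g"
  shows "nijenhuis A g (J_TD A g) (\<lambda>_. (0, a)) (\<lambda>_. (0, b)) (\<rho>, V)
    = (TD_vec A g (TD_vec A g \<rho> b) a - TD_vec A g (TD_vec A g \<rho> a) b, 0)"
proof -
  let ?T = "TTD_topology A g" and ?u = "(\<rho>, V)"
  let ?J = "\<lambda>W z. J_TD A g z (0, W)"
  note H = Hausdorff_TTD_topology
  have zero: "0 \<in> topspace ?T"
    using zero_in_zero_mean zero_in_gradient_fields by (simp add: topspace_TTD_topology TTD_def zero_prod_def)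
  have const: "dir_deriv ?T (\<lambda>_. B) ?u v = 0" for B v
    using dir_deriv_eq[OF H has_dir_deriv_const[OF zero]] .
  have Ju: "?J W ?u = (- TD_vec A g \<rho> W, 0)" if "W \<in> gradient_fields A g" for W
    by (rule J_TD_vertical[OF \<rho> that])
  have along_vertical: "dir_deriv ?T (?J W) ?u (0, W') = 0" if "W \<in> gradient_fields A g" for W W'
    by (rule dir_deriv_eq[OF H has_dir_deriv_affine[OF zero]])
      (simp add: J_TD_vertical[OF \<rho> that])
  have along_horizontal: "dir_deriv ?T (?J W) ?u (- f, 0) = (TD_vec A g f W, 0)"
    if W: "W \<in> gradient_fields A g" and f: "f \<in> smooth_functions A" for W f
  proof (rule dir_deriv_eq[OF H has_dir_deriv_affine])
    show "(TD_vec A g f W, 0) \<in> topspace ?T"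
      using TD_vec_zero_mean[OF W f] zero_in_gradient_fields by (simp add: topspace_TTD_topology TTD_def)
    \<comment> \<open>By compactness, \<open>\<rho> - t f\<close> is positive for small \<open>t\<close>; this is where \<open>J_TD_vertical\<close> applies.\<close>
    obtain B where B: "\<And>p. \<bar>f p\<bar> \<le> B" using smooth_function_bounded[OF f] by blast
    have "compact (range \<rho>)"
      using compact_continuous_image[OF smooth_functions_continuous_on[OF \<rho>(1)] compact_M] .
    then obtain r where r: "r \<in> range \<rho>" "\<And>p. r \<le> \<rho> p"
      using compact_attains_inf[of "range \<rho>"] by auto
    have r0: "0 < r" using r(1) \<rho>(2) by auto
    have B0: "0 \<le> B" using B[of undefined] by linarith
    have "((\<lambda>t. \<bar>t\<bar> * B) \<longlongrightarrow> \<bar>0::real\<bar> * B) (at 0)" by (intro tendsto_intros)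
    then have "\<forall>\<^sub>F t in at 0. \<bar>t\<bar> * B < r" using r0 by (simp add: order_tendsto_iff)
    then show "\<forall>\<^sub>F t in at 0. ?J W (?u + t *\<^sub>R (- f, 0)) = ?J W ?u + t *\<^sub>R (TD_vec A g f W, 0)"
    proof eventually_elim
      fix t :: real assume t: "\<bar>t\<bar> * B < r"
      have eq: "\<rho> + (- t) *\<^sub>R f = (\<lambda>p. \<rho> p - t * f p)" by (simp add: fun_eq_iff)
      have sm: "\<rho> + (- t) *\<^sub>R f \<in> smooth_functions A"
        unfolding eq by (intro smooth_functions_diff smooth_functions_mult smooth_functions_const \<rho> f)
      have pos: "0 < (\<rho> + (- t) *\<^sub>R f) p" for p
      proof -
        have "\<bar>t * f p\<bar> \<le> \<bar>t\<bar> * B" unfolding abs_mult using B by (intro mult_left_mono) auto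
        then show ?thesis using t r(2)[of p] by (simp add: abs_le_iff)
      qed
      have "?u + t *\<^sub>R (- f, 0) = (\<rho> + (- t) *\<^sub>R f, V)" by simp
      moreover have "?J W (\<rho> + (- t) *\<^sub>R f, V) = (- TD_vec A g (\<rho> + (- t) *\<^sub>R f) W, 0)"
        by (rule J_TD_vertical[OF sm pos W])
      ultimately have "?J W (?u + t *\<^sub>R (- f, 0)) = (- TD_vec A g (\<rho> + (- t) *\<^sub>R f) W, 0)" by metis
      then show "?J W (?u + t *\<^sub>R (- f, 0)) = ?J W ?u + t *\<^sub>R (TD_vec A g f W, 0)"
        using TD_vec_affine[OF W \<rho>(1) f, of "- t"] Ju[OF W] by simp
    qed
  qed
  have J0: "J_TD A g ?u 0 = 0"
    using Ju[OF zero_in_gradient_fields] TD_vec_zero_field[OF \<rho>(1)] by (simp add: zero_prod_def)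
  have "lie_bracket A g (?J a) (?J b) ?u = (TD_vec A g (TD_vec A g \<rho> a) b - TD_vec A g (TD_vec A g \<rho> b) a, 0)"
    using along_horizontal[OF b TD_vec_smooth[OF a \<rho>(1)]] along_horizontal[OF a TD_vec_smooth[OF b \<rho>(1)]]
    by (simp add: lie_bracket_def Ju a b)
  moreover have "lie_bracket A g (?J a) (\<lambda>_. (0, b)) ?u = 0" "lie_bracket A g (\<lambda>_. (0, a)) (?J b) ?u = 0"
    using along_vertical a b by (simp_all add: lie_bracket_def const)
  moreover have "lie_bracket A g (\<lambda>_. (0, a)) (\<lambda>_. (0, b)) ?u = 0"
    by (simp add: lie_bracket_def const)
  ultimately show ?thesis
    by (simp add: nijenhuis_def Let_def J0)
qed

text \<open>A bump function that vanishes at one point of a coordinate ball and is positive at another one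
  cannot have zero gradient on that ball.\<close>

lemma exists_nondegenerate_zero:
  obtains s p where "s \<in> smooth_functions A" "s p = 0" "along (grad A g s) s p \<noteq> 0"
proof -
  fix p\<^sub>0 :: 'a
  let ?c = "chart_at A p\<^sub>0"
  note c = chart_at[of p\<^sub>0]
  obtain r where r: "r > 0" "ball (coord ?c p\<^sub>0) r \<subseteq> coord_image ?c"
    using open_coord_image[OF c(1)] c(2) open_contains_ball by blast
  define y where "y = coord ?c p\<^sub>0 + (r / 2) *\<^sub>R axis undefined 1"
  have y: "y \<in> ball (coord ?c p\<^sub>0) r" "y \<noteq> coord ?c p\<^sub>0" using r(1) by (auto simp: y_def dist_norm)
  have "inv_coord ?c y \<noteq> p\<^sub>0" using y r(2) coord_inv_coord[of y ?c] by auto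
  then obtain b where b: "b \<in> smooth_functions A" "0 < b p\<^sub>0" "b (inv_coord ?c y) = 0"
  proof -
    assume ne: "inv_coord ?c y \<noteq> p\<^sub>0"
    have "open (- {inv_coord ?c y})" by (rule open_Compl) simp
    then obtain b K where "b \<in> smooth_functions A" "0 < b p\<^sub>0" "K \<subseteq> - {inv_coord ?c y}" "\<And>q. q \<notin> K \<Longrightarrow> b q = 0"
      by (rule bump_around[of "- {inv_coord ?c y}" p\<^sub>0]) (use ne in auto)
    then show ?thesis using that[of b] by blast
  qed
  \<comment> \<open>Subtracting the value \<open>b p\<close> turns any point \<open>p\<close> into a zero and keeps the gradient.\<close>
  have "\<exists>p. along (grad A g (\<lambda>q. b q - b p)) (\<lambda>q. b q - b p) p \<noteq> 0"
  proof (rule ccontr)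
    assume "\<nexists>p. along (grad A g (\<lambda>q. b q - b p)) (\<lambda>q. b q - b p) p \<noteq> 0"
    then have 0: "along (grad A g (\<lambda>q. b q - b p)) (\<lambda>q. b q - b p) p = 0" for p by blast
    have "(in_chart ?c b has_derivative (\<lambda>_. 0)) (at z within ball (coord ?c p\<^sub>0) r)"
      if z: "z \<in> ball (coord ?c p\<^sub>0) r" for z
    proof -
      define p where "p = inv_coord ?c z"
      let ?s = "\<lambda>q. b q - b p"
      have p: "p \<in> patch ?c" "coord ?c p = z"
        using z r(2) inv_coord_in_patch[of z ?c] coord_inv_coord[of z ?c] by (auto simp: p_def)
      have s: "?s \<in> smooth_functions A" by (intro smooth_functions_diff b smooth_functions_const)
      have "grad A g ?s ?c p = 0" by (rule grad_eq_0_if_along_eq_0[OF s 0 c(1) p(1)])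
      then have "frechet_derivative (in_chart ?c ?s) (at z) = (\<lambda>_. 0)"
        using grad_inner[OF s c(1) p(1)] p(2) by (simp add: fun_eq_iff)
      moreover have "in_chart ?c ?s differentiable (at z)"
        using smooth_in_chart_differentiable[of UNIV ?s ?c p] s c(1) p by (simp add: smooth_functions_iff)
      ultimately have "(in_chart ?c ?s has_derivative (\<lambda>_. 0)) (at z)" by (simp add: frechet_derivative_works)
      from has_derivative_add[OF this has_derivative_const[of "b p"]]
      show ?thesis by (simp add: in_chart_def has_derivative_at_withinI)
    qed
    from has_derivative_zero_unique[OF convex_ball this y(1), of "coord ?c p\<^sub>0"]
    have "in_chart ?c b (coord ?c p\<^sub>0) = in_chart ?c b y" using r(1) by simp
    then show False using b inv_coord_coord[OF c] by (simp add: in_chart_def)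
  qed
  then obtain p where "along (grad A g (\<lambda>q. b q - b p)) (\<lambda>q. b q - b p) p \<noteq> 0" by blast
  then show ?thesis
    using that[of "\<lambda>q. b q - b p" p] smooth_functions_diff[OF b(1) smooth_functions_const[of "b p"]] by simp
qed

text \<open>At a zero \<open>p\<close> of \<open>s\<close>, all terms with a factor \<open>s\<close> drop out, and only
  \<open>\<nabla>s (div (k \<nabla>(s\<^sup>3))) = 6 k |\<nabla>s|\<^sup>4\<close> remains.\<close>

lemma commutator_at_zero:
  fixes k :: real
  assumes s: "s \<in> smooth_functions A" "s p = 0"
  defines "b \<equiv> grad A g s" and "a \<equiv> grad A g (\<lambda>q. s q * (s q * s q))" and "\<rho> \<equiv> \<lambda>_. k"
  shows "TD_vec A g (TD_vec A g \<rho> b) a p = 0"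
    and "TD_vec A g (TD_vec A g \<rho> a) b p = 6 * k * (along b s p * along b s p)"
proof -
  note sm = smooth_functions_mult smooth_functions_const smooth_functions_add s(1)
  have b: "b \<in> gradient_fields A g" using s unfolding gradient_fields_def b_def by blast
  have L: "along b s \<in> smooth_functions A" by (rule along_smooth[OF gradient_field_smooth[OF b] s(1)])
  have D: "divergence A g b \<in> smooth_functions A" by (rule divergence_smooth[OF gradient_field_smooth[OF b]])
  have a: "TD_vec A g f a = TD_vec A g (\<lambda>q. f q * (3 * (s q * s q))) b" for f
    unfolding a_def b_def grad_cube[OF s(1)] TD_vec_def by simp
  have cube: "along b (\<lambda>q. f q * (3 * (s q * s q))) q
      = f q * (6 * (s q * along b s q)) + 3 * (s q * s q) * along b f q" if "f \<in> smooth_functions A" for f q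
    using that by (simp add: along_mult along_const sm algebra_simps)
  have f: "TD_vec A g \<rho> b \<in> smooth_functions A" unfolding \<rho>_def by (intro TD_vec_smooth b sm)
  have f': "(\<lambda>q. TD_vec A g \<rho> b q * (3 * (s q * s q))) \<in> smooth_functions A" by (intro sm f)
  show "TD_vec A g (TD_vec A g \<rho> b) a p = 0"
    unfolding a TD_vec_eq[OF b f'] cube[OF f] by (simp add: s(2))
  let ?h = "\<lambda>q. 3 * k * (s q * divergence A g b q) + 6 * k * along b s q"
  have h: "?h \<in> smooth_functions A" by (intro sm D L)
  have r: "(\<lambda>q. \<rho> q * (3 * (s q * s q))) \<in> smooth_functions A" unfolding \<rho>_def by (intro sm)
  have rho: "\<rho> \<in> smooth_functions A" unfolding \<rho>_def by (rule smooth_functions_const)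
  have "TD_vec A g \<rho> a = (\<lambda>q. s q * ?h q)"
    unfolding a fun_eq_iff TD_vec_eq[OF b r] cube[OF rho]
    by (simp add: \<rho>_def along_const algebra_simps)
  then show "TD_vec A g (TD_vec A g \<rho> a) b p = 6 * k * (along b s p * along b s p)"
    using TD_vec_eq[OF b smooth_functions_mult[OF s(1) h], of p] along_mult[OF s(1) h, of b p]
    by (simp add: s(2))
qed

theorem nijenhuis_J_TD_nonzero:
  "\<exists>X \<in> vector_fields_TD A g. \<exists>Y \<in> vector_fields_TD A g. \<exists>u \<in> TD A g.
    nijenhuis A g (J_TD A g) X Y u \<noteq> 0"
proof -
  interpret finite_measure vol by (rule finite_measure_vol)
  obtain s p where s: "s \<in> smooth_functions A" "s p = 0" "along (grad A g s) s p \<noteq> 0"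
    using exists_nondegenerate_zero by blast
  \<comment> \<open>The value of the uniform density.\<close>
  define k where "k = 1 / measure vol UNIV"
  have "0 < measure vol UNIV"
    using emeasure_vol_open_pos[OF open_UNIV UNIV_I] by (simp add: zero_less_measure_iff emeasure_eq_measure)
  then have k: "0 < k" "k * measure vol UNIV = 1" by (simp_all add: k_def)
  let ?b = "grad A g s" and ?a = "grad A g (\<lambda>q. s q * (s q * s q))" and ?\<rho> = "\<lambda>_::'a. k"
  have ab: "?a \<in> gradient_fields A g" "?b \<in> gradient_fields A g"
    unfolding gradient_fields_def using s(1) smooth_functions_mult by blast+
  have field: "(\<lambda>_. (0, W)) \<in> vector_fields_TD A g" if "W \<in> gradient_fields A g" for W
    unfolding vector_fields_TD_def using that zero_in_zero_mean zero_in_gradient_fields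
    by (auto simp: topspace_TTD_topology Hausdorff_TTD_topology TTD_def zero_prod_def intro!: frechet_smooth_const)
  have u: "(?\<rho>, 0) \<in> TD A g"
    using k smooth_functions_const[of k] zero_in_gradient_fields
    by (simp add: TD_def densities_def space_vol mult.commute)
  have "nijenhuis A g (J_TD A g) (\<lambda>_. (0, ?a)) (\<lambda>_. (0, ?b)) (?\<rho>, 0)
      = (TD_vec A g (TD_vec A g ?\<rho> ?b) ?a - TD_vec A g (TD_vec A g ?\<rho> ?a) ?b, 0)"
    by (rule nijenhuis_vertical[OF smooth_functions_const k(1) ab])
  moreover have "(TD_vec A g (TD_vec A g ?\<rho> ?b) ?a - TD_vec A g (TD_vec A g ?\<rho> ?a) ?b) p \<noteq> 0"
    using commutator_at_zero[OF s(1,2), of k] s(3) k(1) by simp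
  ultimately have "nijenhuis A g (J_TD A g) (\<lambda>_. (0, ?a)) (\<lambda>_. (0, ?b)) (?\<rho>, 0) \<noteq> 0"
    by (auto simp: zero_prod_def)
  then show ?thesis using field ab u by blast
qed

end

theorem corollary5p6:
  fixes A :: "('a::t2_space, 'n::{finite, wellorder}) chart set"
    and g :: "('a, 'n) chart \<Rightarrow> 'a \<Rightarrow> real ^ 'n::_ ^ 'n::_"
  assumes "closed_oriented_riemannian_manifold A g"
  shows "\<exists>X \<in> vector_fields_TD A g. \<exists>Y \<in> vector_fields_TD A g. \<exists>u \<in> TD A g.
    nijenhuis A g (J_TD A g) X Y u \<noteq> 0"
proof -
  interpret ordered_closed_riemannian_manifold A g
    using assms by (rule ordered_closed_riemannian_manifold.intro)
  show ?thesis by (rule nijenhuis_J_TD_nonzero)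
qed

end
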